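(* Let $X$ be a conservative CBI-process with functional characteristics $(F,R)$, where $F$ has parameters $(b,m)$ and $R$ has parameters $(\alpha,\beta,\mu)$, and suppose that $X$ converges to a limit distribution $L$. Let $W$ be the scale function of $\widehat X^R=-X^R$, let $k(x)=b\,W'_+(x)+\int_{(0,\infty)}[W(x)-W(x-\xi)]\,m(\mathrm{d}\xi)$ for $x>0$, and let $\gamma=b/\lambda_0$, where $\lambda_0\in(0,\infty]$ is the effective drift of $\widehat X^R$ (with $b/\infty=0$). Suppose that the limit $c=\lim_{x\downarrow0}k(x)$ exists and lies in $(0,\infty)$, and define $$K(x)=\exp\left(\int_x^1\left(c-k(y)\right)\frac{\mathrm{d}y}{y}\right),\qquad x>0.$$ Then $K$ is slowly varying at $0$, and $L$ has a density $f$ with respect to Lebesgue measure satisfying $$f(x)\sim\frac{\kappa}{\Gamma(c)}(x-\gamma)^{c-1}K(x-\gamma)\qquad\text{as }x\downarrow\gamma,$$ where $$\kappa=\exp\left(c\int_0^1(e^{-x}-1)\frac{\mathrm{d}x}{x}+c\int_1^\infty e^{-x}\frac{\mathrm{d}x}{x}-\int_1^\infty k(x)\frac{\mathrm{d}x}{x}\right).$$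
   Context: A conservative CBI-process (continuous-state branching process with immigration) is a stochastically continuous Markov process $X=(X_t)_{t\ge0}$ with state space $[0,\infty)$ such that $-\log\mathbb{E}^x[e^{-uX_t}]=\phi(t,u)+x\psi(t,u)$ for all $t,u,x\ge 0$ and some functions $\phi,\psi$. By Kawazu–Watanabe, the derivatives $F(u)=\partial_t\phi(t,u)|_{t=0}$, $R(u)=\partial_t\psi(t,u)|_{t=0}$ exist and have the form $$F(u)=bu-\int_{(0,\infty)}(e^{-u\xi}-1)\,m(\mathrm{d}\xi),\qquad R(u)=-\alpha u^2+\beta u-\int_{(0,\infty)}\left(e^{-u\xi}-1+u\xi\mathbf 1_{(0,1]}(\xi)\right)\mu(\mathrm{d}\xi),$$ with $\alpha,b\ge0$, $\beta\in\mathbb{R}$, $m,\mu$ Lévy measures on $(0,\infty)$, $\int(\xi\wedge1)\,m(\mathrm{d}\xi)<\infty$, $\int(\xi^2\wedge 1)\,\mu(\mathrm{d}\xi)<\infty$, and $\int_{0+}\frac{\mathrm{d}s}{\max(R(s),0)}=\infty$ (the integral over an arbitrarily small right neighbourhood of $0$). Moreover $\partial_t\phi=F(\psi)$, $\phi(0,u)=0$, $\partial_t\psi=R(\psi)$, $\psi(0,u)=u$. Conversely, any such pair $(F,R)$ determines a unique conservative CBI-process. $(F,R)$ are its functional characteristics. $X^R$ denotes the Lévy process without negative jumps with $\mathbb{E}[e^{-uX^R_t}]=e^{-tR(u)}$. A probability measure $L$ on $[0,\infty)$ is the limit distribution of $X$ if $X_t\to L$ in distribution as $t\to\infty$ under $\mathbb{P}^x$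 for every $x\ge0$. If $L$ exists then $R'_+(0)\le0$, $R\not\equiv0$, $R(u)<0$ for all $u>0$, and $-\log\int e^{-ux}L(\mathrm{d}x)=-\int_0^uF(s)/R(s)\,\mathrm{d}s$ for $u\ge0$. The scale function of $\widehat X^R$ is the unique function $W:\mathbb{R}\to[0,\infty)$ that vanishes on $(-\infty,0)$, is continuous and increasing (non-decreasing) on $[0,\infty)$, and satisfies $\int_0^\infty e^{-ux}W(x)\,\mathrm{d}x=-1/R(u)$ for $u>0$. On $(0,\infty)$ it is strictly positive, absolutely continuous and log-concave; $W'_+$ denotes its right derivative. The Lévy–Khintchine decomposition of $L$ is $-\log\int_{[0,\infty)}e^{-ux}L(\mathrm{d}x)=u\gamma-\int_{(0,\infty)}(e^{-xu}-1)\frac{k(x)}{x}\mathrm{d}x$ with $\gamma=bW(0)=b/\lambda_0$. Effective drift: $\lambda_0=\int_{(0,1]}\xi\,\mu(\mathrm{d}\xi)-\beta$ if $X^R$ has paths of bounded variation (i.e. $\alpha=0$ and $\int_{(0,1]}\xi\mu(\mathrm{d}\xi)<\infty$), and $\lambda_0=+\infty$ otherwise; $\lambda_0>0$ whenever $L$ exists. $K$ is slowly varying at $0$ if $K(ax)/K(x)\to1$ as $x\downarrow0$ for every $a>0$. $g\sim h$ means $g/h\to1$. *)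

theory Defs
  imports "HOL-Probability.Probability"
begin

section \<open>Markov processes on the half-line\<close>

text \<open>
  A process with state space \<open>[0,\<infinity>)\<close> is given by its coordinate maps \<open>X t\<close>, for \<open>t \<ge> 0\<close>, together
  with the family of laws \<open>P x\<close>, for \<open>x \<ge> 0\<close>, on one measurable space. Values at negative times or
  negative starting points are irrelevant throughout.
\<close>

definition natural_filtration :: "(real \<Rightarrow> 'w measure) \<Rightarrow> (real \<Rightarrow> 'w \<Rightarrow> real) \<Rightarrow> real \<Rightarrow> 'w measure" where
  "natural_filtration P X s =
     sigma (space (P 0)) (\<Union>r\<in>{0..s}. {X r -` A \<inter> space (P 0) | A. A \<in> sets borel})"

text \<open>
  The fifth condition says that \<open>x \<mapsto> P x (X t \<in> \<cdot>)\<close> is a probability kernel, the last one is the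
  time-homogeneous Markov property. The processes are conservative: there is no cemetery state.
\<close>

definition markov_process :: "(real \<Rightarrow> 'w measure) \<Rightarrow> (real \<Rightarrow> 'w \<Rightarrow> real) \<Rightarrow> bool" where
  "markov_process P X \<longleftrightarrow>
     (\<forall>x\<ge>0. prob_space (P x) \<and> sets (P x) = sets (P 0)) \<and>
     (\<forall>t\<ge>0. X t \<in> borel_measurable (P 0)) \<and>
     (\<forall>t\<ge>0. \<forall>\<omega>\<in>space (P 0). 0 \<le> X t \<omega>) \<and>
     (\<forall>x\<ge>0. AE \<omega> in P x. X 0 \<omega> = x) \<and>
     (\<forall>t\<ge>0. (\<lambda>x. distr (P x) borel (X t)) \<in> restrict_space borel {0..} \<rightarrow>\<^sub>M prob_algebra borel) \<and>
     (\<forall>x\<ge>0. \<forall>s\<ge>0. \<forall>t\<ge>0. \<forall>A\<in>sets borel.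
        AE \<omega> in P x.
          real_cond_exp (P x) (natural_filtration P X s)
            (indicator {\<omega>\<in>space (P x). X (s + t) \<omega> \<in> A}) \<omega>
          = measure (distr (P (X s \<omega>)) borel (X t)) A)"

definition stochastically_continuous :: "(real \<Rightarrow> 'w measure) \<Rightarrow> (real \<Rightarrow> 'w \<Rightarrow> real) \<Rightarrow> bool" where
  "stochastically_continuous P X \<longleftrightarrow>
     (\<forall>x\<ge>0. \<forall>t\<ge>0. \<forall>\<epsilon>>0.
        ((\<lambda>s. measure (P x) {\<omega>\<in>space (P x). \<epsilon> < \<bar>X s \<omega> - X t \<omega>\<bar>}) \<longlongrightarrow> 0) (at t within {0..}))"

section \<open>Conservative CBI-processes\<close>

definition CBI_exponents ::
    "(real \<Rightarrow> 'w measure) \<Rightarrow> (real \<Rightarrow> 'w \<Rightarrow> real) \<Rightarrow> (real \<Rightarrow> real \<Rightarrow> real) \<Rightarrow> (real \<Rightarrow> real \<Rightarrow> real) \<Rightarrow> bool" where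
  "CBI_exponents P X \<phi> \<psi> \<longleftrightarrow>
     (\<forall>t\<ge>0. \<forall>u\<ge>0. \<forall>x\<ge>0. - ln (LINT \<omega>|P x. exp (- u * X t \<omega>)) = \<phi> t u + x * \<psi> t u)"

definition conservative_CBI :: "(real \<Rightarrow> 'w measure) \<Rightarrow> (real \<Rightarrow> 'w \<Rightarrow> real) \<Rightarrow> bool" where
  "conservative_CBI P X \<longleftrightarrow>
     markov_process P X \<and> stochastically_continuous P X \<and> (\<exists>\<phi> \<psi>. CBI_exponents P X \<phi> \<psi>)"

definition functional_characteristics ::
    "(real \<Rightarrow> 'w measure) \<Rightarrow> (real \<Rightarrow> 'w \<Rightarrow> real) \<Rightarrow> (real \<Rightarrow> real) \<Rightarrow> (real \<Rightarrow> real) \<Rightarrow> bool" where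
  "functional_characteristics P X F R \<longleftrightarrow>
     (\<exists>\<phi> \<psi>. CBI_exponents P X \<phi> \<psi> \<and>
        (\<forall>u\<ge>0. ((\<lambda>t. \<phi> t u) has_real_derivative F u) (at_right 0)) \<and>
        (\<forall>u\<ge>0. ((\<lambda>t. \<psi> t u) has_real_derivative R u) (at_right 0)))"

definition immigration_mechanism :: "real \<Rightarrow> real measure \<Rightarrow> real \<Rightarrow> real" where
  "immigration_mechanism b m u = b * u - (LINT \<xi>:{0<..}|m. exp (- u * \<xi>) - 1)"

definition branching_mechanism :: "real \<Rightarrow> real \<Rightarrow> real measure \<Rightarrow> real \<Rightarrow> real" where
  "branching_mechanism \<alpha> \<beta> \<mu> u =
     - \<alpha> * u\<^sup>2 + \<beta> * u
     - (LINT \<xi>:{0<..}|\<mu>. exp (- u * \<xi>) - 1 + u * \<xi> * indicator {0<..1} \<xi>)"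

text \<open>Measures on \<open>(0,\<infinity>)\<close> are represented as Borel measures on the real line without mass on \<open>(-\<infinity>,0]\<close>.\<close>

definition levy_measure_pos :: "real measure \<Rightarrow> bool" where
  "levy_measure_pos \<nu> \<longleftrightarrow>
     sets \<nu> = sets borel \<and> emeasure \<nu> {..0} = 0 \<and> (\<integral>\<^sup>+\<xi>. ennreal (min (\<xi>\<^sup>2) 1) \<partial>\<nu>) < \<infinity>"

text \<open>
  The last condition is \<open>\<integral>\<^sub>0\<^sub>+ ds / max (R s) 0 = \<infinity>\<close>; in \<^typ>\<open>ennreal\<close> one has \<open>1 / 0 = \<infinity>\<close>, as required.
\<close>

definition admissible_parameters ::
    "real \<Rightarrow> real measure \<Rightarrow> real \<Rightarrow> real \<Rightarrow> real measure \<Rightarrow> bool" where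
  "admissible_parameters b m \<alpha> \<beta> \<mu> \<longleftrightarrow>
     0 \<le> b \<and> 0 \<le> \<alpha> \<and>
     levy_measure_pos m \<and> (\<integral>\<^sup>+\<xi>. ennreal (min \<xi> 1) \<partial>m) < \<infinity> \<and>
     levy_measure_pos \<mu> \<and>
     (\<forall>\<epsilon>>0. (\<integral>\<^sup>+s\<in>{0<..\<epsilon>}. (1 / ennreal (max (branching_mechanism \<alpha> \<beta> \<mu> s) 0)) \<partial>lborel) = \<infinity>)"

definition limit_distribution ::
    "(real \<Rightarrow> 'w measure) \<Rightarrow> (real \<Rightarrow> 'w \<Rightarrow> real) \<Rightarrow> real measure \<Rightarrow> bool" where
  "limit_distribution P X L \<longleftrightarrow>
     prob_space L \<and> sets L = sets borel \<and> emeasure L {..<0} = 0 \<and>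
     (\<forall>x\<ge>0. \<forall>\<tau>. filterlim \<tau> at_top sequentially \<longrightarrow>
        weak_conv_m (\<lambda>n. distr (P x) borel (X (\<tau> n))) L)"

section \<open>Scale function and effective drift\<close>

text \<open>
  The spectrally negative process \<open>-X\<^sup>R\<close>, where \<open>X\<^sup>R\<close> is the Levy process with
  \<open>E[exp (-u X\<^sup>R\<^sub>t)] = exp (-t R(u))\<close>, enters only through its exponent \<open>R\<close>.
\<close>

definition is_scale_function :: "(real \<Rightarrow> real) \<Rightarrow> (real \<Rightarrow> real) \<Rightarrow> bool" where
  "is_scale_function R W \<longleftrightarrow>
     (\<forall>x. 0 \<le> W x) \<and> (\<forall>x<0. W x = 0) \<and>
     continuous_on {0..} W \<and> mono_on {0..} W \<and>
     (\<forall>u>0. set_integrable lborel {0..} (\<lambda>x. exp (- u * x) * W x) \<and>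
             (LINT x:{0..}|lborel. exp (- u * x) * W x) = - (1 / R u))"

text \<open>The first case is the one in which \<open>X\<^sup>R\<close> has paths of bounded variation.\<close>

definition effective_drift :: "real \<Rightarrow> real \<Rightarrow> real measure \<Rightarrow> ereal" where
  "effective_drift \<alpha> \<beta> \<mu> =
     (if \<alpha> = 0 \<and> (\<integral>\<^sup>+\<xi>\<in>{0<..1}. ennreal \<xi> \<partial>\<mu>) < \<infinity>
      then ereal ((LINT \<xi>:{0<..1}|\<mu>. \<xi>) - \<beta>) else \<infinity>)"

definition right_derivative :: "(real \<Rightarrow> real) \<Rightarrow> real \<Rightarrow> real" where
  "right_derivative f x = vector_derivative f (at_right x)"

definition k_function :: "real \<Rightarrow> real measure \<Rightarrow> (real \<Rightarrow> real) \<Rightarrow> real \<Rightarrow> real" where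
  "k_function b m W x = b * right_derivative W x + (LINT \<xi>:{0<..}|m. W x - W (x - \<xi>))"

definition slowly_varying_at_0 :: "(real \<Rightarrow> real) \<Rightarrow> bool" where
  "slowly_varying_at_0 K \<longleftrightarrow> (\<forall>a>0. ((\<lambda>x. K (a * x) / K x) \<longlongrightarrow> 1) (at_right 0))"

end

theory Submission
  imports Defs
begin

text \<open>
  The scale function \<open>W\<close> is log-concave, so that \<open>W'\<^sub>+\<close> exists and \<open>W\<close> is its primitive on \<open>(0,\<infinity>)\<close>;
  together with \<open>W(0) = 1 / \<lambda>\<^sub>0\<close> this gives \<open>- F(u) / R(u) = \<gamma> + \<integral>\<^sub>0\<^sup>\<infinity> e\<^sup>-\<^sup>u\<^sup>x k(x) dx\<close>.
  The limit law is invariant, and differentiating its invariance under the semigroup at time \<open>0\<close> turns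
  this into an equation for \<open>x L(dx)\<close>: if \<open>L\<^sub>0\<close> denotes \<open>L\<close> shifted by \<open>- \<gamma>\<close>, then \<open>x L\<^sub>0(dx)\<close> is the
  convolution of \<open>k(x) dx\<close> and \<open>L\<^sub>0\<close>. Hence \<open>L\<^sub>0\<close> has the density \<open>f\<^sub>0(x) = x\<^sup>-\<^sup>1 \<integral> k(x - y) L\<^sub>0(dy)\<close>, and
  \<open>x f\<^sub>0(x) \<sim> c G(x)\<close> at \<open>0\<close>, where \<open>G\<close> is the distribution function of \<open>L\<^sub>0\<close>. A Gronwall argument shows that
  \<open>G\<close> is regularly varying with index \<open>c\<close>, so the (elementary) Abelian direction of Karamata's theorem
  yields \<open>G(t) \<sim> D(1 / t) / \<Gamma>(1 + c)\<close> for the Laplace transform \<open>D\<close> of \<open>L\<^sub>0\<close>; no Tauberian theorem is needed. Finally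
  \<open>D(1 / t) \<sim> \<kappa> t\<^sup>c K(t)\<close> follows from the Levy-Khintchine form of \<open>D\<close>.
\<close>

subsection \<open>Log-concavity of the scale function\<close>

text \<open>\<open>is_scale_function\<close> records only continuity, monotonicity and the
  transform, so positivity of W, existence of its right derivative and negativity of R have to be
  derived. Positivity comes from c > 0: if W vanished up to some x > 0, so would k. Log-concavity is
  hard to see on the Laplace side; the transform is therefore expanded as a power series in s at the
  argument u (1 - s), where the signs of the coefficients of R can be used in an induction, and W is
  recovered by letting the sampling rate grow. Invariance replaces the formula for the exponent of L
  as an integral of F / R: it needs only the derivatives of \<phi> and \<psi> at time 0 and no
  differential equation in t. The claim concerns the density itself, and the behaviour of G alone
  would not control it. The convolution equation closes this gap, because it exhibits one explicit
  version of the density as an average of k, which is close to c near 0. The constant \<kappa>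
  measures the cost of replacing exp(-x/t) by the indicator of x \<le> t in the Levy-Khintchine
  exponent.\<close>

lemma integral_dominated_convergence_within:
  fixes s :: "real \<Rightarrow> 'a \<Rightarrow> real"
  assumes [measurable]: "f \<in> borel_measurable M" "\<And>y. s y \<in> borel_measurable M"
    and w: "integrable M w"
    and lim: "AE x in M. ((\<lambda>y. s y x) \<longlongrightarrow> f x) (at u within S)"
    and bound: "\<forall>\<^sub>F y in at u within S. AE x in M. norm (s y x) \<le> w x"
  shows "((\<lambda>y. integral\<^sup>L M (s y)) \<longlongrightarrow> integral\<^sup>L M f) (at u within S)"
  unfolding tendsto_at_iff_sequentially comp_def
proof (intro allI impI)
  fix X :: "nat \<Rightarrow> real" assume X: "\<forall>i. X i \<in> S - {u}" "X \<longlonglongrightarrow> u"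
  then have fl: "filterlim X (at u within S) sequentially"
    by (simp add: filterlim_at)
  from filterlim_iff[THEN iffD1, OF fl, rule_format, OF bound]
  obtain N where N: "\<And>n. N \<le> n \<Longrightarrow> AE x in M. norm (s (X n) x) \<le> w x"
    by (auto simp: eventually_sequentially)
  show "(\<lambda>i. integral\<^sup>L M (s (X i))) \<longlonglongrightarrow> integral\<^sup>L M f"
  proof (rule LIMSEQ_offset, rule integral_dominated_convergence)
    show "AE x in M. norm (s (X (n + N)) x) \<le> w x" for n
      by (rule N) auto
    show "AE x in M. (\<lambda>n. s (X (n + N)) x) \<longlonglongrightarrow> f x"
      using lim
    proof eventually_elim
      fix x assume "((\<lambda>y. s y x) \<longlongrightarrow> f x) (at u within S)"
      then show "(\<lambda>n. s (X (n + N)) x) \<longlonglongrightarrow> f x"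
        by (intro LIMSEQ_ignore_initial_segment filterlim_compose[OF _ fl])
    qed
  qed (use w in auto)
qed

lemma exp_neg_mult_tendsto_0:
  fixes x :: real assumes "0 < x"
  shows "((\<lambda>u. exp (- u * x)) \<longlongrightarrow> 0) at_top"
proof (rule filterlim_compose[OF exp_at_bot])
  show "LIM u at_top. - u * x :> at_bot"
    using filterlim_tendsto_neg_mult_at_bot[OF tendsto_const _ filterlim_ident, of "- x"] assms
    by (simp add: mult.commute)
qed

lemma integral_exp_pos:
  assumes "prob_space M" and int: "integrable M (\<lambda>x. exp (f x :: real))"
  shows "0 < (LINT x|M. exp (f x))"
proof -
  interpret prob_space M by fact
  have "(LINT x|M. exp (f x)) \<noteq> 0"
  proof
    assume "(LINT x|M. exp (f x)) = 0"
    then have "AE x in M. exp (f x) = 0"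
      by (subst (asm) integral_nonneg_eq_0_iff_AE[OF int]) auto
    then have "AE x in M. False" by simp
    then show False by simp
  qed
  moreover have "0 \<le> (LINT x|M. exp (f x))" by simp
  ultimately show ?thesis by linarith
qed

lemma sums_integral_dominated:
  fixes f :: "nat \<Rightarrow> 'a \<Rightarrow> 'b::{banach, second_countable_topology}"
  assumes int: "\<And>n. integrable M (f n)" and [measurable]: "g \<in> borel_measurable M"
    and sums: "AE x in M. (\<lambda>n. f n x) sums g x"
    and w: "integrable M w" and bound: "\<And>N. AE x in M. norm (\<Sum>n<N. f n x) \<le> w x"
  shows "(\<lambda>n. integral\<^sup>L M (f n)) sums integral\<^sup>L M g"
proof -
  have "(\<lambda>N. (LINT x|M. (\<Sum>n<N. f n x))) \<longlonglongrightarrow> integral\<^sup>L M g"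
    by (rule integral_dominated_convergence[where w=w])
       (use int w sums bound in \<open>auto simp: sums_def\<close>)
  then show ?thesis
    using int by (simp add: sums_def Bochner_Integration.integral_sum)
qed

section \<open>Integrals against Levy measures and the power series of R\<close>

lemma levy_measure_integrable:
  assumes \<nu>: "levy_measure_pos \<nu>" and [measurable]: "f \<in> borel_measurable borel"
    and bound: "\<And>\<xi>. \<xi> > 0 \<Longrightarrow> \<bar>f \<xi>\<bar> \<le> C * min (\<xi>\<^sup>2) 1"
  shows "set_integrable \<nu> {0<..} f"
proof -
  have s[measurable_cong]: "sets \<nu> = sets borel" using \<nu> by (simp add: levy_measure_pos_def)
  have "integrable \<nu> (\<lambda>\<xi>. min (\<xi>\<^sup>2) 1 :: real)"
    by (rule integrableI_nonneg) (use \<nu> in \<open>auto simp: levy_measure_pos_def\<close>)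
  then have i: "integrable \<nu> (\<lambda>\<xi>. C * min (\<xi>\<^sup>2) 1)" by simp
  have C: "0 \<le> C" using bound[of 1] by auto
  show ?thesis unfolding set_integrable_def
    by (rule Bochner_Integration.integrable_bound[OF i])
       (use bound C in \<open>auto split: split_indicator simp: abs_mult intro!: AE_I2\<close>)
qed

lemma exp_remainder_2_bounds:
  fixes z :: real assumes "0 \<le> z"
  shows "0 \<le> exp (- z) - 1 + z" "exp (- z) - 1 + z \<le> z\<^sup>2"
proof -
  show "0 \<le> exp (- z) - 1 + z" using exp_ge_add_one_self[of "-z"] by simp
  have "1 + z \<le> exp z" by simp
  then have "exp (-z) \<le> 1 / (1 + z)"
    using assms by (simp add: exp_minus field_simps)
  also have "\<dots> \<le> 1 - z + z\<^sup>2"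
    using assms by (simp add: field_simps power2_eq_square)
  finally show "exp (- z) - 1 + z \<le> z\<^sup>2" by simp
qed

lemma min_one_sq_scale:
  fixes u \<xi> :: real assumes "x \<le> 1" "x \<le> (u * \<xi>)\<^sup>2"
  shows "x \<le> (1 + u\<^sup>2) * min (\<xi>\<^sup>2) 1"
proof -
  have "(u*\<xi>)\<^sup>2 \<le> (1+u\<^sup>2) * \<xi>\<^sup>2" by (simp add: power_mult_distrib mult_right_mono)
  moreover have "1 \<le> (1 + u\<^sup>2) * 1" by simp
  ultimately have "x \<le> (1+u\<^sup>2) * \<xi>\<^sup>2" "x \<le> (1 + u\<^sup>2) * 1" using assms by linarith+
  then show ?thesis unfolding min_def by presburger
qed

lemma branching_integrand_bound:
  fixes u \<xi> :: real assumes "0 \<le> u" "0 < \<xi>"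
  shows "\<bar>exp (- u * \<xi>) - 1 + u * \<xi> * indicator {0<..1} \<xi>\<bar> \<le> (1 + u\<^sup>2) * min (\<xi>\<^sup>2) 1"
proof (cases "\<xi> \<le> 1")
  case True
  have "\<bar>exp (- u * \<xi>) - 1 + u * \<xi>\<bar> \<le> (u * \<xi>)\<^sup>2"
    using exp_remainder_2_bounds[of "u * \<xi>"] assms by simp
  also have "\<dots> \<le> (1+u\<^sup>2) * \<xi>\<^sup>2" by (simp add: power_mult_distrib mult_right_mono)
  also have "\<xi>\<^sup>2 = min (\<xi>\<^sup>2) 1" using True assms by (simp add: power_le_one)
  finally show ?thesis using True assms by simp
next
  case False
  have "\<bar>exp (- u * \<xi>) - 1\<bar> \<le> 1" using assms by simp
  moreover have "min (\<xi>\<^sup>2) 1 = 1" using False by simp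
  moreover have "(1::real) \<le> 1 + u\<^sup>2" by simp
  ultimately have "\<bar>exp (- u * \<xi>) - 1\<bar> \<le> (1 + u\<^sup>2) * min (\<xi>\<^sup>2) 1"
    using order_trans by (metis mult.right_neutral)
  then show ?thesis using False by simp
qed

lemma exp_real_sums: "(\<lambda>n. x ^ n / fact n) sums exp (x::real)"
  using exp_converges[of x] by (simp add: field_simps scaleR_conv_of_real)

lemma sum_power_fact_le_exp:
  fixes x :: real assumes "0 \<le> x"
  shows "(\<Sum>n<N. x ^ n / fact n) \<le> exp x"
  unfolding sums_unique[OF exp_real_sums]
  by (rule sum_le_suminf) (use exp_real_sums[of x] assms in \<open>auto simp: sums_iff\<close>)

lemma power_fact_le_exp:
  fixes x :: real assumes "0 \<le> x"
  shows "x ^ n / fact n \<le> exp x"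
  using member_le_sum[of n "{..<Suc n}" "\<lambda>i. x ^ i / fact i"] sum_power_fact_le_exp[OF assms, of "Suc n"] assms
  by simp

lemma exp_power_term_le:
  fixes x :: real assumes "0 \<le> x"
  shows "exp (- x) * (x ^ j / fact j) \<le> 1"
  using power_fact_le_exp[OF assms, of j] by (simp add: exp_minus field_simps)

text \<open>Two factors of \<open>x\<close> are split off, and what remains is a Poisson weight, at
  most 1. The square is what a Levy measure integrates near 0, which is why the bound starts at
  \<open>j = 2\<close>.\<close>

lemma exp_power_term_le_sq:
  fixes x :: real assumes "0 \<le> x" "2 \<le> j"
  shows "exp (- x) * (x ^ j / fact j) \<le> x\<^sup>2"
proof -
  obtain i where j: "j = i + 2" using assms(2) by (metis add.commute le_Suc_ex)
  have f: "fact i \<le> (fact j :: real)" unfolding j by (rule fact_mono) simp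
  have "x ^ j / fact j \<le> x ^ j / fact i"
    by (rule divide_left_mono) (use f assms in auto)
  then have "exp (- x) * (x ^ j / fact j) \<le> exp (-x) * (x ^ j / fact i)"
    by (intro mult_left_mono) auto
  also have "\<dots> = (exp (-x) * (x ^ i / fact i)) * x\<^sup>2" by (simp add: j power_add power2_eq_square)
  also have "\<dots> \<le> 1 * x\<^sup>2" by (rule mult_right_mono[OF exp_power_term_le]) (use assms in auto)
  finally show ?thesis by simp
qed

text \<open>Expand \<open>exp (s * u * \<xi>)\<close> inside the Levy integral. From order 2 on,
  each coefficient is the \<mu>-integral of a Poisson weight, plus a contribution of \<alpha> at
  order 2, hence nonnegative. At orders 0 and 1 the Poisson weights need not be \<mu>-integrable, so
  the compensator is kept with them there.\<close>

lemma branching_power_series: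
  fixes u \<alpha> \<beta> :: real
  assumes \<mu>: "levy_measure_pos \<mu>" and \<alpha>: "0 \<le> \<alpha>" and u: "0 < u"
  obtains p where "p 0 = - branching_mechanism \<alpha> \<beta> \<mu> u" "\<And>j. 2 \<le> j \<Longrightarrow> 0 \<le> p j"
    "\<And>s. \<bar>s\<bar> < 1 \<Longrightarrow> (\<lambda>j. p j * s ^ j) sums (- branching_mechanism \<alpha> \<beta> \<mu> (u * (1 - s)))"
proof -
  have [measurable_cong]: "sets \<mu> = sets borel" using \<mu> by (simp add: levy_measure_pos_def)
  define e where "e j \<xi> = exp (- (u * \<xi>)) * ((u * \<xi>) ^ j / fact j)" for j \<xi>
  define q where "q j = (LINT \<xi>:{0<..}|\<mu>. e j \<xi>)" for j
  define g where "g s \<xi> = exp (- (u * (1 - s)) * \<xi>) - 1 + u * (1 - s) * \<xi> * indicator {0<..1} \<xi>" for s \<xi>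
  \<comment> \<open>The derivative of \<open>g s \<xi>\<close> in \<open>s\<close> at
    \<open>s = 0\<close>. Subtracting \<open>g 0\<close> and \<open>s * h\<close> leaves exactly the
    exponential series from order 2 on.\<close>
  define h where "h \<xi> = e 1 \<xi> - u * \<xi> * indicator {0<..1} \<xi>" for \<xi>
  define B where "B = 1 + u\<^sup>2"
  have [measurable]: "e j \<in> borel_measurable borel" "g s \<in> borel_measurable borel" "h \<in> borel_measurable borel" for j s
    unfolding e_def g_def h_def by measurable
  have e0: "0 \<le> e j \<xi>" if "\<xi> > 0" for j \<xi> using that u by (simp add: e_def)
  have eb: "e j \<xi> \<le> B * min (\<xi>\<^sup>2) 1" if "\<xi> > 0" "2 \<le> j" for j \<xi>
    unfolding e_def B_def
    by (rule min_one_sq_scale) (use that u exp_power_term_le_sq[of "u*\<xi>" j] exp_power_term_le[of "u*\<xi>" j] in auto)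
  have ei: "set_integrable \<mu> {0<..} (e j)" if "2 \<le> j" for j
    by (rule levy_measure_integrable[OF \<mu>, where C=B]) (use e0 eb that in auto)
  have gi: "set_integrable \<mu> {0<..} (g s)" if "\<bar>s\<bar> < 1" for s
    by (rule levy_measure_integrable[OF \<mu>, where C="1 + (u * (1 - s))\<^sup>2"])
       (use that u branching_integrand_bound[of "u*(1-s)"] in \<open>auto simp: g_def\<close>)
  have hi: "set_integrable \<mu> {0<..} h"
  proof (rule levy_measure_integrable[OF \<mu>, where C=B])
    fix \<xi> :: real assume \<xi>: "\<xi> > 0"
    show "\<bar>h \<xi>\<bar> \<le> B * min (\<xi>\<^sup>2) 1"
    proof (cases "\<xi> \<le> 1")
      case True
      have "\<bar>h \<xi>\<bar> = u * \<xi> * (1 - exp (- (u * \<xi>)))"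
        using True \<xi> u by (simp add: h_def e_def abs_if algebra_simps mult_less_0_iff)
      also have "\<dots> \<le> u * \<xi> * (u * \<xi>)"
        using u \<xi> exp_ge_add_one_self[of "-(u * \<xi>)"] by (intro mult_left_mono) (auto simp del: exp_ge_add_one_self)
      also have "\<dots> \<le> B * \<xi>\<^sup>2" by (simp add: B_def power2_eq_square algebra_simps)
      also have "\<xi>\<^sup>2 = min (\<xi>\<^sup>2) 1" using True \<xi> by (simp add: power_le_one)
      finally show ?thesis .
    next
      case False
      have "\<bar>h \<xi>\<bar> \<le> 1" using False \<xi> u exp_power_term_le[of "u * \<xi>" 1] by (simp add: h_def e_def)
      moreover have "1 \<le> \<xi>\<^sup>2" using False by simp
      ultimately show ?thesis by (simp add: B_def add_increasing2 min_def)
    qed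
  qed simp
  have tail: "(\<lambda>i. s ^ (i + 2) * q (i + 2)) sums
      (LINT \<xi>:{0<..}|\<mu>. g s \<xi> - g 0 \<xi> - s * h \<xi>)" if s: "\<bar>s\<bar> < 1" for s
    unfolding q_def set_lebesgue_integral_def
    apply (subst integral_mult_right_zero[symmetric])
  proof (rule sums_integral_dominated[where 'b=real, unfolded real_norm_def, where w="\<lambda>\<xi>. (1 / (1 - \<bar>s\<bar>)) * (B * min (\<xi>\<^sup>2) 1)"])
    show "integrable \<mu> (\<lambda>x. s ^ (n + 2) * (indicat_real {0<..} x *\<^sub>R e (n + 2) x))" for n
      using ei[of "n+2"] by (simp add: set_integrable_def)
    show "integrable \<mu> (\<lambda>\<xi>. (1 / (1 - \<bar>s\<bar>)) * (B * min (\<xi>\<^sup>2) 1))"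
      by (intro integrable_mult_right integrableI_nonneg) (use \<mu> in \<open>auto simp: levy_measure_pos_def\<close>)
    show "AE x in \<mu>. (\<lambda>n. s ^ (n + 2) * (indicat_real {0<..} x *\<^sub>R e (n + 2) x)) sums
        (indicat_real {0<..} x *\<^sub>R (g s x - g 0 x - s * h x))"
    proof (rule AE_I2)
      fix x
      have "(\<lambda>n. exp (-(u*x)) * ((s * (u * x)) ^ n / fact n)) sums (exp (-(u*x)) * exp (s * (u * x)))"
        by (intro sums_mult exp_real_sums)
      then have "(\<lambda>n. exp (-(u*x)) * ((s * (u * x)) ^ (n+2) / fact (n+2))) sums (exp (-(u*x)) * exp (s * (u * x))
          - (\<Sum>n<2. exp (-(u*x)) * ((s * (u * x)) ^ n / fact n)))"
        by (subst sums_iff_shift) simp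
      also have "(\<lambda>n. exp (-(u*x)) * ((s * (u * x)) ^ (n+2) / fact (n+2))) = (\<lambda>n. s ^ (n + 2) * e (n + 2) x)"
        by (auto simp: e_def power_mult_distrib fun_eq_iff)
      also have "exp (-(u*x)) * exp (s * (u * x))
          - (\<Sum>n<2. exp (-(u*x)) * ((s * (u * x)) ^ n / fact n)) = g s x - g 0 x - s * h x"
        by (simp add: g_def h_def e_def numeral_2_eq_2 algebra_simps flip: exp_add)
      finally have "(\<lambda>n. s ^ (n + 2) * e (n + 2) x) sums (g s x - g 0 x - s * h x)" .
      from sums_mult[OF this, of "indicator {0<..} x"]
      show "(\<lambda>n. s ^ (n + 2) * (indicat_real {0<..} x *\<^sub>R e (n + 2) x)) sums
        (indicat_real {0<..} x *\<^sub>R (g s x - g 0 x - s * h x))"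
        by (simp add: ac_simps)
    qed
    fix N
    show "AE x in \<mu>. \<bar>\<Sum>n<N. s ^ (n + 2) * (indicat_real {0<..} x *\<^sub>R e (n + 2) x)\<bar>
          \<le> (1 / (1 - \<bar>s\<bar>)) * (B * min (x\<^sup>2) 1)"
    proof (rule AE_I2)
      fix x
      have B0: "0 \<le> B * min (x\<^sup>2) 1" by (simp add: B_def)
      have "\<bar>\<Sum>n<N. s ^ (n + 2) * (indicat_real {0<..} x *\<^sub>R e (n + 2) x)\<bar> \<le> (\<Sum>n<N. \<bar>s\<bar> ^ n * (B * min (x\<^sup>2) 1))"
      proof (rule order_trans[OF sum_abs], rule sum_mono)
        fix n
        have "\<bar>s\<bar> ^ (n + 2) \<le> \<bar>s\<bar> ^ n" by (rule power_decreasing) (use s in auto)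
        then have "\<bar>s\<bar> ^ (n + 2) * \<bar>indicat_real {0<..} x *\<^sub>R e (n + 2) x\<bar> \<le> \<bar>s\<bar> ^ n * (B * min (x\<^sup>2) 1)"
          by (rule mult_mono) (use e0 eb[of x "n+2"] B0 in \<open>auto split: split_indicator\<close>)
        then show "\<bar>s ^ (n + 2) * (indicat_real {0<..} x *\<^sub>R e (n + 2) x)\<bar> \<le> \<bar>s\<bar> ^ n * (B * min (x\<^sup>2) 1)"
          by (simp add: abs_mult power_abs)
      qed
      also have "\<dots> = (\<Sum>n<N. \<bar>s\<bar> ^ n) * (B * min (x\<^sup>2) 1)" by (simp add: sum_distrib_right)
      also have "\<dots> \<le> (1 / (1 - \<bar>s\<bar>)) * (B * min (x\<^sup>2) 1)"
      proof (rule mult_right_mono[OF _ B0])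
        have "(\<lambda>n. \<bar>s\<bar> ^ n) sums (1 / (1 - \<bar>s\<bar>))" by (rule geometric_sums) (use s in auto)
        then show "(\<Sum>n<N. \<bar>s\<bar> ^ n) \<le> 1 / (1 - \<bar>s\<bar>)"
          by (metis sum_le_suminf sums_iff finite_lessThan zero_le_power abs_ge_zero)
      qed
      finally show "\<bar>\<Sum>n<N. s ^ (n + 2) * (indicat_real {0<..} x *\<^sub>R e (n + 2) x)\<bar>
          \<le> (1 / (1 - \<bar>s\<bar>)) * (B * min (x\<^sup>2) 1)" .
    qed
  qed measurable
  define p where "p j = (if j = 0 then \<alpha> * u\<^sup>2 - \<beta> * u + (LINT \<xi>:{0<..}|\<mu>. g 0 \<xi>)
     else if j = 1 then - 2 * \<alpha> * u\<^sup>2 + \<beta> * u + (LINT \<xi>:{0<..}|\<mu>. h \<xi>)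
     else if j = 2 then \<alpha> * u\<^sup>2 + q 2 else q j)" for j :: nat
  show thesis
  proof
    show "p 0 = - branching_mechanism \<alpha> \<beta> \<mu> u" by (simp add: p_def branching_mechanism_def g_def[abs_def])
    show "0 \<le> p j" if "2 \<le> j" for j
    proof -
      have "0 \<le> q j" unfolding q_def set_lebesgue_integral_def
        by (rule Bochner_Integration.integral_nonneg) (use e0 in \<open>auto split: split_indicator\<close>)
      then show ?thesis using that \<alpha> by (auto simp: p_def)
    qed
    fix s :: real assume s: "\<bar>s\<bar> < 1"
    have R: "- branching_mechanism \<alpha> \<beta> \<mu> (u * (1 - s)) = \<alpha> * (u * (1 - s))\<^sup>2 - \<beta> * (u * (1 - s)) + (LINT \<xi>:{0<..}|\<mu>. g s \<xi>)"
      by (simp add: branching_mechanism_def g_def[abs_def])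
    have I: "(LINT \<xi>:{0<..}|\<mu>. g s \<xi> - g 0 \<xi> - s * h \<xi>)
       = (LINT \<xi>:{0<..}|\<mu>. g s \<xi>) - (LINT \<xi>:{0<..}|\<mu>. g 0 \<xi>) - s * (LINT \<xi>:{0<..}|\<mu>. h \<xi>)"
      using gi[OF s] gi[of 0] hi by (simp add: set_integral_diff)
    have "(\<lambda>i. s ^ (i + 2) * q (i + 2) + (if i = 0 then \<alpha> * u\<^sup>2 * s\<^sup>2 else 0)) sums
       ((LINT \<xi>:{0<..}|\<mu>. g s \<xi> - g 0 \<xi> - s * h \<xi>) + \<alpha> * u\<^sup>2 * s\<^sup>2)"
      by (intro sums_add tail[OF s] sums_single)
    also have "(\<lambda>i. s ^ (i + 2) * q (i + 2) + (if i = 0 then \<alpha> * u\<^sup>2 * s\<^sup>2 else 0)) = (\<lambda>i. p (i + 2) * s ^ (i + 2))"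
      by (auto simp: fun_eq_iff p_def numeral_2_eq_2 algebra_simps)
    finally have "(\<lambda>j. p j * s ^ j) sums ((LINT \<xi>:{0<..}|\<mu>. g s \<xi> - g 0 \<xi> - s * h \<xi>) + \<alpha> * u\<^sup>2 * s\<^sup>2
        + (\<Sum>i<2. p i * s ^ i))"
      by (subst (asm) sums_iff_shift) 
    also have "((LINT \<xi>:{0<..}|\<mu>. g s \<xi> - g 0 \<xi> - s * h \<xi>) + \<alpha> * u\<^sup>2 * s\<^sup>2
        + (\<Sum>i<2. p i * s ^ i)) = - branching_mechanism \<alpha> \<beta> \<mu> (u * (1 - s))"
      unfolding I R by (simp add: numeral_2_eq_2 p_def) (simp add: power2_eq_square algebra_simps)
    finally show "(\<lambda>j. p j * s ^ j) sums (- branching_mechanism \<alpha> \<beta> \<mu> (u * (1 - s)))" .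
  qed
qed

section \<open>Poissonised Laplace transforms and their generating function\<close>

lemma laplace_power_integrable:
  fixes W :: "real \<Rightarrow> real"
  assumes [measurable]: "W \<in> borel_measurable borel" and W0: "\<And>x. 0 \<le> W x"
    and int: "\<And>u. u > 0 \<Longrightarrow> set_integrable lborel {0..} (\<lambda>x. exp (- u * x) * W x)"
    and u: "0 < u"
  shows "set_integrable lborel {0..} (\<lambda>x. exp (- u * x) * ((u * x) ^ n / fact n) * W x)"
  unfolding set_integrable_def
proof (rule Bochner_Integration.integrable_bound)
  show "integrable lborel (\<lambda>x. 2 ^ n * (indicator {0..} x *\<^sub>R (exp (- (u/2) * x) * W x)))"
    using int[of "u/2"] u by (simp add: set_integrable_def)
  show "AE x in lborel. norm (indicator {0..} x *\<^sub>R (exp (- u * x) * ((u * x) ^ n / fact n) * W x)) \<le> norm (2 ^ n * (indicator {0..} x *\<^sub>R (exp (- (u/2) * x) * W x)))"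
  proof (rule AE_I2, cases)
    fix x :: real assume x: "0 \<le> x"
    \<comment> \<open>Half of the exponent absorbs the power, at the price of \<open>2 ^ n\<close>;
      the transform at \<open>u / 2\<close> is finite.\<close>
    have "(u * x / 2) ^ n / fact n \<le> exp (u * x / 2)"
      by (rule power_fact_le_exp) (use x u in simp)
    then have "exp (- u * x) * ((u * x) ^ n / fact n) \<le> exp (- u * x) * (2 ^ n * exp (u * x / 2))"
      by (intro mult_left_mono) (auto simp: power_divide field_simps)
    also have "\<dots> = 2 ^ n * exp (- (u/2) * x)" by (simp flip: exp_add)
    finally have "exp (- u * x) * ((u * x) ^ n / fact n) * W x \<le> 2 ^ n * exp (- (u/2) * x) * W x"
      using W0 by (rule mult_right_mono)
    then show "norm (indicator {0..} x *\<^sub>R (exp (- u * x) * ((u * x) ^ n / fact n) * W x)) \<le> norm (2 ^ n * (indicator {0..} x *\<^sub>R (exp (- (u/2) * x) * W x)))"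
      using x u W0[of x] by (simp add: abs_mult)
  qed simp
qed simp

text \<open>Summing the Poisson weights against \<open>s ^ n\<close> turns
  \<open>exp (- u * x)\<close> into \<open>exp (- (u * (1 - s)) * x)\<close>. For signed
  \<open>s\<close> the partial sums are dominated by the integrand at
  \<open>u * (1 - \<bar>s\<bar>)\<close>, which is still a positive argument.\<close>

lemma laplace_power_series:
  fixes W :: "real \<Rightarrow> real"
  assumes [measurable]: "W \<in> borel_measurable borel" and W0: "\<And>x. 0 \<le> W x"
    and int: "\<And>u. u > 0 \<Longrightarrow> set_integrable lborel {0..} (\<lambda>x. exp (- u * x) * W x)"
    and u: "0 < u" and s: "\<bar>s\<bar> < 1"
  shows "(\<lambda>n. (LINT x:{0..}|lborel. exp (- u * x) * ((u * x) ^ n / fact n) * W x) * s ^ n) sums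
      (LINT x:{0..}|lborel. exp (- (u * (1 - s)) * x) * W x)"
proof -
  let ?f = "\<lambda>n x. indicator {0..} x *\<^sub>R (exp (- u * x) * ((u * x) ^ n / fact n) * W x)"
  have c1: "u * (1 - \<bar>s\<bar>) > 0" using u s by simp
  have fi: "integrable lborel (?f n)" for n
    using laplace_power_integrable[OF _ W0 int u, of n] by (simp add: set_integrable_def)
  have "(\<lambda>n. LINT x|lborel. ?f n x * s ^ n) sums (LINT x|lborel. indicator {0..} x *\<^sub>R (exp (- (u * (1 - s)) * x) * W x))"
  proof (rule sums_integral_dominated[where 'b=real, unfolded real_norm_def])
    show "integrable lborel (\<lambda>x. ?f n x * s ^ n)" for n
      by (rule integrable_mult_left[OF fi])
    show "integrable lborel (\<lambda>x. indicator {0..} x *\<^sub>R (exp (- (u * (1 - \<bar>s\<bar>)) * x) * W x))"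
      using int[OF c1] by (simp add: set_integrable_def)
    show "AE x in lborel. (\<lambda>n. ?f n x * s ^ n) sums (indicator {0..} x *\<^sub>R (exp (- (u * (1 - s)) * x) * W x))"
    proof (rule AE_I2)
      fix x :: real
      have "(\<lambda>n. (indicator {0..} x * exp (-u*x) * W x) * ((s * (u * x)) ^ n / fact n)) sums
         ((indicator {0..} x * exp (-u*x) * W x) * exp (s * (u * x)))"
        by (intro sums_mult exp_real_sums)
      moreover have "(indicator {0..} x * exp (-u*x) * W x) * exp (s * (u * x)) =
         indicator {0..} x *\<^sub>R (exp (- (u * (1 - s)) * x) * W x)"
        by (simp add: algebra_simps flip: exp_add)
      moreover have "(\<lambda>n. (indicator {0..} x * exp (-u*x) * W x) * ((s * (u * x)) ^ n / fact n)) = (\<lambda>n. ?f n x * s ^ n)"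
        by (simp add: power_mult_distrib fun_eq_iff)
      ultimately show "(\<lambda>n. ?f n x * s ^ n) sums (indicator {0..} x *\<^sub>R (exp (- (u * (1 - s)) * x) * W x))"
        by (simp only:)
    qed
    fix N
    show "AE x in lborel. \<bar>\<Sum>n<N. ?f n x * s ^ n\<bar> \<le> indicator {0..} x *\<^sub>R (exp (- (u * (1 - \<bar>s\<bar>)) * x) * W x)"
    proof (rule AE_I2, cases)
      fix x :: real assume x: "0 \<le> x"
      have "\<bar>\<Sum>n<N. ?f n x * s ^ n\<bar> \<le> (\<Sum>n<N. (exp (-u*x) * W x) * ((\<bar>s\<bar> * (u * x)) ^ n / fact n))"
        by (rule order_trans[OF sum_abs], rule sum_mono)
          (use x u W0[of x] in \<open>auto simp: abs_mult power_mult_distrib power_abs mult_ac\<close>)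
      also have "\<dots> = (exp (-u*x) * W x) * (\<Sum>n<N. (\<bar>s\<bar> * (u * x)) ^ n / fact n)"
        by (simp add: sum_distrib_left)
      also have "\<dots> \<le> (exp (-u*x) * W x) * exp (\<bar>s\<bar> * (u * x))"
        by (intro mult_left_mono sum_power_fact_le_exp) (use x u W0[of x] in auto)
      also have "\<dots> = exp (- (u * (1 - \<bar>s\<bar>)) * x) * W x"
        by (simp add: algebra_simps flip: exp_add)
      finally show "\<bar>\<Sum>n<N. ?f n x * s ^ n\<bar> \<le> indicator {0..} x *\<^sub>R (exp (- (u * (1 - \<bar>s\<bar>)) * x) * W x)"
        using x by simp
    qed simp
  qed measurable
  then show ?thesis by (simp add: set_lebesgue_integral_def)
qed

section \<open>Reciprocal power series and log-concave sequences\<close>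

lemma power_series_zero_coeff:
  fixes c :: "nat \<Rightarrow> real"
  assumes "\<And>s. \<bar>s\<bar> < 1 \<Longrightarrow> (\<lambda>n. c n * s ^ n) sums 0"
  shows "c n = 0"
proof (induction n rule: less_induct)
  case (less n)
  \<comment> \<open>The coefficients below \<open>n\<close> vanish by induction, so division by
    \<open>s ^ n\<close> leaves a series that is 0 off the origin and tends to \<open>c n\<close> at
    it.\<close>
  have "((\<lambda>s::real. 0::real) \<longlongrightarrow> c (0 + n)) (at 0)"
  proof (rule powser_limit_0_strong[where s=1 and a="\<lambda>i. c (i + n)"])
    fix s :: real assume s: "s \<noteq> 0" "norm s < 1"
    have "(\<lambda>i. c (i + n) * s ^ (i + n)) sums (0 - (\<Sum>i<n. c i * s ^ i))"
      by (subst sums_iff_shift) (use assms[of s] s less in auto)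
    then have "(\<lambda>i. inverse (s ^ n) * (c (i + n) * s ^ (i + n))) sums (inverse (s ^ n) * 0)"
      using less by (intro sums_mult) auto
    then show "(\<lambda>i. c (i + n) * s ^ i) sums 0"
      using s by (simp add: power_add field_simps)
  qed simp
  then show ?case by (simp add: tendsto_const_iff)
qed

lemma convolution_inverse_of_sums:
  fixes a p :: "nat \<Rightarrow> real"
  assumes a: "\<And>s. \<bar>s\<bar> < 1 \<Longrightarrow> (\<lambda>n. a n * s ^ n) sums f s"
    and p: "\<And>s. \<bar>s\<bar> < 1 \<Longrightarrow> (\<lambda>n. p n * s ^ n) sums g s"
    and fg: "\<And>s. \<bar>s\<bar> < 1 \<Longrightarrow> g s * f s = 1"
  shows "(\<Sum>i\<le>Suc n. p i * a (Suc n - i)) = 0"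
proof -
  let ?c = "\<lambda>n. (\<Sum>i\<le>n. p i * a (n - i)) - (if n = 0 then 1 else 0)"
  have "?c (Suc n) = 0"
  proof (rule power_series_zero_coeff[of ?c])
    fix s :: real assume s: "\<bar>s\<bar> < 1"
    \<comment> \<open>A radius strictly between \<open>\<bar>s\<bar>\<close> and 1: convergence at
      \<open>r\<close> gives absolute convergence at \<open>s\<close>, as the Cauchy product
      requires.\<close>
    define r where "r = (1 + \<bar>s\<bar>) / 2"
    have r: "\<bar>r\<bar> < 1" "\<bar>s\<bar> < \<bar>r\<bar>" using s by (auto simp: r_def)
    have "summable (\<lambda>n. norm (p n * s ^ n))" "summable (\<lambda>n. norm (a n * s ^ n))"
      using powser_insidea[OF sums_summable[OF p[OF r(1)]], of s] powser_insidea[OF sums_summable[OF a[OF r(1)]], of s] r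
      by auto
    from Cauchy_product_sums[OF this]
    have "(\<lambda>n. \<Sum>i\<le>n. (p i * s ^ i) * (a (n - i) * s ^ (n - i))) sums 1"
      using p[OF s] a[OF s] fg[OF s] by (simp add: sums_iff)
    moreover have "(\<lambda>n. \<Sum>i\<le>n. (p i * s ^ i) * (a (n - i) * s ^ (n - i))) = (\<lambda>n. (\<Sum>i\<le>n. p i * a (n - i)) * s ^ n)"
    proof (rule ext)
      fix n
      have "(p i * s ^ i) * (a (n - i) * s ^ (n - i)) = p i * a (n - i) * s ^ n" if "i \<in> {..n}" for i
      proof -
        have "s ^ i * s ^ (n - i) = s ^ n" using that by (simp flip: power_add)
        then show ?thesis by (simp add: ac_simps)
      qed
      then show "(\<Sum>i\<le>n. (p i * s ^ i) * (a (n - i) * s ^ (n - i))) = (\<Sum>i\<le>n. p i * a (n - i)) * s ^ n"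
        unfolding sum_distrib_right by (intro sum.cong) auto
    qed
    ultimately have "(\<lambda>n. (\<Sum>i\<le>n. p i * a (n - i)) * s ^ n - (if n = 0 then 1 else 0)) sums (1 - 1)"
      by (intro sums_diff sums_single[of 0 "\<lambda>_. 1::real"]) auto
    moreover have "(\<lambda>n. (\<Sum>i\<le>n. p i * a (n - i)) * s ^ n - (if n = 0 then 1 else 0)) = (\<lambda>n. ?c n * s ^ n)"
      by (auto simp: fun_eq_iff)
    ultimately show "(\<lambda>n. ?c n * s ^ n) sums 0" by simp
  qed
  then show ?thesis by simp
qed

text \<open>The ratios \<open>a (i + 1) / a i\<close> decrease from \<open>m\<close> to
  \<open>n\<close>, written without division. The range of \<open>step\<close> is bounded so that
  the lemma applies inside a strong induction, where log-concavity is known only below the current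
  index.\<close>

lemma decreasing_ratio_chain:
  fixes a :: "nat \<Rightarrow> real"
  assumes pos: "\<And>n. 0 < a n" and step: "\<And>i. m \<le> i \<Longrightarrow> i < n \<Longrightarrow> a (i + 2) * a i \<le> (a (i + 1))\<^sup>2" and "m \<le> n"
  shows "a m * a (n + 1) \<le> a (m + 1) * a n"
  using \<open>m \<le> n\<close> step
proof (induction n rule: dec_induct)
  case base
  then show ?case by simp
next
  case (step n)
  have 1: "a m * a (n + 1) \<le> a (m + 1) * a n" by (rule step.IH) (use step.prems in auto)
  have 2: "a (n + 2) * a n \<le> (a (n + 1))\<^sup>2" by (rule step.prems) (use step.hyps in auto)
  have "a n * (a m * a (n + 2)) = a m * (a (n + 2) * a n)" by simp
  also have "\<dots> \<le> a m * (a (n + 1))\<^sup>2" using 2 pos[of m] by simp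
  also have "\<dots> = (a m * a (n + 1)) * a (n + 1)" by (simp add: power2_eq_square)
  also have "\<dots> \<le> (a (m + 1) * a n) * a (n + 1)" by (rule mult_right_mono[OF 1]) (use pos less_imp_le in auto)
  finally have "a n * (a m * a (n + 2)) \<le> a n * (a (m + 1) * a (n + 1))" by (simp add: ac_simps)
  then show ?case using pos[of n] by simp
qed

text \<open>Solve the recursion for \<open>p 0 * a (n + 1) / a n\<close>: it is \<open>- p 1\<close>
  minus the sum of \<open>p (i + 2) * a (n - Suc i) / a n\<close>. By the induction hypothesis the
  ratios in this sum grow when \<open>n\<close> is replaced by \<open>n + 1\<close>, and one further
  nonnegative summand appears. So \<open>a (n + 1) / a n\<close> decreases.\<close>

lemma renewal_log_concave:
  fixes a p :: "nat \<Rightarrow> real"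
  assumes p0: "0 < p 0" and p: "\<And>j. 2 \<le> j \<Longrightarrow> 0 \<le> p j" and pos: "\<And>n. 0 < a n"
    and conv: "\<And>n. (\<Sum>i\<le>Suc n. p i * a (Suc n - i)) = 0"
  shows "a (n + 2) * a n \<le> (a (n + 1))\<^sup>2"
proof (induction n rule: less_induct)
  case (less n)
  have split: "p 0 * a (Suc k) + p 1 * a k + (\<Sum>i<k. p (i + 2) * a (k - Suc i)) = 0" for k
    using conv[of k] by (simp add: sum.atMost_Suc_shift lessThan_Suc_atMost[symmetric] sum.lessThan_Suc_shift del: sum.atMost_Suc sum.lessThan_Suc)
  have A: "p 0 * a (n + 2) = - p 1 * a (n + 1) - (\<Sum>i<Suc n. p (i + 2) * a (Suc n - Suc i))"
    using split[of "Suc n"] by simp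
  have B: "p 0 * a (n + 1) = - p 1 * a n - (\<Sum>i<n. p (i + 2) * a (n - Suc i))"
    using split[of n] by simp
  have C: "(\<Sum>i<n. p (i + 2) * a (n - Suc i)) * a (n + 1) \<le> (\<Sum>i<Suc n. p (i + 2) * a (Suc n - Suc i)) * a n"
  proof -
    have "(\<Sum>i<n. p (i + 2) * a (n - Suc i)) * a (n + 1) = (\<Sum>i<n. p (i + 2) * (a (n - Suc i) * a (n + 1)))"
      by (simp add: sum_distrib_right mult.assoc)
    also have "\<dots> \<le> (\<Sum>i<n. p (i + 2) * (a (n - i) * a n))"
    proof (rule sum_mono)
      fix i assume i: "i \<in> {..<n}"
      have "a (n - Suc i) * a (n + 1) \<le> a (n - Suc i + 1) * a n"
        by (rule decreasing_ratio_chain[OF pos]) (use less i in auto)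
      also have "n - Suc i + 1 = n - i" using i by auto
      finally show "p (i + 2) * (a (n - Suc i) * a (n + 1)) \<le> p (i + 2) * (a (n - i) * a n)"
        using p[of "i+2"] by (intro mult_left_mono) auto
    qed
    also have "\<dots> \<le> (\<Sum>i<Suc n. p (i + 2) * (a (n - i) * a n))"
      using p[of "n+2"] pos[of 0] pos[of n] by simp
    finally show ?thesis by (simp add: sum_distrib_right mult.assoc del: sum.lessThan_Suc)
  qed
  have "p 0 * (a (n + 2) * a n) \<le> p 0 * (a (n + 1))\<^sup>2"
  proof -
    have "p 0 * (a (n + 2) * a n) = (p 0 * a (n + 2)) * a n" by simp
    also have "\<dots> = - p 1 * a (n + 1) * a n - (\<Sum>i<Suc n. p (i + 2) * a (Suc n - Suc i)) * a n"
      unfolding A by (simp add: algebra_simps)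
    also have "\<dots> \<le> - p 1 * a (n + 1) * a n - (\<Sum>i<n. p (i + 2) * a (n - Suc i)) * a (n + 1)"
      using C by simp
    also have "\<dots> = (p 0 * a (n + 1)) * a (n + 1)" unfolding B by (simp add: algebra_simps)
    finally show ?thesis by (simp add: power2_eq_square)
  qed
  then show ?case using p0 by simp
qed

text \<open>Sum the decreasing slopes of \<open>ln a\<close> on either side of \<open>q\<close>. The
  weak inequalities matter: the indices will come from rounding and may coincide.\<close>

lemma log_concave_three_points:
  fixes a :: "nat \<Rightarrow> real"
  assumes pos: "\<And>n. 0 < a n" and lc: "\<And>n. a (n + 2) * a n \<le> (a (n + 1))\<^sup>2" and pq: "p \<le> q" "q \<le> r"
  shows "(real q - real p) * (ln (a r) - ln (a q)) \<le> (real r - real q) * (ln (a q) - ln (a p))"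
proof -
  define d where "d i = ln (a (i + 1)) - ln (a i)" for i
  have dec: "d j \<le> d i" if "i \<le> j" for i j
  proof -
    have "a i * a (j + 1) \<le> a (i + 1) * a j" by (rule decreasing_ratio_chain[OF pos lc that])
    then have "ln (a i * a (j + 1)) \<le> ln (a (i + 1) * a j)" using pos by (subst ln_le_cancel_iff) auto
    then show ?thesis using pos by (simp add: d_def ln_mult_pos)
  qed
  have tel: "ln (a k) - ln (a j) = (\<Sum>i\<in>{j..<k}. d i)" if "j \<le> k" for j k
    unfolding d_def using sum_Suc_diff'[OF that, of "\<lambda>i. ln (a i)"] by simp
  have "(\<Sum>i\<in>{q..<r}. d i) \<le> (\<Sum>i\<in>{q..<r}. d q)" by (rule sum_mono) (use dec in auto)
  then have 1: "ln (a r) - ln (a q) \<le> (real r - real q) * d q" using tel[of q r] pq by (simp add: of_nat_diff)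
  have "(\<Sum>i\<in>{p..<q}. d q) \<le> (\<Sum>i\<in>{p..<q}. d i)" by (rule sum_mono) (use dec in auto)
  then have 2: "(real q - real p) * d q \<le> ln (a q) - ln (a p)" using tel[of p q] pq by (simp add: of_nat_diff)
  have "(real q - real p) * (ln (a r) - ln (a q)) \<le> (real q - real p) * ((real r - real q) * d q)"
    by (rule mult_left_mono[OF 1]) (use pq in auto)
  also have "\<dots> = (real r - real q) * ((real q - real p) * d q)" by simp
  also have "\<dots> \<le> (real r - real q) * (ln (a q) - ln (a p))"
    by (rule mult_left_mono[OF 2]) (use pq in auto)
  finally show ?thesis .
qed

text \<open>Chebyshev's argument. The Erlang law is that of a sum of \<open>n N + 1\<close>
  exponential variables of rate \<open>N\<close>; its mean \<open>(n N + 1) / N\<close> tends to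
  \<open>x\<close> and its second moment about \<open>x\<close> tends to 0.\<close>

lemma erlang_sampling:
  fixes V :: "real \<Rightarrow> real" and n :: "nat \<Rightarrow> nat"
  assumes [measurable]: "V \<in> borel_measurable borel" and bound: "\<And>y. \<bar>V y\<bar> \<le> C"
    and cont: "isCont V x" and n: "(\<lambda>N. real (n N) / real N) \<longlonglongrightarrow> x"
  shows "(\<lambda>N. LINT y|lborel. erlang_density (n N) (real N) y * V y) \<longlonglongrightarrow> V x"
proof (rule LIMSEQ_I)
  fix r :: real assume r: "0 < r"
  have C0: "0 \<le> C" using bound[of 0] by simp
  from cont r obtain d where d: "d > 0" "\<And>y. \<bar>y - x\<bar> < d \<Longrightarrow> \<bar>V y - V x\<bar> < r / 2"
    unfolding continuous_at_eps_delta dist_real_def by (meson half_gt_zero)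
  \<comment> \<open>\<open>2 * C\<close> bounds every deviation of \<open>V\<close>, and
    \<open>d\<^sup>2 \<le> (y - x)\<^sup>2\<close> outside the \<open>d\<close>-neighbourhood, so
    the quadratic term takes over there.\<close>
  define B where "B = 2 * C / d\<^sup>2"
  have le: "\<bar>V y - V x\<bar> \<le> r / 2 + B * (y - x)\<^sup>2" for y
  proof (cases "\<bar>y - x\<bar> < d")
    case True then show ?thesis using d(2)[OF True] C0 by (simp add: B_def add_increasing2 less_imp_le)
  next
    case False
    then have "d\<^sup>2 \<le> (y - x)\<^sup>2" using d(1) by (metis abs_le_square_iff abs_of_pos not_less)
    then have "2 * C * d\<^sup>2 \<le> 2 * C * (y - x)\<^sup>2" using C0 by (intro mult_left_mono) auto
    then have "2 * C \<le> B * (y - x)\<^sup>2" using d(1) by (simp add: B_def pos_le_divide_eq)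
    moreover have "\<bar>V y - V x\<bar> \<le> 2 * C" using bound[of x] bound[of y] by linarith
    ultimately show ?thesis using r by linarith
  qed
  define e where "e N = erlang_density (n N) (real N)" for N
  have mom: "has_bochner_integral lborel (\<lambda>y. e N y * y ^ i) (fact (n N + i) / (fact (n N) * real N ^ i))"
    if "N > 0" for N i
  proof (rule has_bochner_integral_nn_integral)
    show "(\<integral>\<^sup>+ y. ennreal (e N y * y ^ i) \<partial>lborel) = ennreal (fact (n N + i) / (fact (n N) * real N ^ i))"
      unfolding e_def by (rule nn_integral_erlang_ith_moment) (use that in simp)
    show "AE y in lborel. 0 \<le> e N y * y ^ i" by (rule AE_I2) (simp add: e_def erlang_density_def)
  qed (auto simp: e_def)
  have fact_two_ratio: "fact (k + 2) / (fact k * c) = (real k + 1) * (real k + 2) / c" for k :: nat and c :: real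
  proof -
    have "fact (k + 2) = fact k * ((real k + 1) * (real k + 2))" by (simp add: numeral_2_eq_2 algebra_simps)
    then show ?thesis by simp
  qed
  define v where "v N = (real (n N) + 1) * (real (n N) + 2) / (real N)\<^sup>2 - 2 * x * ((real (n N) + 1) / real N) + x\<^sup>2" for N
  have m0: "has_bochner_integral lborel (e N) 1" and m1: "has_bochner_integral lborel (\<lambda>y. e N y * y) ((real (n N) + 1) / real N)"
    and m2: "has_bochner_integral lborel (\<lambda>y. e N y * y\<^sup>2) ((real (n N) + 1) * (real (n N) + 2) / (real N)\<^sup>2)"
    if "N > 0" for N
    using mom[OF that, of 0] mom[OF that, of 1] mom[OF that, of 2]
    by (simp_all add: fact_two_ratio ac_simps)
  have var: "has_bochner_integral lborel (\<lambda>y. e N y * (y - x)\<^sup>2) (v N)" if "N > 0" for N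
  proof -
    have "has_bochner_integral lborel (\<lambda>y. e N y * y\<^sup>2 - 2 * x * (e N y * y) + x\<^sup>2 * e N y)
        ((real (n N) + 1) * (real (n N) + 2) / (real N)\<^sup>2 - 2 * x * ((real (n N) + 1) / real N) + x\<^sup>2 * 1)"
      by (intro has_bochner_integral_add has_bochner_integral_diff has_bochner_integral_mult_right m0 m1 m2 that)
    then show ?thesis by (simp add: v_def power2_diff algebra_simps)
  qed
  have "v \<longlonglongrightarrow> (x + 0) * (x + 2 * 0) - 2 * x * (x + 0) + x\<^sup>2"
  proof (rule Lim_transform_eventually)
    show "(\<lambda>N. (real (n N) / real N + 1 / real N) * (real (n N) / real N + 2 * (1 / real N))
         - 2 * x * (real (n N) / real N + 1 / real N) + x\<^sup>2) \<longlonglongrightarrow> (x + 0) * (x + 2 * 0) - 2 * x * (x + 0) + x\<^sup>2"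
      by (intro tendsto_intros n lim_1_over_n)
    show "\<forall>\<^sub>F N in sequentially. (real (n N) / real N + 1 / real N) * (real (n N) / real N + 2 * (1 / real N))
         - 2 * x * (real (n N) / real N + 1 / real N) + x\<^sup>2 = v N"
      using eventually_gt_at_top[of 0] by eventually_elim (simp add: v_def field_simps power2_eq_square)
  qed
  also have "(x + 0) * (x + 2 * 0) - 2 * x * (x + 0) + x\<^sup>2 = 0" by (simp add: power2_eq_square algebra_simps)
  finally have "(\<lambda>N. B * v N) \<longlonglongrightarrow> B * 0" by (intro tendsto_intros)
  then have "\<forall>\<^sub>F N in sequentially. B * v N < r / 2" by (rule order_tendstoD) (use r in simp)
  with eventually_gt_at_top[of 0]
  have "\<forall>\<^sub>F N in sequentially. norm ((LINT y|lborel. e N y * V y) - V x) < r"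
  proof eventually_elim
    case (elim N)
    have e0: "0 \<le> e N y" for y by (simp add: e_def)
    have [measurable]: "e N \<in> borel_measurable borel" unfolding e_def by measurable
    have iV: "integrable lborel (\<lambda>y. e N y * V y)"
      by (rule Bochner_Integration.integrable_bound[of _ "\<lambda>y. C * e N y"])
         (use m0[OF elim(1)] bound C0 e0 in \<open>auto simp: has_bochner_integral_iff abs_mult mult.commute intro!: mult_right_mono\<close>)
    have "(LINT y|lborel. e N y * V y) - V x = (LINT y|lborel. e N y * V y - V x * e N y)"
      using iV m0[OF elim(1)] by (simp add: has_bochner_integral_iff)
    also have "\<bar>\<dots>\<bar> \<le> (LINT y|lborel. (r / 2) * e N y + B * (e N y * (y - x)\<^sup>2))"
    proof (rule order_trans[OF integral_abs_bound], rule integral_mono)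
      fix y
      have "\<bar>e N y * V y - V x * e N y\<bar> = e N y * \<bar>V y - V x\<bar>"
      proof -
        have "e N y * V y - V x * e N y = e N y * (V y - V x)" by (simp add: algebra_simps)
        then show ?thesis using e0[of y] by (simp add: abs_mult)
      qed
      also have "\<dots> \<le> e N y * (r / 2 + B * (y - x)\<^sup>2)" by (rule mult_left_mono[OF le e0])
      finally show "\<bar>e N y * V y - V x * e N y\<bar> \<le> (r / 2) * e N y + B * (e N y * (y - x)\<^sup>2)" by (simp add: algebra_simps)
    qed (use iV m0[OF elim(1)] var[OF elim(1)] in \<open>auto simp: has_bochner_integral_iff\<close>)
    also have "\<dots> = r / 2 + B * v N"
      using m0[OF elim(1)] var[OF elim(1)] by (simp add: has_bochner_integral_iff)
    finally show ?case using elim(2) by simp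
  qed
  then show "\<exists>no. \<forall>N\<ge>no. norm ((LINT y|lborel. erlang_density (n N) (real N) y * V y) - V x) < r"
    by (simp add: eventually_sequentially e_def)
qed

lemma set_integral_half_line_pos:
  fixes g :: "real \<Rightarrow> real"
  assumes int: "set_integrable lborel {0..} g" and nonneg: "\<And>x. 0 \<le> x \<Longrightarrow> 0 \<le> g x"
    and pos: "\<And>x. 0 < x \<Longrightarrow> x < d \<Longrightarrow> 0 < g x" and d: "0 < d"
  shows "0 < (LINT x:{0..}|lborel. g x)"
proof -
  have ge: "0 \<le> (LINT x:{0..}|lborel. g x)"
    unfolding set_lebesgue_integral_def
    by (rule Bochner_Integration.integral_nonneg) (use nonneg in \<open>auto split: split_indicator\<close>)
  have "(LINT x:{0..}|lborel. g x) \<noteq> 0"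
  proof
    assume "(LINT x:{0..}|lborel. g x) = 0"
    then have "AE x in lborel. indicator {0..} x *\<^sub>R g x = 0"
      unfolding set_lebesgue_integral_def
      by (subst (asm) integral_nonneg_eq_0_iff_AE)
         (use int nonneg in \<open>auto simp: set_integrable_def split: split_indicator\<close>)
    then have "AE x in lborel. x \<notin> {0<..<d}"
      by eventually_elim (use pos in \<open>force split: split_indicator_asm\<close>)
    then have "{0<..<d} \<in> null_sets lborel" by (subst AE_iff_null_sets) auto
    then show False using d by (auto simp: null_sets_def)
  qed
  then show ?thesis using ge by simp
qed

lemma nat_floor_over_tendsto:
  fixes x :: real assumes "0 \<le> x"
  shows "(\<lambda>N. real (nat \<lfloor>real N * x\<rfloor>) / real N) \<longlonglongrightarrow> x"
proof (rule real_tendsto_sandwich)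
  have f: "real (nat \<lfloor>real N * x\<rfloor>) = of_int \<lfloor>real N * x\<rfloor>" for N
    using assms by (simp add: of_nat_nat)
  show "\<forall>\<^sub>F N in sequentially. x - 1 / real N \<le> real (nat \<lfloor>real N * x\<rfloor>) / real N"
    using eventually_gt_at_top[of 0]
  proof eventually_elim
    case (elim N)
    have "real N * x - 1 \<le> of_int \<lfloor>real N * x\<rfloor>" by linarith
    then have "(real N * x - 1) / real N \<le> of_int \<lfloor>real N * x\<rfloor> / real N" by (rule divide_right_mono) simp
    then show ?case using elim unfolding f by (simp add: diff_divide_distrib)
  qed
  show "\<forall>\<^sub>F N in sequentially. real (nat \<lfloor>real N * x\<rfloor>) / real N \<le> x"
    using eventually_gt_at_top[of 0]
  proof eventually_elim
    case (elim N)
    have "of_int \<lfloor>real N * x\<rfloor> \<le> real N * x" by linarith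
    then show ?case using elim unfolding f by (simp add: field_simps)
  qed
  have "(\<lambda>N. x - 1 / real N) \<longlonglongrightarrow> x - 0" by (intro tendsto_intros lim_1_over_n)
  then show "(\<lambda>N. x - 1 / real N) \<longlonglongrightarrow> x" by simp
qed simp

section \<open>First properties of scale functions\<close>

lemma scale_function_measurable:
  assumes "is_scale_function R W"
  shows "W \<in> borel_measurable borel"
proof -
  have "(\<lambda>x. indicator {0..} x *\<^sub>R W x) \<in> borel_measurable borel"
    by (rule borel_measurable_continuous_on_indicator) (use assms in \<open>auto simp: is_scale_function_def\<close>)
  also have "(\<lambda>x. indicator {0..} x *\<^sub>R W x) = W"
    using assms by (auto simp: is_scale_function_def fun_eq_iff split: split_indicator)
  finally show ?thesis .
qed

lemma scale_function_isCont:
  assumes "is_scale_function R W" "0 < x"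
  shows "isCont W x"
proof -
  have "continuous_on {0<..} W"
    by (rule continuous_on_subset[of "{0..}"]) (use assms in \<open>auto simp: is_scale_function_def\<close>)
  then show ?thesis using assms(2) by (simp add: continuous_on_eq_continuous_at)
qed

text \<open>As \<open>W\<close> is monotone, the part of the Laplace integral over
  \<open>[x, x + 1]\<close> alone is at least \<open>exp (- u * (x + 1)) * W x\<close>; the factor
  \<open>exp u\<close> undoes the shift by 1.\<close>

lemma scale_function_exp_bound:
  assumes sc: "is_scale_function R W" and u: "0 < u"
  shows "exp (- u * x) * W x \<le> exp u * (- (1 / R u))"
proof (cases "0 \<le> x")
  case True
  have int: "set_integrable lborel {0..} (\<lambda>x. exp (- u * x) * W x)"
    and eq: "(LINT x:{0..}|lborel. exp (- u * x) * W x) = - (1 / R u)"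
    using sc u by (auto simp: is_scale_function_def)
  have "exp (- u * (x + 1)) * W x = (LINT y|lborel. indicator {x..x+1} y *\<^sub>R (exp (- u * (x + 1)) * W x))"
    by (simp add: measure_def)
  also have "\<dots> \<le> (LINT y|lborel. indicator {0..} y *\<^sub>R (exp (- u * y) * W y))"
  proof (rule integral_mono)
    show "integrable lborel (\<lambda>y. indicator {x..x+1} y *\<^sub>R (exp (- u * (x + 1)) * W x))"
      by (intro integrable_scaleR_left integrable_real_indicator) simp_all
    show "integrable lborel (\<lambda>y. indicator {0..} y *\<^sub>R (exp (- u * y) * W y))"
      using int by (simp add: set_integrable_def)
    fix y
    show "indicator {x..x+1} y *\<^sub>R (exp (- u * (x + 1)) * W x) \<le> indicator {0..} y *\<^sub>R (exp (- u * y) * W y)"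
    proof (cases "y \<in> {x..x+1}")
      case y: True
      have "W x \<le> W y" using sc y True by (auto simp: is_scale_function_def mono_on_def)
      moreover have "exp (- u * (x + 1)) \<le> exp (- u * y)" using u y by simp
      ultimately have "exp (- u * (x + 1)) * W x \<le> exp (- u * y) * W y"
        using sc by (intro mult_mono) (auto simp: is_scale_function_def)
      then show ?thesis using y True by simp
    next
      case False
      then show ?thesis using sc by (auto simp: is_scale_function_def split: split_indicator)
    qed
  qed
  also have "\<dots> = - (1 / R u)" using eq by (simp add: set_lebesgue_integral_def)
  finally have "exp u * (exp (- u * (x + 1)) * W x) \<le> exp u * (- (1 / R u))" by (rule mult_left_mono) simp
  moreover have "exp u * (exp (- u * (x + 1)) * W x) = exp (- u * x) * W x"
    by (simp add: algebra_simps flip: exp_add)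
  ultimately show ?thesis by linarith
next
  case False
  have "0 \<le> (LINT x:{0..}|lborel. exp (- u * x) * W x)"
    unfolding set_lebesgue_integral_def
    by (rule Bochner_Integration.integral_nonneg) (use sc in \<open>auto simp: is_scale_function_def\<close>)
  then have "0 \<le> - (1 / R u)" using sc u by (auto simp: is_scale_function_def)
  then have "0 \<le> exp u * (- (1 / R u))" by (intro mult_nonneg_nonneg) auto
  moreover have "W x = 0" using False sc by (simp add: is_scale_function_def)
  ultimately show ?thesis by simp
qed

text \<open>The transform of a positive function is positive. A zero of \<open>R\<close> is excluded
  as well, because \<open>1 / 0 = 0\<close> would make the transform vanish.\<close>

lemma scale_function_exponent_neg:
  assumes sc: "is_scale_function R W" and pos: "\<And>x. 0 < x \<Longrightarrow> 0 < W x" and u: "0 < u"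
  shows "R u < 0"
proof -
  have "0 < (LINT x:{0..}|lborel. exp (- u * x) * W x)"
    by (rule set_integral_half_line_pos[where d=1]) (use sc pos u in \<open>auto simp: is_scale_function_def\<close>)
  then have "0 < - (1 / R u)" using sc u by (auto simp: is_scale_function_def)
  then show ?thesis by (simp add: field_simps)
qed

text \<open>
  The Poissonised values \<open>a\<^sub>n = \<integral> W(x) e\<^sup>-\<^sup>u\<^sup>x (u x)\<^sup>n / n! dx\<close> have a generating function that is inverse to the one
  of the coefficients \<open>p\<^sub>j\<close> of \<open>- R(u (1 - s))\<close>. As \<open>p\<^sub>j \<ge> 0\<close> for \<open>j \<ge> 2\<close>, they form a log-concave sequence, and
  so do the averages of \<open>e\<^sup>-\<^sup>x W(x)\<close> over Erlang laws, which concentrate as \<open>N \<rightarrow> \<infinity>\<close>. The factor \<open>e\<^sup>-\<^sup>x\<close> makes the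
  sampled function bounded.
\<close>

lemma scale_function_log_concave:
  fixes \<alpha> \<beta> :: real
  assumes \<mu>: "levy_measure_pos \<mu>" and \<alpha>: "0 \<le> \<alpha>"
    and sc: "is_scale_function (branching_mechanism \<alpha> \<beta> \<mu>) W" and pos: "\<And>x. 0 < x \<Longrightarrow> 0 < W x"
    and xyz: "0 < x" "x < y" "y < z"
  shows "(y - x) * (ln (W z) - ln (W y)) \<le> (z - y) * (ln (W y) - ln (W x))"
proof -
  let ?R = "branching_mechanism \<alpha> \<beta> \<mu>"
  have [measurable]: "W \<in> borel_measurable borel" by (rule scale_function_measurable[OF sc])
  have W0: "0 \<le> W t" and Wneg: "t < 0 \<Longrightarrow> W t = 0" for t using sc by (auto simp: is_scale_function_def)
  have int: "set_integrable lborel {0..} (\<lambda>x. exp (- u * x) * W x)"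
    and eq: "(LINT x:{0..}|lborel. exp (- u * x) * W x) = - (1 / ?R u)" if "0 < u" for u
    using sc that by (auto simp: is_scale_function_def)
  have Rneg: "?R u < 0" if "0 < u" for u by (rule scale_function_exponent_neg[OF sc pos that])
  define a where "a u n = (LINT x:{0..}|lborel. exp (- u * x) * ((u * x) ^ n / fact n) * W x)" for u n
  have apos: "0 < a u n" if u: "0 < u" for u n
    unfolding a_def
  proof (rule set_integral_half_line_pos[where d=1])
    show "set_integrable lborel {0..} (\<lambda>x. exp (- u * x) * ((u * x) ^ n / fact n) * W x)"
      by (rule laplace_power_integrable[OF _ W0 int u]) simp
  qed (use u W0 pos in auto)
  have alc: "a u (n + 2) * a u n \<le> (a u (n + 1))\<^sup>2" if u: "0 < u" for u n
  proof -
    obtain p where p: "p 0 = - ?R u" "\<And>j. 2 \<le> j \<Longrightarrow> 0 \<le> p j"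
      "\<And>s. \<bar>s\<bar> < 1 \<Longrightarrow> (\<lambda>j. p j * s ^ j) sums (- ?R (u * (1 - s)))"
      using branching_power_series[OF \<mu> \<alpha> u] by blast
    show ?thesis
    proof (rule renewal_log_concave[OF _ p(2) apos[OF u]])
      show "0 < p 0" using Rneg[OF u] p(1) by simp
      show "(\<Sum>i\<le>Suc n. p i * a u (Suc n - i)) = 0" for n
      proof (rule convolution_inverse_of_sums[OF _ p(3)])
        fix s :: real assume s: "\<bar>s\<bar> < 1"
        have us: "0 < u * (1 - s)" using s u by simp
        show "(\<lambda>n. a u n * s ^ n) sums (- (1 / ?R (u * (1 - s))))"
          using laplace_power_series[OF _ W0 int u s] eq[OF us] by (simp add: a_def)
        show "- ?R (u * (1 - s)) * (- (1 / ?R (u * (1 - s)))) = 1" using Rneg[OF us] by simp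
      qed
    qed
  qed
  define V where "V x = exp (- x) * W x" for x
  have [measurable]: "V \<in> borel_measurable borel" unfolding V_def by measurable
  have Vb: "\<bar>V t\<bar> \<le> exp 1 * (- (1 / ?R 1))" for t
    using scale_function_exp_bound[OF sc, of 1 t] W0[of t] by (simp add: V_def)
  have cont: "isCont V t" if "0 < t" for t
    unfolding V_def using scale_function_isCont[OF sc that] by (intro continuous_intros)
  define v where "v N n = (LINT y|lborel. erlang_density n (real N) y * V y)" for N n
  \<comment> \<open>The factor \<open>exp (- y)\<close> in \<open>V\<close> tilts the Erlang law of
    rate \<open>N\<close> to rate \<open>N + 1\<close> and leaves a power of
    \<open>N / (N + 1)\<close>.\<close>
  have v_a: "v N n = real N * (real N / (real N + 1)) ^ n * a (real N + 1) n" if N: "N > 0" for N n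
  proof -
    have "v N n = (LINT y|lborel. real N * (real N / (real N + 1)) ^ n *
        (indicator {0..} y *\<^sub>R (exp (- (real N + 1) * y) * (((real N + 1) * y) ^ n / fact n) * W y)))"
      unfolding v_def
    proof (rule Bochner_Integration.integral_cong[OF refl])
      fix y
      have "exp (- (real N * y)) * exp (- y) = exp (- (real N + 1) * y)" by (simp add: algebra_simps flip: exp_add)
      then show "erlang_density n (real N) y * V y = real N * (real N / (real N + 1)) ^ n *
        (indicator {0..} y *\<^sub>R (exp (- (real N + 1) * y) * (((real N + 1) * y) ^ n / fact n) * W y))"
        using Wneg[of y] by (auto simp: erlang_density_def V_def power_mult_distrib power_divide split: split_indicator)
    qed
    also have "\<dots> = real N * (real N / (real N + 1)) ^ n * a (real N + 1) n"
      unfolding a_def set_lebesgue_integral_def by (rule integral_mult_right_zero)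
    finally show ?thesis .
  qed
  \<comment> \<open>The prefactor of \<open>a (real N + 1) n\<close> in \<open>v_a\<close> is
    log-affine in \<open>n\<close>, so it cancels from the three-point inequality.\<close>
  have three: "(real q - real p) * (ln (v N r) - ln (v N q)) \<le> (real r - real q) * (ln (v N q) - ln (v N p))"
    if N: "N > 0" and pq: "p \<le> q" "q \<le> r" for N p q r
  proof -
    have l: "ln (v N n) = ln (real N) + real n * ln (real N / (real N + 1)) + ln (a (real N + 1) n)" for n
      using N apos[of "real N + 1" n] unfolding v_a[OF N] by (simp add: ln_mult_pos ln_realpow)
    have "(real q - real p) * (ln (a (real N + 1) r) - ln (a (real N + 1) q)) \<le>
       (real r - real q) * (ln (a (real N + 1) q) - ln (a (real N + 1) p))"
      by (rule log_concave_three_points[OF apos alc pq]) auto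
    then show ?thesis unfolding l by (simp add: algebra_simps)
  qed
  \<comment> \<open>As \<open>k t N / N\<close> tends to \<open>t\<close>, dividing the inequality
    between indices by \<open>N\<close> gives, in the limit, the inequality between points.\<close>
  define k where "k t N = nat \<lfloor>real N * t\<rfloor>" for t :: real and N
  have klim: "(\<lambda>N. real (k t N) / real N) \<longlonglongrightarrow> t" if "0 < t" for t
    unfolding k_def by (rule nat_floor_over_tendsto) (use that in simp)
  have vlim: "(\<lambda>N. ln (v N (k t N))) \<longlonglongrightarrow> ln (V t)" if "0 < t" for t
    using erlang_sampling[OF _ Vb cont[OF that] klim[OF that]] pos[OF that]
    by (intro tendsto_ln) (auto simp: v_def V_def)
  have "(y - x) * (ln (V z) - ln (V y)) \<le> (z - y) * (ln (V y) - ln (V x))"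
  proof (rule LIMSEQ_le)
    show "(\<lambda>N. (real (k y N) / real N - real (k x N) / real N) * (ln (v N (k z N)) - ln (v N (k y N))))
        \<longlonglongrightarrow> (y - x) * (ln (V z) - ln (V y))"
      by (intro tendsto_intros klim vlim) (use xyz in auto)
    show "(\<lambda>N. (real (k z N) / real N - real (k y N) / real N) * (ln (v N (k y N)) - ln (v N (k x N))))
        \<longlonglongrightarrow> (z - y) * (ln (V y) - ln (V x))"
      by (intro tendsto_intros klim vlim) (use xyz in auto)
    have "(real (k y N) / real N - real (k x N) / real N) * (ln (v N (k z N)) - ln (v N (k y N))) \<le>
        (real (k z N) / real N - real (k y N) / real N) * (ln (v N (k y N)) - ln (v N (k x N)))" if N: "1 \<le> N" for N
    proof -
      have "k x N \<le> k y N" "k y N \<le> k z N" unfolding k_def using xyz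
        by (auto intro!: nat_mono floor_mono mult_left_mono)
      from divide_right_mono[OF three[OF _ this, of N], of "real N"] N show ?thesis
        by (simp add: diff_divide_distrib left_diff_distrib right_diff_distrib)
    qed
    then show "\<exists>M. \<forall>N\<ge>M. (real (k y N) / real N - real (k x N) / real N) * (ln (v N (k z N)) - ln (v N (k y N))) \<le>
        (real (k z N) / real N - real (k y N) / real N) * (ln (v N (k y N)) - ln (v N (k x N)))" by blast
  qed
  \<comment> \<open>The logarithms of \<open>V\<close> and \<open>W\<close> differ by a linear
    function, which contributes equally to both sides.\<close>
  moreover have "ln (V t) = ln (W t) - t" if "0 < t" for t
    using pos[OF that] by (simp add: V_def ln_mult_pos)
  ultimately show ?thesis using xyz by (simp add: algebra_simps)
qed

subsection \<open>The Laplace transform of k\<close>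

lemma log_concave_slope_decreasing:
  fixes g :: "real \<Rightarrow> real"
  assumes three: "\<And>x y z. 0 < x \<Longrightarrow> x < y \<Longrightarrow> y < z \<Longrightarrow> (y - x) * (g z - g y) \<le> (z - y) * (g y - g x)"
    and x: "0 < x" and h: "0 < h" "h \<le> h'"
  shows "(g (x + h') - g x) / h' \<le> (g (x + h) - g x) / h"
proof (cases "h = h'")
  case False
  then have "(x + h - x) * (g (x + h') - g (x + h)) \<le> (x + h' - (x + h)) * (g (x + h) - g x)"
    by (intro three) (use x h in auto)
  then have "h * (g (x + h') - g x) \<le> h' * (g (x + h) - g x)" by (simp add: algebra_simps)
  then show ?thesis using h by (simp add: field_simps)
qed simp

text \<open>Concavity compares the right slopes with a slope further left, over
  \<open>[a / 2, a]\<close>. The bound is uniform in \<open>x \<ge> a\<close> and \<open>h\<close>,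
  which later supplies the dominating constant for the difference quotients.\<close>

lemma log_concave_slope_le:
  fixes g :: "real \<Rightarrow> real"
  assumes three: "\<And>x y z. 0 < x \<Longrightarrow> x < y \<Longrightarrow> y < z \<Longrightarrow> (y - x) * (g z - g y) \<le> (z - y) * (g y - g x)"
    and a: "0 < a" "a \<le> x" and h: "0 < h"
  shows "(g (x + h) - g x) / h \<le> (g a - g (a / 2)) / (a / 2)"
proof -
  have "(x - a / 2) * (g (x + h) - g x) \<le> (x + h - x) * (g x - g (a / 2))"
    by (intro three) (use a h in auto)
  then have "(g (x + h) - g x) / h \<le> (g x - g (a / 2)) / (x - a / 2)"
    using a h by (simp add: field_simps)
  also have "\<dots> \<le> (g a - g (a / 2)) / (a / 2)"
    using log_concave_slope_decreasing[OF three, of "a/2" "a/2" "x - a/2"] a by simp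
  finally show ?thesis .
qed

text \<open>The slopes of \<open>ln W\<close> increase as the step shrinks and are bounded above,
  hence converge to their supremum; exponentiation carries the derivative over to
  \<open>W\<close>.\<close>

lemma log_concave_right_derivative:
  fixes W :: "real \<Rightarrow> real"
  assumes pos: "\<And>x. 0 < x \<Longrightarrow> 0 < W x"
    and three: "\<And>x y z. 0 < x \<Longrightarrow> x < y \<Longrightarrow> y < z \<Longrightarrow>
      (y - x) * (ln (W z) - ln (W y)) \<le> (z - y) * (ln (W y) - ln (W x))"
    and x: "0 < x"
  shows "\<exists>d. (W has_real_derivative d) (at_right x)"
proof -
  define g where "g y = ln (W y)" for y
  have three': "\<And>x y z. 0 < x \<Longrightarrow> x < y \<Longrightarrow> y < z \<Longrightarrow> (y - x) * (g z - g y) \<le> (z - y) * (g y - g x)"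
    using three by (simp add: g_def)
  define s where "s h = (g (x + h) - g x) / h" for h
  define l where "l = (SUP h\<in>{0<..}. s h)"
  have bdd: "bdd_above (s ` {0<..})"
    by (rule bdd_aboveI[of _ "(g x - g (x / 2)) / (x / 2)"])
       (use log_concave_slope_le[OF three' x order_refl] in \<open>auto simp: s_def\<close>)
  have "(s \<longlongrightarrow> l) (at_right 0)"
  proof (rule increasing_tendsto)
    show "\<forall>\<^sub>F h in at_right 0. s h \<le> l"
      using eventually_at_right_less[of "0::real"]
      by eventually_elim (auto simp: l_def intro!: cSUP_upper bdd)
    fix y assume "y < l"
    then obtain h where h: "h > 0" "y < s h"
      unfolding l_def by (subst (asm) less_cSUP_iff) (use bdd in auto)
    have "\<forall>\<^sub>F h' in at_right 0. h' \<in> {0<..<h}" using h(1) by (rule eventually_at_right_real)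
    then show "\<forall>\<^sub>F h' in at_right 0. y < s h'"
    proof eventually_elim
      case (elim h')
      then have "s h \<le> s h'" unfolding s_def by (intro log_concave_slope_decreasing[OF three' x]) auto
      then show ?case using h(2) by simp
    qed
  qed
  then have "(g has_real_derivative l) (at_right x)"
    unfolding has_field_derivative_iff
    by (subst filterlim_at_right_to_0) (simp add: s_def[abs_def] add.commute)
  then have "((\<lambda>y. exp (g y)) has_real_derivative exp (g x) * l) (at_right x)"
    by (auto intro!: derivative_eq_intros)
  moreover have "((\<lambda>y. exp (g y)) has_real_derivative exp (g x) * l) (at_right x)
      \<longleftrightarrow> (W has_real_derivative exp (g x) * l) (at_right x)"
  proof (rule has_field_derivative_cong_eventually)
    show "\<forall>\<^sub>F y in at_right x. exp (g y) = W y"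
      using eventually_at_right_less[of x] by eventually_elim (use pos x in \<open>auto simp: g_def\<close>)
  qed (use pos x in \<open>simp add: g_def\<close>)
  ultimately show ?thesis by blast
qed

lemma right_derivativeI:
  fixes f :: "real \<Rightarrow> real"
  assumes "(f has_real_derivative d) (at_right x)"
  shows "right_derivative f x = d"
  using assms unfolding right_derivative_def has_real_derivative_iff_has_vector_derivative
  by (intro vector_derivative_within trivial_limit_at_right_real)

lemma right_derivative_sequence:
  fixes f :: "real \<Rightarrow> real"
  assumes "(f has_real_derivative d) (at_right x)"
  shows "(\<lambda>n. (f (x + 1 / real (Suc n)) - f x) * real (Suc n)) \<longlonglongrightarrow> d"
proof -
  have "((\<lambda>y. (f y - f x) / (y - x)) \<longlongrightarrow> d) (at_right x)"
    using assms by (simp add: has_field_derivative_iff)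
  moreover have "filterlim (\<lambda>n. x + 1 / real (Suc n)) (at_right x) sequentially"
  proof -
    have "(\<lambda>n. x + 1 / real (Suc n)) \<longlonglongrightarrow> x + 0"
      by (intro tendsto_intros LIMSEQ_Suc lim_1_over_n)
    then show ?thesis by (auto simp: filterlim_at)
  qed
  ultimately have "(\<lambda>n. (f (x + 1 / real (Suc n)) - f x) / (x + 1 / real (Suc n) - x)) \<longlonglongrightarrow> d"
    by (rule filterlim_compose)
  then show ?thesis by simp
qed

text \<open>Dominated convergence applied to the difference quotients, whose integrals telescope.\<close>

lemma log_concave_integral_right_derivative:
  fixes W :: "real \<Rightarrow> real"
  assumes pos: "\<And>x. 0 < x \<Longrightarrow> 0 < W x"
    and three: "\<And>x y z. 0 < x \<Longrightarrow> x < y \<Longrightarrow> y < z \<Longrightarrow>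
      (y - x) * (ln (W z) - ln (W y)) \<le> (z - y) * (ln (W y) - ln (W x))"
    and mono: "\<And>x y. 0 < x \<Longrightarrow> x \<le> y \<Longrightarrow> W x \<le> W y"
    and cont: "\<And>x. 0 < x \<Longrightarrow> isCont W x"
    and [measurable]: "W \<in> borel_measurable borel" "w \<in> borel_measurable borel"
    and w: "\<And>x. 0 < x \<Longrightarrow> (W has_real_derivative w x) (at_right x)"
    and ab: "0 < a" "a \<le> b"
  shows "set_integrable lborel {a..b} w" "(LINT x:{a..b}|lborel. w x) = W b - W a"
proof -
  define g where "g y = ln (W y)" for y
  have three': "\<And>x y z. 0 < x \<Longrightarrow> x < y \<Longrightarrow> y < z \<Longrightarrow> (y - x) * (g z - g y) \<le> (z - y) * (g y - g x)"
    using three by (simp add: g_def)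
  define S where "S = (g a - g (a / 2)) / (a / 2)"
  define q where "q n x = (W (x + 1 / real (Suc n)) - W x) * real (Suc n)" for n x
  have qlim: "(\<lambda>n. q n x) \<longlonglongrightarrow> w x" if "0 < x" for x
    unfolding q_def by (rule right_derivative_sequence[OF w[OF that]])
  have q0: "0 \<le> q n x" if "0 < x" for n x
    unfolding q_def using mono[of x "x + 1 / real (Suc n)"] that by simp
  have qb: "q n x \<le> W (b + 1) * S" if x: "a \<le> x" "x \<le> b" for n x
  proof -
    define h where "h = 1 / real (Suc n)"
    have h: "0 < h" "h \<le> 1" by (auto simp: h_def)
    have x0: "0 < x" using x ab by simp
    have g_le: "(g (x + h) - g x) / h \<le> S"
      unfolding S_def by (rule log_concave_slope_le[OF three']) (use x ab h in auto)
    have g0: "0 \<le> (g (x + h) - g x) / h"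
      using mono[of x "x + h"] pos[OF x0] h x0 by (simp add: g_def)
    \<comment> \<open>Increments of \<open>W\<close> are reduced to increments of
      \<open>ln W\<close> through \<open>1 - exp (- z) \<le> z\<close>.\<close>
    have "W (x + h) - W x = W (x + h) * (1 - exp (- (g (x + h) - g x)))"
      using pos[OF x0] pos[of "x + h"] x0 h by (simp add: g_def exp_diff algebra_simps)
    also have "\<dots> \<le> W (x + h) * (g (x + h) - g x)"
    proof (rule mult_left_mono)
      show "1 - exp (- (g (x + h) - g x)) \<le> g (x + h) - g x"
        using exp_ge_add_one_self[of "- (g (x + h) - g x)"] by linarith
    qed (use pos[of "x + h"] x0 h in auto)
    finally have "(W (x + h) - W x) / h \<le> W (x + h) * (g (x + h) - g x) / h"
      by (rule divide_right_mono) (use h in simp)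
    then have "q n x \<le> W (x + h) * ((g (x + h) - g x) / h)"
      by (simp add: q_def h_def)
    also have "\<dots> \<le> W (b + 1) * S"
      using g_le g0 mono[of "x + h" "b + 1"] x h x0 pos[of "b+1"] ab by (intro mult_mono) auto
    finally show ?thesis .
  qed
  have [measurable]: "q n \<in> borel_measurable borel" for n unfolding q_def by measurable
  have dom: "integrable lborel (\<lambda>x. indicator {a..b} x *\<^sub>R (W (b + 1) * S))"
    by (intro integrable_scaleR_left integrable_real_indicator) (use emeasure_lborel_Icc[OF ab(2)] in auto)
  have lim: "AE x in lborel. (\<lambda>n. indicator {a..b} x *\<^sub>R q n x) \<longlonglongrightarrow> indicator {a..b} x *\<^sub>R w x"
    by (rule AE_I2) (use ab qlim in \<open>auto split: split_indicator intro!: tendsto_intros\<close>)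
  have bound: "AE x in lborel. norm (indicator {a..b} x *\<^sub>R q n x) \<le> indicator {a..b} x *\<^sub>R (W (b + 1) * S)" for n
    by (rule AE_I2) (use ab qb q0 in \<open>auto split: split_indicator\<close>)
  have "integrable lborel (\<lambda>x. indicator {a..b} x *\<^sub>R w x)"
    by (rule integrable_dominated_convergence[OF _ _ dom lim bound]) measurable
  then show "set_integrable lborel {a..b} w" by (simp add: set_integrable_def)
  have 1: "(\<lambda>n. LINT x|lborel. indicator {a..b} x *\<^sub>R q n x) \<longlonglongrightarrow> (LINT x|lborel. indicator {a..b} x *\<^sub>R w x)"
    by (rule integral_dominated_convergence[OF _ _ dom lim bound]) measurable
  \<comment> \<open>The lower end \<open>a / 2\<close> makes \<open>\<Phi>\<close> differentiable
    from both sides at every \<open>t \<ge> a\<close>. The integral of a difference quotient of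
    \<open>W\<close> becomes a difference of two quotients of \<open>\<Phi>\<close>, one at
    \<open>b\<close> and one at \<open>a\<close>.\<close>
  define \<Phi> where "\<Phi> t = integral {a / 2..t} W" for t
  have D: "(\<Phi> has_real_derivative W t) (at t)" if t: "a \<le> t" for t
  proof -
    have "continuous_on {a/2..t+1} W" using cont ab by (intro continuous_at_imp_continuous_on) auto
    then have "(\<Phi> has_real_derivative W t) (at t within {a/2..t+1})"
      unfolding \<Phi>_def by (rule integral_has_real_derivative) (use t ab in auto)
    then have "(\<Phi> has_real_derivative W t) (at t within {a/2<..<t+1})"
      by (rule has_field_derivative_subset) auto
    moreover have "at t within {a/2<..<t+1} = at t" using t ab by (intro at_within_open) auto
    ultimately show ?thesis by simp
  qed
  have I: "(LINT x|lborel. indicator {a..b} x *\<^sub>R q n x) =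
      (\<Phi> (b + 1 / real (Suc n)) - \<Phi> b) * real (Suc n) - (\<Phi> (a + 1 / real (Suc n)) - \<Phi> a) * real (Suc n)" for n
  proof -
    have "(LINT x|lborel. q n x * indicator {a..b} x) =
      (\<Phi> (b + 1 / real (Suc n)) - \<Phi> b) * real (Suc n) - (\<Phi> (a + 1 / real (Suc n)) - \<Phi> a) * real (Suc n)"
    proof (rule integral_FTC_Icc_real[OF ab(2), where F="\<lambda>x. (\<Phi> (x + 1 / real (Suc n)) - \<Phi> x) * real (Suc n)"])
      fix x assume x: "a \<le> x" "x \<le> b"
      have "((\<lambda>x. \<Phi> (x + 1 / real (Suc n))) has_real_derivative W (x + 1 / real (Suc n))) (at x)"
        by (rule DERIV_shift[THEN iffD1]) (rule D[OF order_trans[OF x(1)]], simp)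
      then show "((\<lambda>x. (\<Phi> (x + 1 / real (Suc n)) - \<Phi> x) * real (Suc n)) has_real_derivative q n x) (at x)"
        unfolding q_def by (intro DERIV_cmult_right DERIV_diff D x)
      have "isCont (\<lambda>x. W (x + 1 / real (Suc n))) x"
      proof (rule isCont_o2[of _ _ W])
        have "0 < x + 1 / real (Suc n)" using x ab by (intro add_pos_nonneg) auto
        then show "isCont W (x + 1 / real (Suc n))" by (rule cont)
      qed simp
      then show "isCont (q n) x"
        unfolding q_def using cont[of x] x ab by (intro continuous_intros) auto
    qed
    then show ?thesis by (simp add: mult.commute)
  qed
  have 2: "(\<lambda>n. (\<Phi> (t + 1 / real (Suc n)) - \<Phi> t) * real (Suc n)) \<longlonglongrightarrow> W t" if "a \<le> t" for t
    by (rule right_derivative_sequence) (rule has_field_derivative_at_within[OF D[OF that]])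
  have "(\<lambda>n. LINT x|lborel. indicator {a..b} x *\<^sub>R q n x) \<longlonglongrightarrow> W b - W a"
    unfolding I by (intro tendsto_diff 2) (use ab in auto)
  from LIMSEQ_unique[OF 1 this] show "(LINT x:{a..b}|lborel. w x) = W b - W a"
    by (simp add: set_lebesgue_integral_def)
qed

section \<open>Laplace transforms of derivatives and of increments\<close>

lemma nn_integral_exp_atLeast:
  fixes u y :: real assumes "0 < u"
  shows "(\<integral>\<^sup>+x. ennreal (u * exp (- u * x)) * indicator {y..} x \<partial>lborel) = ennreal (exp (- u * y))"
proof -
  have "(\<integral>\<^sup>+x. ennreal (u * exp (- u * x)) * indicator {y..} x \<partial>lborel) = ennreal (0 - (- exp (- u * y)))"
  proof (rule nn_integral_FTC_atLeast)
    show "((\<lambda>x. - exp (- u * x)) has_real_derivative u * exp (- u * x)) (at x)" for x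
      by (auto intro!: derivative_eq_intros)
    have "((\<lambda>x. exp (- u * x)) \<longlongrightarrow> 0) at_top"
      using exp_neg_mult_tendsto_0[OF assms] by (simp add: mult.commute)
    then show "((\<lambda>x. - exp (- u * x)) \<longlongrightarrow> 0) at_top" by (rule tendsto_eq_intros) simp
  qed (use assms in auto)
  then show ?thesis by simp
qed

text \<open>Integration by parts as an application of Tonelli's theorem:
  \<open>exp (- u * y)\<close> is the integral of \<open>u * exp (- u * x)\<close> over
  \<open>x \<ge> y\<close>. Working in \<open>ennreal\<close> avoids boundary terms and
  integrability at infinity.\<close>

lemma laplace_primitive:
  fixes W w :: "real \<Rightarrow> real"
  assumes [measurable]: "W \<in> borel_measurable borel" "w \<in> borel_measurable borel"
    and cont: "continuous_on {0..} W" and W0: "0 \<le> W 0" and w0: "\<And>x. 0 < x \<Longrightarrow> 0 \<le> w x"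
    and int: "\<And>a b. 0 < a \<Longrightarrow> a \<le> b \<Longrightarrow> set_integrable lborel {a..b} w"
    and eq: "\<And>a b. 0 < a \<Longrightarrow> a \<le> b \<Longrightarrow> (LINT x:{a..b}|lborel. w x) = W b - W a"
    and u: "0 < u"
  shows "(\<integral>\<^sup>+x\<in>{0..}. ennreal (u * exp (- u * x) * W x) \<partial>lborel)
    = ennreal (W 0) + (\<integral>\<^sup>+x\<in>{0<..}. ennreal (exp (- u * x) * w x) \<partial>lborel)"
proof -
  have prim: "ennreal (W x) = ennreal (W 0) + (\<integral>\<^sup>+y. ennreal (w y) * indicator {0<..x} y \<partial>lborel)" if x: "0 \<le> x" for x
  proof (cases "x = 0")
    case False
    then have x: "0 < x" using x by simp
    \<comment> \<open>\<open>w\<close> may be unbounded at 0, so it is integrated from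
      \<open>x / (n + 2)\<close> on; monotone convergence and continuity of \<open>W\<close> at 0
      then give the primitive on all of \<open>(0, x]\<close>.\<close>
    define A where "A n = {x / real (n + 2)..x}" for n :: nat
    have An: "0 < x / real (n + 2)" "x / real (n + 2) \<le> x" for n
      using x by (auto simp: field_simps)
    have nn: "(\<integral>\<^sup>+y. ennreal (w y) * indicator (A n) y \<partial>lborel) = ennreal (W x - W (x / real (n + 2)))" for n
    proof -
      have "(\<integral>\<^sup>+y. ennreal (w y) * indicator (A n) y \<partial>lborel) = (\<integral>\<^sup>+y. ennreal (indicator (A n) y *\<^sub>R w y) \<partial>lborel)"
        by (intro nn_integral_cong) (auto split: split_indicator)
      also have "\<dots> = ennreal (LINT y|lborel. indicator (A n) y *\<^sub>R w y)"
      proof (rule nn_integral_eq_integral)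
        show "integrable lborel (\<lambda>y. indicator (A n) y *\<^sub>R w y)"
          using int[OF An] by (simp add: set_integrable_def A_def)
        show "AE y in lborel. 0 \<le> indicator (A n) y *\<^sub>R w y"
        proof (rule AE_I2)
          fix y show "0 \<le> indicator (A n) y *\<^sub>R w y"
            using w0[of y] An(1)[of n] by (auto split: split_indicator simp: A_def)
        qed
      qed
      also have "\<dots> = ennreal (W x - W (x / real (n + 2)))"
        using eq[OF An] by (simp add: set_lebesgue_integral_def A_def)
      finally show ?thesis .
    qed
    have "(\<lambda>n. \<integral>\<^sup>+y. ennreal (w y) * indicator (A n) y \<partial>lborel) \<longlonglongrightarrow> (\<integral>\<^sup>+y. ennreal (w y) * indicator {0<..x} y \<partial>lborel)"
    proof (rule nn_integral_LIMSEQ)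
      show "incseq (\<lambda>n y. ennreal (w y) * indicator (A n) y)"
      proof (rule incseq_SucI, rule le_funI, rule mult_left_mono)
        fix n y
        have "x / real (Suc n + 2) \<le> x / real (n + 2)" by (rule divide_left_mono) (use x in auto)
        then have "A n \<subseteq> A (Suc n)" unfolding A_def by auto
        then show "(indicator (A n) y :: ennreal) \<le> indicator (A (Suc n)) y" by (auto split: split_indicator)
      qed simp
      show "(\<lambda>n. ennreal (w y) * indicator (A n) y) \<longlonglongrightarrow> ennreal (w y) * indicator {0<..x} y" for y
      proof (cases "y \<in> {0<..x}")
        case True
        have "(\<lambda>n. x / real (n + 2)) \<longlonglongrightarrow> 0"
          using LIMSEQ_ignore_initial_segment[OF lim_const_over_n[of x], of 2] by simp
        then have "\<forall>\<^sub>F n in sequentially. x / real (n + 2) < y" by (rule order_tendstoD) (use True in auto)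
        then have "\<forall>\<^sub>F n in sequentially. ennreal (w y) * indicator (A n) y = ennreal (w y) * indicator {0<..x} y"
          by eventually_elim (use True in \<open>auto simp: A_def\<close>)
        then show ?thesis by (rule tendsto_eventually)
      next
        case False
        then have "y \<notin> A n" for n using An(1)[of n] by (auto simp: A_def simp del: of_nat_add)
        then show ?thesis using False by simp
      qed
    qed (auto simp: A_def)
    moreover have "(\<lambda>n. ennreal (W x - W (x / real (n + 2)))) \<longlonglongrightarrow> ennreal (W x - W 0)"
    proof (intro tendsto_ennrealI tendsto_diff tendsto_const)
      have "(\<lambda>n. x / real (n + 2)) \<longlonglongrightarrow> 0"
        using LIMSEQ_ignore_initial_segment[OF lim_const_over_n[of x], of 2] by simp
      then show "(\<lambda>n. W (x / real (n + 2))) \<longlonglongrightarrow> W 0"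
        by (rule continuous_on_tendsto_compose[OF cont]) (use x in auto)
    qed
    ultimately have I: "(\<integral>\<^sup>+y. ennreal (w y) * indicator {0<..x} y \<partial>lborel) = ennreal (W x - W 0)"
      unfolding nn by (rule LIMSEQ_unique)
    have "W 0 \<le> W x"
    proof (rule tendsto_upperbound)
      show "(\<lambda>n. W (x / real (n + 2))) \<longlonglongrightarrow> W 0"
        by (rule continuous_on_tendsto_compose[OF cont])
          (use x LIMSEQ_ignore_initial_segment[OF lim_const_over_n[of x], of 2] in auto)
      have "W (x / real (n + 2)) \<le> W x" for n
      proof -
        have "0 \<le> (LINT y:{x / real (n + 2)..x}|lborel. w y)"
          unfolding set_lebesgue_integral_def
        proof (rule Bochner_Integration.integral_nonneg)
          fix y show "0 \<le> indicator {x / real (n + 2)..x} y *\<^sub>R w y"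
            using w0[of y] An(1)[of n] by (auto split: split_indicator)
        qed
        then show ?thesis using eq[OF An] by simp
      qed
      then show "\<forall>\<^sub>F n in sequentially. W (x / real (n + 2)) \<le> W x" by simp
    qed simp
    then show ?thesis using W0 unfolding I by (simp flip: ennreal_plus)
  qed simp
  have "(\<integral>\<^sup>+x\<in>{0..}. ennreal (u * exp (- u * x) * W x) \<partial>lborel) =
    (\<integral>\<^sup>+x. ennreal (u * exp (- u * x)) * indicator {0..} x * ennreal (W 0) +
       (\<integral>\<^sup>+y. ennreal (u * exp (- u * x)) * (if y \<le> x then 1 else 0) * (ennreal (w y) * (if 0 < y then 1 else 0)) \<partial>lborel) \<partial>lborel)"
  proof (intro nn_integral_cong)
    fix x :: real
    show "ennreal (u * exp (- u * x) * W x) * indicator {0..} x =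
       ennreal (u * exp (- u * x)) * indicator {0..} x * ennreal (W 0) +
       (\<integral>\<^sup>+y. ennreal (u * exp (- u * x)) * (if y \<le> x then 1 else 0) * (ennreal (w y) * (if 0 < y then 1 else 0)) \<partial>lborel)"
    proof (cases "0 \<le> x")
      case True
      have "ennreal (u * exp (- u * x) * W x) = ennreal (u * exp (- u * x)) * ennreal (W x)"
        using u by (simp add: ennreal_mult')
      also have "\<dots> = ennreal (u * exp (- u * x)) * ennreal (W 0) +
        ennreal (u * exp (- u * x)) * (\<integral>\<^sup>+y. ennreal (w y) * indicator {0<..x} y \<partial>lborel)"
        unfolding prim[OF True] by (simp add: distrib_left)
      also have "ennreal (u * exp (- u * x)) * (\<integral>\<^sup>+y. ennreal (w y) * indicator {0<..x} y \<partial>lborel) =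
        (\<integral>\<^sup>+y. ennreal (u * exp (- u * x)) * (ennreal (w y) * indicator {0<..x} y) \<partial>lborel)"
        by (rule nn_integral_cmult[symmetric]) measurable
      also have "\<dots> = (\<integral>\<^sup>+y. ennreal (u * exp (- u * x)) * (if y \<le> x then 1 else 0) * (ennreal (w y) * (if 0 < y then 1 else 0)) \<partial>lborel)"
        by (intro nn_integral_cong) (auto split: split_indicator)
      finally show ?thesis using True by simp
    next
      case False
      have "(\<integral>\<^sup>+y. ennreal (u * exp (- u * x)) * (if y \<le> x then 1 else 0) * (ennreal (w y) * (if 0 < y then 1 else 0)) \<partial>lborel)
         = (\<integral>\<^sup>+(y::real). 0 \<partial>lborel)"
        by (rule nn_integral_cong) (use False in \<open>auto split: split_indicator\<close>)
      then show ?thesis using False by simp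
    qed
  qed
  also have "\<dots> = (\<integral>\<^sup>+x. ennreal (u * exp (- u * x)) * indicator {0..} x * ennreal (W 0) \<partial>lborel) +
     (\<integral>\<^sup>+x. (\<integral>\<^sup>+y. ennreal (u * exp (- u * x)) * (if y \<le> x then 1 else 0) * (ennreal (w y) * (if 0 < y then 1 else 0)) \<partial>lborel) \<partial>lborel)"
    by (rule nn_integral_add) measurable
  also have "(\<integral>\<^sup>+x. ennreal (u * exp (- u * x)) * indicator {0..} x * ennreal (W 0) \<partial>lborel) = ennreal (W 0)"
    using nn_integral_exp_atLeast[OF u, of 0] by (subst nn_integral_multc) auto
  also have "(\<integral>\<^sup>+x. (\<integral>\<^sup>+y. ennreal (u * exp (- u * x)) * (if y \<le> x then 1 else 0) * (ennreal (w y) * (if 0 < y then 1 else 0)) \<partial>lborel) \<partial>lborel)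
    = (\<integral>\<^sup>+y. (\<integral>\<^sup>+x. ennreal (u * exp (- u * x)) * (if y \<le> x then 1 else 0) * (ennreal (w y) * (if 0 < y then 1 else 0)) \<partial>lborel) \<partial>lborel)"
    by (rule lborel_pair.Fubini') measurable
  also have "\<dots> = (\<integral>\<^sup>+y. ennreal (exp (- u * y)) * (ennreal (w y) * (if 0 < y then 1 else 0)) \<partial>lborel)"
  proof (rule nn_integral_cong)
    fix y :: real
    have "(\<integral>\<^sup>+x. ennreal (u * exp (- u * x)) * (if y \<le> x then 1 else 0) * (ennreal (w y) * (if 0 < y then 1 else 0)) \<partial>lborel) =
      (\<integral>\<^sup>+x. ennreal (u * exp (- u * x)) * indicator {y..} x \<partial>lborel) * (ennreal (w y) * (if 0 < y then 1 else 0))"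
      by (subst nn_integral_multc[symmetric]) (auto intro!: nn_integral_cong split: split_indicator)
    then show "(\<integral>\<^sup>+x. ennreal (u * exp (- u * x)) * (if y \<le> x then 1 else 0) * (ennreal (w y) * (if 0 < y then 1 else 0)) \<partial>lborel) =
      ennreal (exp (- u * y)) * (ennreal (w y) * (if 0 < y then 1 else 0))"
      by (simp only: nn_integral_exp_atLeast[OF u])
  qed
  also have "\<dots> = (\<integral>\<^sup>+x\<in>{0<..}. ennreal (exp (- u * x) * w x) \<partial>lborel)"
    by (intro nn_integral_cong) (auto simp: ennreal_mult' split: split_indicator)
  finally show ?thesis .
qed

text \<open>Tonelli's theorem for \<open>m\<close> rests on this. The weight
  \<open>min (\<xi>\<^sup>2) 1\<close> is bounded away from 0 on each
  \<open>(1 / (n + 1), \<infinity>)\<close>, and the null set \<open>{..0}\<close> completes the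
  cover.\<close>

lemma levy_measure_sigma_finite:
  assumes \<nu>: "levy_measure_pos \<nu>"
  shows "sigma_finite_measure \<nu>"
proof
  have s[measurable_cong]: "sets \<nu> = sets borel" using \<nu> by (simp add: levy_measure_pos_def)
  have sp: "space \<nu> = UNIV" using sets_eq_imp_space_eq[OF s] by simp
  define A where "A n = {1 / real (Suc n)<..}" for n
  have fin: "emeasure \<nu> (A n) \<noteq> \<infinity>" for n
  proof -
    define d where "d = min ((1 / real (Suc n))\<^sup>2) 1"
    have d: "0 < d" by (simp add: d_def)
    have "ennreal d * emeasure \<nu> (A n) = (\<integral>\<^sup>+\<xi>. ennreal d * indicator (A n) \<xi> \<partial>\<nu>)"
      by (subst nn_integral_cmult_indicator) (auto simp: A_def s)
    also have "\<dots> \<le> (\<integral>\<^sup>+\<xi>. ennreal (min (\<xi>\<^sup>2) 1) \<partial>\<nu>)"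
    proof (rule nn_integral_mono)
      fix \<xi> :: real
      show "ennreal d * indicator (A n) \<xi> \<le> ennreal (min (\<xi>\<^sup>2) 1)"
      proof (cases "\<xi> \<in> A n")
        case True
        then have "(1 / real (Suc n))\<^sup>2 \<le> \<xi>\<^sup>2" by (intro power_mono) (auto simp: A_def)
        then have "d \<le> min (\<xi>\<^sup>2) 1" by (auto simp: d_def)
        then show ?thesis using True by (simp add: ennreal_leI)
      qed simp
    qed
    also have "\<dots> < \<infinity>" using \<nu> by (simp add: levy_measure_pos_def)
    finally show ?thesis using d by (auto simp: ennreal_mult_eq_top_iff)
  qed
  show "\<exists>B. countable B \<and> B \<subseteq> sets \<nu> \<and> \<Union> B = space \<nu> \<and> (\<forall>a\<in>B. emeasure \<nu> a \<noteq> \<infinity>)"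
  proof (intro exI[of _ "insert {..0} (range A)"] conjI)
    show "\<Union> (insert {..0} (range A)) = space \<nu>"
    proof -
      have "x \<in> \<Union> (insert {..0} (range A))" for x :: real
      proof (cases "x \<le> 0")
        case False
        then obtain n where "inverse (real (Suc n)) < x" using reals_Archimedean[of x] by auto
        then have "x \<in> A n" by (simp add: A_def field_simps)
        then show ?thesis by blast
      qed simp
      then show ?thesis using sp by blast
    qed
    show "\<forall>a\<in>insert {..0} (range A). emeasure \<nu> a \<noteq> \<infinity>"
      using fin \<nu> by (auto simp: levy_measure_pos_def)
  qed (auto simp: s A_def)
qed

lemma integrable_min_one:
  assumes "levy_measure_pos m" "(\<integral>\<^sup>+\<xi>. ennreal (min \<xi> 1) \<partial>m) < \<infinity>"
  shows "set_integrable m {0<..} (\<lambda>\<xi>. min \<xi> 1)"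
proof -
  have [measurable_cong]: "sets m = sets borel" using assms by (simp add: levy_measure_pos_def)
  have "integrable m (\<lambda>\<xi>. indicator {0<..} \<xi> *\<^sub>R min \<xi> 1)"
  proof (rule integrableI_nonneg)
    have "(\<integral>\<^sup>+\<xi>. ennreal (indicator {0<..} \<xi> *\<^sub>R min \<xi> 1) \<partial>m) \<le> (\<integral>\<^sup>+\<xi>. ennreal (min \<xi> 1) \<partial>m)"
      by (intro nn_integral_mono) (auto split: split_indicator)
    then show "(\<integral>\<^sup>+\<xi>. ennreal (indicator {0<..} \<xi> *\<^sub>R min \<xi> 1) \<partial>m) < \<infinity>" using assms(2) by simp
    show "AE \<xi> in m. 0 \<le> indicator {0<..} \<xi> *\<^sub>R min \<xi> 1"
    proof (rule AE_I2)
      fix \<xi> :: real show "0 \<le> indicator {0<..} \<xi> *\<^sub>R min \<xi> 1" by (cases "0 < \<xi>") auto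
    qed
  qed measurable
  then show ?thesis by (simp add: set_integrable_def)
qed

lemma immigration_integrable:
  fixes u :: real
  assumes m: "levy_measure_pos m" "(\<integral>\<^sup>+\<xi>. ennreal (min \<xi> 1) \<partial>m) < \<infinity>" and u: "0 \<le> u"
  shows "set_integrable m {0<..} (\<lambda>\<xi>. 1 - exp (- u * \<xi>))"
proof -
  have [measurable_cong]: "sets m = sets borel" using m by (simp add: levy_measure_pos_def)
  have i: "integrable m (\<lambda>\<xi>. (1 + u) * (indicator {0<..} \<xi> *\<^sub>R min \<xi> 1))"
    using integrable_min_one[OF m] by (simp add: set_integrable_def)
  show ?thesis unfolding set_integrable_def
  proof (rule Bochner_Integration.integrable_bound[OF i], measurable, rule AE_I2, cases)
    fix \<xi> :: real assume \<xi>: "0 < \<xi>"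
    have "1 - exp (- u * \<xi>) \<le> u * \<xi>" using exp_ge_add_one_self[of "- u * \<xi>"] by linarith
    moreover have "u * \<xi> \<le> (1 + u) * \<xi>" using \<xi> by simp
    moreover have "1 - exp (- u * \<xi>) \<le> (1 + u) * 1"
      using u by (simp add: add_increasing2 add_nonneg_nonneg)
    ultimately have "1 - exp (- u * \<xi>) \<le> (1 + u) * min \<xi> 1" by (auto simp: min_def)
    moreover have "0 \<le> 1 - exp (- u * \<xi>)" using u \<xi> by simp
    ultimately show "norm (indicator {0<..} \<xi> *\<^sub>R (1 - exp (- u * \<xi>))) \<le> norm ((1 + u) * (indicator {0<..} \<xi> *\<^sub>R min \<xi> 1))"
      using \<xi> u by (simp add: abs_mult)
  qed simp
qed

text \<open>\<open>W\<close> vanishes on the negative axis, so a shift by \<open>\<xi>\<close> just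
  multiplies its transform by \<open>exp (- u * \<xi>)\<close>.\<close>

lemma laplace_increment:
  fixes W :: "real \<Rightarrow> real"
  assumes [measurable]: "W \<in> borel_measurable borel"
    and Wneg: "\<And>x. x < 0 \<Longrightarrow> W x = 0" and mono: "mono W"
    and int: "set_integrable lborel {0..} (\<lambda>x. exp (- u * x) * W x)"
    and eq: "(LINT x:{0..}|lborel. exp (- u * x) * W x) = I" and \<xi>: "0 \<le> \<xi>"
  shows "(\<integral>\<^sup>+x. ennreal (exp (- u * x) * (W x - W (x - \<xi>))) \<partial>lborel) = ennreal ((1 - exp (- u * \<xi>)) * I)"
proof -
  have e: "(\<lambda>x. indicator {0..} x *\<^sub>R (exp (- u * x) * W x)) = (\<lambda>x. exp (- u * x) * W x)"
    using Wneg by (auto simp: fun_eq_iff split: split_indicator)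
  have h1: "has_bochner_integral lborel (\<lambda>x. exp (- u * x) * W x) I"
    using int eq unfolding set_integrable_def set_lebesgue_integral_def e by (simp add: has_bochner_integral_iff)
  then have "has_bochner_integral lborel (\<lambda>x. exp (- u * (- \<xi> + 1 * x)) * W (- \<xi> + 1 * x)) (I /\<^sub>R \<bar>1\<bar>)"
    by (subst (asm) lborel_has_bochner_integral_real_affine_iff[where t="-\<xi>" and c=1]) auto
  then have "has_bochner_integral lborel (\<lambda>x. exp (- u * \<xi>) * (exp (- u * (- \<xi> + 1 * x)) * W (- \<xi> + 1 * x))) (exp (- u * \<xi>) * I)"
    by (intro has_bochner_integral_mult_right) simp
  moreover have "exp (- u * \<xi>) * (exp (- u * (- \<xi> + 1 * x)) * W (- \<xi> + 1 * x)) = exp (- u * x) * W (x - \<xi>)" for x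
    by (simp add: algebra_simps flip: exp_add mult.assoc)
  ultimately have "has_bochner_integral lborel (\<lambda>x. exp (- u * x) * W (x - \<xi>)) (exp (- u * \<xi>) * I)"
    by (simp only:)
  from has_bochner_integral_diff[OF h1 this]
  have h2: "has_bochner_integral lborel (\<lambda>x. exp (- u * x) * (W x - W (x - \<xi>))) ((1 - exp (- u * \<xi>)) * I)"
    by (simp add: algebra_simps)
  show ?thesis
    using h2 nn_integral_eq_integral[of lborel "\<lambda>x. exp (- u * x) * (W x - W (x - \<xi>))"] monoD[OF mono, of "_ - \<xi>" _] \<xi>
    by (auto simp: has_bochner_integral_iff)
qed

lemma scale_function_mono:
  assumes "is_scale_function R W" shows "mono W"
proof (rule monoI)
  fix x y :: real assume "x \<le> y"
  then show "W x \<le> W y"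
    using assms by (cases "0 \<le> x") (auto simp: is_scale_function_def mono_on_def)
qed

text \<open>If \<open>W x = 0\<close>, monotonicity makes \<open>W\<close> vanish up to
  \<open>x\<close>; then the derivative and the increments in \<open>k\<close> vanish on
  \<open>(0, x)\<close>, against \<open>c > 0\<close>.\<close>

lemma scale_function_pos:
  assumes sc: "is_scale_function R W"
    and k: "\<And>x. 0 < x \<Longrightarrow> k x = k_function b m W x"
    and lim: "(k \<longlongrightarrow> c) (at_right 0)" and c: "0 < c" and x: "0 < x"
  shows "0 < W x"
proof (rule ccontr)
  assume "\<not> 0 < W x"
  moreover have "0 \<le> W y" for y using sc by (simp add: is_scale_function_def)
  ultimately have W0: "W y = 0" if "y \<le> x" for y
    using monoD[OF scale_function_mono[OF sc] that] by (metis antisym linorder_not_le order_trans)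
  have k0: "k y = 0" if y: "0 < y" "y < x" for y
  proof -
    have "(W has_real_derivative 0) (at_right y) \<longleftrightarrow> ((\<lambda>_. 0) has_real_derivative 0) (at_right y)"
    proof (rule has_field_derivative_cong_eventually)
      show "\<forall>\<^sub>F z in at_right y. W z = 0"
        using eventually_at_right_real[OF y(2)] by eventually_elim (auto intro: W0)
    qed (use W0 y in auto)
    then have "right_derivative W y = 0" by (intro right_derivativeI) simp
    moreover have "(LINT \<xi>:{0<..}|m. W y - W (y - \<xi>)) = (LINT \<xi>|m. 0)"
      unfolding set_lebesgue_integral_def
      by (rule Bochner_Integration.integral_cong) (use W0 y in \<open>auto split: split_indicator\<close>)
    ultimately show ?thesis using k[OF y(1)] by (simp add: k_function_def)
  qed
  have "\<forall>\<^sub>F y in at_right 0. k y = 0"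
    using eventually_at_right_real[OF x] by eventually_elim (auto intro: k0)
  then have "((\<lambda>_. 0) \<longlongrightarrow> c) (at_right (0::real))"
    using lim by (rule Lim_transform_eventually[rotated])
  then show False using c tendsto_unique[OF trivial_limit_at_right_real _ tendsto_const] by fastforce
qed

text \<open>The derivative part of \<open>k\<close> contributes \<open>b * (- u / R u - W 0)\<close>
  by \<open>laplace_primitive\<close>; the increments contribute the integral part of
  \<open>F u\<close> times \<open>- (1 / R u)\<close> by Tonelli. The facts on
  \<open>- u / R u\<close> serve to identify \<open>b * W 0\<close> with the drift later.\<close>

lemma k_function_laplace:
  fixes b \<alpha> \<beta> :: real
  assumes params: "admissible_parameters b m \<alpha> \<beta> \<mu>"
    and sc: "is_scale_function (branching_mechanism \<alpha> \<beta> \<mu>) W" and pos: "\<And>x. 0 < x \<Longrightarrow> 0 < W x"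
  shows "(\<lambda>x. indicator {0<..} x * k_function b m W x) \<in> borel_measurable borel" (is ?meas)
    and "\<And>x. 0 < x \<Longrightarrow> 0 \<le> k_function b m W x" (is "\<And>x. _ \<Longrightarrow> ?nonneg x")
    and "\<And>u. 0 < u \<Longrightarrow> (\<integral>\<^sup>+x\<in>{0<..}. ennreal (exp (- u * x) * k_function b m W x) \<partial>lborel)
      = ennreal (- immigration_mechanism b m u / branching_mechanism \<alpha> \<beta> \<mu> u - b * W 0)" (is "\<And>u. _ \<Longrightarrow> ?lap u")
    and "\<And>u. 0 < u \<Longrightarrow> W 0 \<le> - u / branching_mechanism \<alpha> \<beta> \<mu> u"
    and "((\<lambda>u. - u / branching_mechanism \<alpha> \<beta> \<mu> u) \<longlongrightarrow> W 0) at_top"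
    and "\<And>u. 0 < u \<Longrightarrow> b * W 0 \<le> - immigration_mechanism b m u / branching_mechanism \<alpha> \<beta> \<mu> u"
proof -
  let ?R = "branching_mechanism \<alpha> \<beta> \<mu>"
  have \<mu>: "levy_measure_pos \<mu>" and \<alpha>: "0 \<le> \<alpha>" and b: "0 \<le> b"
    and m: "levy_measure_pos m" "(\<integral>\<^sup>+\<xi>. ennreal (min \<xi> 1) \<partial>m) < \<infinity>"
    using params by (auto simp: admissible_parameters_def)
  have [measurable_cong]: "sets m = sets borel" using m by (simp add: levy_measure_pos_def)
  interpret m: sigma_finite_measure m by (rule levy_measure_sigma_finite[OF m(1)])
  interpret lm: pair_sigma_finite lborel m ..
  have [measurable]: "W \<in> borel_measurable borel" by (rule scale_function_measurable[OF sc])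
  have W0: "0 \<le> W t" and Wneg: "t < 0 \<Longrightarrow> W t = 0" for t using sc by (auto simp: is_scale_function_def)
  have contW: "continuous_on {0..} W" using sc by (simp add: is_scale_function_def)
  have mono: "mono W" by (rule scale_function_mono[OF sc])
  have cont: "isCont W t" if "0 < t" for t by (rule scale_function_isCont[OF sc that])
  have int: "set_integrable lborel {0..} (\<lambda>x. exp (- u * x) * W x)"
    and eq: "(LINT x:{0..}|lborel. exp (- u * x) * W x) = - (1 / ?R u)" if "0 < u" for u
    using sc that by (auto simp: is_scale_function_def)
  have Rneg: "?R u < 0" if "0 < u" for u by (rule scale_function_exponent_neg[OF sc pos that])
  note three = scale_function_log_concave[OF \<mu> \<alpha> sc pos]
  define w where "w x = (if 0 < x then right_derivative W x else 0)" for x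
  have w: "(W has_real_derivative w x) (at_right x)" if "0 < x" for x
    using log_concave_right_derivative[OF pos three that] that right_derivativeI by (auto simp: w_def)
  have wlim: "(\<lambda>n. (W (x + 1 / real (Suc n)) - W x) * real (Suc n)) \<longlonglongrightarrow> w x" if "0 < x" for x
    by (rule right_derivative_sequence[OF w[OF that]])
  have [measurable]: "w \<in> borel_measurable borel"
  proof (rule borel_measurable_LIMSEQ_real)
    show "(\<lambda>n. indicator {0<..} x * ((W (x + 1 / real (Suc n)) - W x) * real (Suc n))) \<longlonglongrightarrow> w x" for x
      using wlim[of x] by (cases "0 < x") (auto simp: w_def)
  qed measurable
  have w0: "0 \<le> w x" if "0 < x" for x
    by (rule LIMSEQ_le_const[OF wlim[OF that]]) (auto intro!: exI[of _ 0] mult_nonneg_nonneg monoD[OF mono])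
  have prim: "(\<integral>\<^sup>+x\<in>{0..}. ennreal (u * exp (- u * x) * W x) \<partial>lborel)
    = ennreal (W 0) + (\<integral>\<^sup>+x\<in>{0<..}. ennreal (exp (- u * x) * w x) \<partial>lborel)" if u: "0 < u" for u
    using log_concave_integral_right_derivative[OF pos three monoD[OF mono] cont _ _ w] 
    by (intro laplace_primitive contW W0 w0 u) auto
  have lapW: "(\<integral>\<^sup>+x\<in>{0..}. ennreal (u * exp (- u * x) * W x) \<partial>lborel) = ennreal (- u / ?R u)" if u: "0 < u" for u
  proof -
    have "(\<integral>\<^sup>+x\<in>{0..}. ennreal (u * exp (- u * x) * W x) \<partial>lborel) =
       (\<integral>\<^sup>+x. ennreal (u * (indicator {0..} x *\<^sub>R (exp (- u * x) * W x))) \<partial>lborel)"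
      by (intro nn_integral_cong) (auto split: split_indicator simp: mult.assoc)
    also have "\<dots> = ennreal (LINT x|lborel. u * (indicator {0..} x *\<^sub>R (exp (- u * x) * W x)))"
      by (rule nn_integral_eq_integral) (use int[OF u] W0 u in \<open>auto simp: set_integrable_def\<close>)
    also have "\<dots> = ennreal (- u / ?R u)"
      using eq[OF u] by (simp add: set_lebesgue_integral_def)
    finally show ?thesis .
  qed
  have W0le: "W 0 \<le> - u / ?R u" if u: "0 < u" for u
  proof -
    have "ennreal (W 0) \<le> ennreal (- u / ?R u)" using prim[OF u] lapW[OF u] by (metis le_iff_add)
    moreover have "0 \<le> - u / ?R u" using u Rneg[OF u] by (simp add: divide_nonneg_neg)
    ultimately show ?thesis by simp
  qed
  then show "\<And>u. 0 < u \<Longrightarrow> W 0 \<le> - u / ?R u" .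
  have lapw: "(\<integral>\<^sup>+x\<in>{0<..}. ennreal (exp (- u * x) * w x) \<partial>lborel) = ennreal (- u / ?R u - W 0)" if u: "0 < u" for u
  proof -
    have "ennreal (W 0) + (\<integral>\<^sup>+x\<in>{0<..}. ennreal (exp (- u * x) * w x) \<partial>lborel) = ennreal (W 0) + ennreal (- u / ?R u - W 0)"
      using prim[OF u] lapW[OF u] W0le[OF u] W0[of 0] by (simp flip: ennreal_plus)
    then show ?thesis by (simp add: ennreal_add_left_cancel)
  qed
  have wint: "integrable lborel (\<lambda>x. indicator {0<..} x * (exp (- u * x) * w x))"
    and wLINT: "(LINT x|lborel. indicator {0<..} x * (exp (- u * x) * w x)) = - u / ?R u - W 0" if u: "0 < u" for u
  proof -
    have e: "(\<integral>\<^sup>+x. ennreal (indicator {0<..} x * (exp (- u * x) * w x)) \<partial>lborel) = ennreal (- u / ?R u - W 0)"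
      unfolding lapw[OF u, symmetric] by (intro nn_integral_cong) (auto split: split_indicator)
    have p: "AE x in lborel. 0 \<le> indicator {0<..} x * (exp (- u * x) * w x)"
      using w0 by (auto split: split_indicator)
    show "integrable lborel (\<lambda>x. indicator {0<..} x * (exp (- u * x) * w x))"
      by (rule integrableI_nonneg[OF _ p]) (measurable, simp only: e, simp)
    show "(LINT x|lborel. indicator {0<..} x * (exp (- u * x) * w x)) = - u / ?R u - W 0"
      using W0le[OF u] by (subst integral_eq_nn_integral[OF _ p]) (measurable, simp only: e, simp)
  qed
  \<comment> \<open>The transform of \<open>w\<close> vanishes at infinity, which exhibits
    \<open>W 0\<close> as the limit of \<open>- u / R u\<close>.\<close>
  have "((\<lambda>u. LINT x|lborel. indicator {0<..} x * (exp (- u * x) * w x)) \<longlongrightarrow> (LINT (x::real)|lborel. 0)) at_top"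
  proof (rule integral_dominated_convergence_at_top[where w="\<lambda>x. indicator {0<..} x * (exp (- 1 * x) * w x)"])
    show "integrable lborel (\<lambda>x. indicator {0<..} x * (exp (- 1 * x) * w x))" by (rule wint) simp
    show "AE x in lborel. ((\<lambda>u. indicator {0<..} x * (exp (- u * x) * w x)) \<longlongrightarrow> 0) at_top"
    proof (rule AE_I2)
      fix x :: real
      show "((\<lambda>u. indicator {0<..} x * (exp (- u * x) * w x)) \<longlongrightarrow> 0) at_top"
      proof (cases "0 < x")
        case True
        have "((\<lambda>u. exp (- u * x)) \<longlongrightarrow> 0) at_top" by (rule exp_neg_mult_tendsto_0[OF True])
        then have "((\<lambda>u. indicator {0<..} x * (exp (- u * x) * w x)) \<longlongrightarrow> indicator {0<..} x * (0 * w x)) at_top"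
          by (intro tendsto_mult tendsto_const)
        then show ?thesis by simp
      qed simp
    qed
    show "\<forall>\<^sub>F u in at_top. AE x in lborel. norm (indicator {0<..} x * (exp (- u * x) * w x))
        \<le> indicator {0<..} x * (exp (- 1 * x) * w x)"
      using eventually_ge_at_top[of 1]
    proof eventually_elim
      case (elim u)
      show ?case
        by (rule AE_I2) (use elim w0 in \<open>auto split: split_indicator simp: abs_mult intro!: mult_right_mono\<close>)
    qed
  qed simp_all
  moreover have "\<forall>\<^sub>F u in at_top. (LINT x|lborel. indicator {0<..} x * (exp (- u * x) * w x)) = - u / ?R u - W 0"
    using eventually_gt_at_top[of 0] by eventually_elim (rule wLINT)
  ultimately have "((\<lambda>u. - u / ?R u - W 0) \<longlongrightarrow> (LINT (x::real)|lborel. 0)) at_top"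
    by (rule Lim_transform_eventually)
  then have "((\<lambda>u. - u / ?R u - W 0) \<longlongrightarrow> 0) at_top" by simp
  then show "((\<lambda>u. - u / ?R u) \<longlongrightarrow> W 0) at_top" by (rule LIM_zero_cancel)
  define N where "N x = (\<integral>\<^sup>+\<xi>\<in>{0<..}. ennreal (W x - W (x - \<xi>)) \<partial>m)" for x
  have [measurable]: "N \<in> borel_measurable borel" unfolding N_def by measurable
  have Wd: "0 \<le> W x - W (x - \<xi>)" if "0 < \<xi>" for x \<xi> using monoD[OF mono, of "x - \<xi>" x] that by simp
  \<comment> \<open>This holds even where the integral diverges: the Bochner integral and
    \<open>enn2real \<infinity>\<close> both default to 0. Such points form a null set by
    \<open>fin\<close>.\<close>
  have N: "(LINT \<xi>:{0<..}|m. W x - W (x - \<xi>)) = enn2real (N x)" for x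
    unfolding set_lebesgue_integral_def
  proof (subst integral_eq_nn_integral)
    show "AE \<xi> in m. 0 \<le> indicator {0<..} \<xi> *\<^sub>R (W x - W (x - \<xi>))"
    proof (rule AE_I2)
      fix \<xi> :: real show "0 \<le> indicator {0<..} \<xi> *\<^sub>R (W x - W (x - \<xi>))"
        using Wd[of \<xi> x] by (cases "0 < \<xi>") auto
    qed
    show "enn2real (\<integral>\<^sup>+\<xi>. ennreal (indicator {0<..} \<xi> *\<^sub>R (W x - W (x - \<xi>))) \<partial>m) = enn2real (N x)"
      unfolding N_def by (intro arg_cong[where f=enn2real] nn_integral_cong) (auto split: split_indicator)
  qed measurable
  have k: "k_function b m W x = b * w x + enn2real (N x)" if "0 < x" for x
    using that by (simp add: k_function_def w_def N)
  show ?meas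
  proof -
    have "(\<lambda>x. indicator {0<..} x * (b * w x + enn2real (N x))) \<in> borel_measurable borel" by measurable
    also have "(\<lambda>x. indicator {0<..} x * (b * w x + enn2real (N x))) = (\<lambda>x. indicator {0<..} x * k_function b m W x)"
      using k by (auto simp: fun_eq_iff split: split_indicator)
    finally show ?thesis .
  qed
  show "?nonneg x" if "0 < x" for x using k[OF that] w0[OF that] b by simp
  define G where "G u = (LINT \<xi>:{0<..}|m. 1 - exp (- u * \<xi>))" for u
  have F: "immigration_mechanism b m u = b * u + G u" for u
  proof -
    have "(LINT \<xi>:{0<..}|m. exp (- u * \<xi>) - 1) = - G u"
      unfolding G_def set_lebesgue_integral_def
      by (subst Bochner_Integration.integral_minus[symmetric]) (simp add: algebra_simps)
    then show ?thesis by (simp add: immigration_mechanism_def)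
  qed
  have G0: "0 \<le> G u" if "0 < u" for u
    unfolding G_def set_lebesgue_integral_def
    by (rule Bochner_Integration.integral_nonneg) (use that in \<open>auto split: split_indicator\<close>)
  have lapN: "(\<integral>\<^sup>+x. ennreal (exp (- u * x)) * N x \<partial>lborel) = ennreal (G u * (- (1 / ?R u)))" if u: "0 < u" for u
  proof -
    have "(\<integral>\<^sup>+x. ennreal (exp (- u * x)) * N x \<partial>lborel) =
        (\<integral>\<^sup>+x. (\<integral>\<^sup>+\<xi>. ennreal (exp (- u * x) * (W x - W (x - \<xi>))) * indicator {0<..} \<xi> \<partial>m) \<partial>lborel)"
      unfolding N_def
      by (subst nn_integral_cmult[symmetric])
         (auto intro!: nn_integral_cong simp: ennreal_mult' mult.assoc)
    also have "\<dots> = (\<integral>\<^sup>+\<xi>. (\<integral>\<^sup>+x. ennreal (exp (- u * x) * (W x - W (x - \<xi>))) * indicator {0<..} \<xi> \<partial>lborel) \<partial>m)"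
      by (rule lm.Fubini'[symmetric]) measurable
    also have "\<dots> = (\<integral>\<^sup>+\<xi>. ennreal ((indicator {0<..} \<xi> *\<^sub>R (1 - exp (- u * \<xi>))) * (- (1 / ?R u))) \<partial>m)"
    proof (rule nn_integral_cong)
      fix \<xi>
      show "(\<integral>\<^sup>+x. ennreal (exp (- u * x) * (W x - W (x - \<xi>))) * indicator {0<..} \<xi> \<partial>lborel) =
         ennreal ((indicator {0<..} \<xi> *\<^sub>R (1 - exp (- u * \<xi>))) * (- (1 / ?R u)))"
        using laplace_increment[OF _ Wneg mono int[OF u] eq[OF u], of \<xi>]
        by (cases "0 < \<xi>") simp_all
    qed
    also have "\<dots> = ennreal (LINT \<xi>|m. (indicator {0<..} \<xi> *\<^sub>R (1 - exp (- u * \<xi>))) * (- (1 / ?R u)))"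
    proof (rule nn_integral_eq_integral)
      show "integrable m (\<lambda>\<xi>. (indicator {0<..} \<xi> *\<^sub>R (1 - exp (- u * \<xi>))) * (- (1 / ?R u)))"
        using immigration_integrable[OF m, of u] u unfolding set_integrable_def by (intro integrable_mult_left) simp
      have "0 \<le> - (1 / ?R u)" using Rneg[OF u] by simp
      then show "AE \<xi> in m. 0 \<le> (indicator {0<..} \<xi> *\<^sub>R (1 - exp (- u * \<xi>))) * (- (1 / ?R u))"
        using u by (intro AE_I2 mult_nonneg_nonneg) (auto split: split_indicator)
    qed
    also have "\<dots> = ennreal (G u * (- (1 / ?R u)))"
      unfolding G_def set_lebesgue_integral_def by (subst integral_mult_left_zero) simp
    finally show ?thesis .
  qed
  have fin: "AE x in lborel. N x < \<infinity>"
  proof -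
    have "AE x in lborel. ennreal (exp (- 1 * x)) * N x \<noteq> \<infinity>"
      by (rule nn_integral_PInf_AE) (use lapN[of 1] in auto)
    then show ?thesis by eventually_elim (auto simp: ennreal_mult_eq_top_iff less_top)
  qed
  have Nneg: "N x = 0" if "x < 0" for x
  proof -
    have "N x = (\<integral>\<^sup>+(\<xi>::real). 0 \<partial>m)"
      unfolding N_def by (rule nn_integral_cong) (use that Wneg in \<open>auto split: split_indicator\<close>)
    then show ?thesis by simp
  qed
  have split: "- immigration_mechanism b m u / ?R u - b * W 0 = b * (- u / ?R u - W 0) + G u * (- (1 / ?R u))" for u
    unfolding F by (simp add: algebra_simps diff_divide_distrib add_divide_distrib)
  have n1: "0 \<le> b * (- u / ?R u - W 0)" and n2: "0 \<le> G u * (- (1 / ?R u))" if u: "0 < u" for u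
  proof -
    show "0 \<le> b * (- u / ?R u - W 0)" using b W0le[OF u] by (intro mult_nonneg_nonneg) auto
    have "0 \<le> - (1 / ?R u)" using Rneg[OF u] by simp
    then show "0 \<le> G u * (- (1 / ?R u))" by (rule mult_nonneg_nonneg[OF G0[OF u]])
  qed
  show "?lap u" if u: "0 < u" for u
  proof -
    have "(\<integral>\<^sup>+x\<in>{0<..}. ennreal (exp (- u * x) * k_function b m W x) \<partial>lborel) =
      (\<integral>\<^sup>+x. ennreal b * (ennreal (exp (- u * x) * w x) * indicator {0<..} x) + ennreal (exp (- u * x)) * N x \<partial>lborel)"
    proof (rule nn_integral_cong_AE)
      show "AE x in lborel. ennreal (exp (- u * x) * k_function b m W x) * indicator {0<..} x =
         ennreal b * (ennreal (exp (- u * x) * w x) * indicator {0<..} x) + ennreal (exp (- u * x)) * N x"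
        \<comment> \<open>The point 0 has to be dropped: \<open>N 0\<close> is \<open>W 0\<close>
          times the mass of \<open>m\<close> on \<open>(0, \<infinity>)\<close> and may be
          positive.\<close>
        using fin AE_lborel_singleton[of 0]
      proof eventually_elim
        case (elim x)
        show ?case
        proof (cases "0 < x")
          case True
          have "ennreal (exp (- u * x) * k_function b m W x) = ennreal (b * (exp (- u * x) * w x) + exp (- u * x) * enn2real (N x))"
            using k[OF True] by (simp add: algebra_simps)
          also have "\<dots> = ennreal b * ennreal (exp (- u * x) * w x) + ennreal (exp (- u * x)) * ennreal (enn2real (N x))"
            using w0[OF True] b by (simp add: ennreal_mult)
          also have "ennreal (enn2real (N x)) = N x" using elim by simp
          finally show ?thesis using True by simp
        next
          case False
          then show ?thesis using elim Nneg[of x] by simp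
        qed
      qed
    qed
    also have "\<dots> = ennreal b * ennreal (- u / ?R u - W 0) + ennreal (G u * (- (1 / ?R u)))"
      by (subst nn_integral_add, measurable, subst nn_integral_cmult, measurable, simp only: lapw[OF u] lapN[OF u])
    also have "\<dots> = ennreal (- immigration_mechanism b m u / ?R u - b * W 0)"
      using n1[OF u] n2[OF u] b W0le[OF u] unfolding split by (subst ennreal_plus) (auto simp: ennreal_mult')
    finally show ?thesis .
  qed
  show "b * W 0 \<le> - immigration_mechanism b m u / ?R u" if u: "0 < u" for u
    using split[of u] n1[OF u] n2[OF u] by linarith
qed

text \<open>Since \<open>u / - R(u) \<rightarrow> W(0)\<close>, this amounts to \<open>- R(u) / u \<rightarrow> \<lambda>\<^sub>0\<close> as \<open>u \<rightarrow> \<infinity>\<close>.\<close>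

lemma drift_over_effective_drift:
  fixes b \<alpha> \<beta> w0 :: real
  assumes \<mu>: "levy_measure_pos \<mu>" and \<alpha>: "0 \<le> \<alpha>"
    and Rneg: "\<And>u. 0 < u \<Longrightarrow> branching_mechanism \<alpha> \<beta> \<mu> u < 0"
    and w0: "0 \<le> w0" "\<And>u. 0 < u \<Longrightarrow> w0 \<le> - u / branching_mechanism \<alpha> \<beta> \<mu> u"
    and lim: "((\<lambda>u. - u / branching_mechanism \<alpha> \<beta> \<mu> u) \<longlongrightarrow> w0) at_top"
  shows "real_of_ereal (ereal b / effective_drift \<alpha> \<beta> \<mu>) = b * w0"
proof -
  let ?R = "branching_mechanism \<alpha> \<beta> \<mu>"
  have [measurable_cong]: "sets \<mu> = sets borel" using \<mu> by (simp add: levy_measure_pos_def)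
  \<comment> \<open>As \<open>- R u / u\<close> is \<open>\<alpha> * u - \<beta>\<close> plus the
    integral of \<open>h u\<close>, its limit hinges on \<open>h u\<close>, which tends to
    \<open>\<xi>\<close> on \<open>(0, 1]\<close> and to 0 beyond.\<close>
  define h where "h u \<xi> = (exp (- u * \<xi>) - 1 + u * \<xi> * indicator {0<..1} \<xi>) / u" for u \<xi> :: real
  have [measurable]: "h u \<in> borel_measurable borel" for u unfolding h_def by measurable
  have hi: "set_integrable \<mu> {0<..} (h u)" if u: "0 < u" for u
  proof (rule levy_measure_integrable[OF \<mu>, where C="(1 + u\<^sup>2) / u"])
    fix \<xi> :: real assume "0 < \<xi>"
    then show "\<bar>h u \<xi>\<bar> \<le> (1 + u\<^sup>2) / u * min (\<xi>\<^sup>2) 1"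
      using branching_integrand_bound[of u \<xi>] u by (simp add: h_def divide_right_mono)
  qed simp
  have r: "- ?R u / u = \<alpha> * u - \<beta> + (LINT \<xi>:{0<..}|\<mu>. h u \<xi>)" if u: "0 < u" for u
  proof -
    have "(LINT \<xi>:{0<..}|\<mu>. h u \<xi>) = (LINT \<xi>:{0<..}|\<mu>. exp (- u * \<xi>) - 1 + u * \<xi> * indicator {0<..1} \<xi>) / u"
      unfolding h_def by (rule set_integral_divide_zero)
    then show ?thesis using u
      by (simp add: branching_mechanism_def diff_divide_distrib add_divide_distrib power2_eq_square)
  qed
  have big: "integrable \<mu> (indicator {1<..} :: real \<Rightarrow> real)"
  proof -
    have "set_integrable \<mu> {0<..} (indicator {1<..} :: real \<Rightarrow> real)"
    proof (rule levy_measure_integrable[OF \<mu>, where C=1])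
      fix \<xi> :: real assume "0 < \<xi>"
      show "\<bar>indicator {1<..} \<xi>\<bar> \<le> 1 * min (\<xi>\<^sup>2) (1::real)"
      proof (cases "1 < \<xi>")
        case True
        then have "1 \<le> \<xi>\<^sup>2" by (simp add: one_le_power)
        then show ?thesis using True by simp
      qed simp
    qed simp
    then have "integrable \<mu> (\<lambda>\<xi>::real. indicator {0<..} \<xi> * indicator {1<..} \<xi> :: real)" by (simp add: set_integrable_def)
    also have "(\<lambda>\<xi>::real. indicator {0<..} \<xi> * indicator {1<..} \<xi> :: real) = indicator {1<..}"
      by (auto simp: fun_eq_iff indicator_def)
    finally show ?thesis .
  qed
  have h_small: "0 \<le> h u \<xi>" "h u \<xi> \<le> \<xi>" if "0 < u" "0 < \<xi>" "\<xi> \<le> 1" for u \<xi>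
    using that exp_remainder_2_bounds(1)[of "u * \<xi>"] by (auto simp: h_def field_simps)
  have h_big: "\<bar>h u \<xi>\<bar> \<le> 1" if "1 \<le> u" "1 < \<xi>" for u \<xi>
  proof -
    have "\<bar>exp (- u * \<xi>) - 1\<bar> \<le> 1" using that by simp
    also have "1 \<le> u" using that by simp
    finally show ?thesis using that by (simp add: h_def)
  qed
  have hlim: "((\<lambda>u. h u \<xi>) \<longlongrightarrow> \<xi> * indicator {0<..1} \<xi>) at_top" if \<xi>: "0 < \<xi>" for \<xi>
  proof -
    have e: "((\<lambda>u. exp (- u * \<xi>)) \<longlongrightarrow> 0) at_top" by (rule exp_neg_mult_tendsto_0[OF \<xi>])
    have i: "((\<lambda>u::real. inverse u) \<longlongrightarrow> 0) at_top" by (rule tendsto_inverse_0_at_top[OF filterlim_ident])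
    have "((\<lambda>u. (exp (- u * \<xi>) - 1) * inverse u + \<xi> * indicator {0<..1} \<xi>) \<longlongrightarrow> (0 - 1) * 0 + \<xi> * indicator {0<..1} \<xi>) at_top"
      by (intro tendsto_intros e i)
    moreover have "\<forall>\<^sub>F u in at_top. (exp (- u * \<xi>) - 1) * inverse u + \<xi> * indicator {0<..1} \<xi> = h u \<xi>"
      using eventually_gt_at_top[of 0] by eventually_elim (simp add: h_def field_simps)
    ultimately show ?thesis by (auto intro: Lim_transform_eventually)
  qed
  show ?thesis
  proof (cases "\<alpha> = 0 \<and> (\<integral>\<^sup>+\<xi>\<in>{0<..1}. ennreal \<xi> \<partial>\<mu>) < \<infinity>")
    case bv: True
    define \<Lambda> where "\<Lambda> = - \<beta> + (LINT \<xi>:{0<..1}|\<mu>. \<xi>)"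
    have \<Lambda>: "(LINT \<xi>:{0<..1}|\<mu>. \<xi>) - \<beta> = \<Lambda>" by (simp add: \<Lambda>_def)
    have small: "integrable \<mu> (\<lambda>\<xi>. indicator {0<..1} \<xi> * \<xi>)"
    proof (rule integrableI_nonneg)
      have "(\<integral>\<^sup>+\<xi>. ennreal (indicator {0<..1} \<xi> * \<xi>) \<partial>\<mu>) = (\<integral>\<^sup>+\<xi>\<in>{0<..1}. ennreal \<xi> \<partial>\<mu>)"
        by (intro nn_integral_cong) (auto split: split_indicator)
      then show "(\<integral>\<^sup>+\<xi>. ennreal (indicator {0<..1} \<xi> * \<xi>) \<partial>\<mu>) < \<infinity>" using bv by simp
    qed (auto split: split_indicator)
    have "((\<lambda>u. LINT \<xi>|\<mu>. indicator {0<..} \<xi> *\<^sub>R h u \<xi>) \<longlongrightarrow> (LINT \<xi>|\<mu>. indicator {0<..1} \<xi> *\<^sub>R \<xi>)) at_top"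
    proof (rule integral_dominated_convergence_at_top[where w="\<lambda>\<xi>. indicator {0<..1} \<xi> * \<xi> + indicator {1<..} \<xi>"])
      show "integrable \<mu> (\<lambda>\<xi>. indicator {0<..1} \<xi> * \<xi> + indicator {1<..} \<xi>)"
        by (intro Bochner_Integration.integrable_add small big)
      show "AE \<xi> in \<mu>. ((\<lambda>u. indicator {0<..} \<xi> *\<^sub>R h u \<xi>) \<longlongrightarrow> indicator {0<..1} \<xi> *\<^sub>R \<xi>) at_top"
      proof (rule AE_I2)
        fix \<xi> :: real
        show "((\<lambda>u. indicator {0<..} \<xi> *\<^sub>R h u \<xi>) \<longlongrightarrow> indicator {0<..1} \<xi> *\<^sub>R \<xi>) at_top"
          using hlim[of \<xi>] by (cases "0 < \<xi>") (simp_all add: mult.commute)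
      qed
      show "\<forall>\<^sub>F u in at_top. AE \<xi> in \<mu>. norm (indicator {0<..} \<xi> *\<^sub>R h u \<xi>) \<le> indicator {0<..1} \<xi> * \<xi> + indicator {1<..} \<xi>"
        using eventually_ge_at_top[of 1]
      proof eventually_elim
        case (elim u)
        have "norm (indicator {0<..} \<xi> *\<^sub>R h u \<xi>) \<le> indicator {0<..1} \<xi> * \<xi> + indicator {1<..} \<xi>" for \<xi>
          using h_small[of u \<xi>] h_big[of u \<xi>] elim
          by (cases "0 < \<xi>"; cases "\<xi> \<le> 1") auto
        then show ?case by simp
      qed
    qed measurable
    then have "((\<lambda>u. - \<beta> + (LINT \<xi>:{0<..}|\<mu>. h u \<xi>)) \<longlongrightarrow> - \<beta> + (LINT \<xi>:{0<..1}|\<mu>. \<xi>)) at_top"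
      unfolding set_lebesgue_integral_def by (intro tendsto_intros)
    then have "((\<lambda>u. (- u / ?R u) * (- \<beta> + (LINT \<xi>:{0<..}|\<mu>. h u \<xi>))) \<longlongrightarrow> w0 * \<Lambda>) at_top"
      unfolding \<Lambda>_def by (rule tendsto_mult[OF lim])
    moreover have "\<forall>\<^sub>F u in at_top. (- u / ?R u) * (- \<beta> + (LINT \<xi>:{0<..}|\<mu>. h u \<xi>)) = 1"
      using eventually_gt_at_top[of 0]
    proof eventually_elim
      case (elim u)
      have "- \<beta> + (LINT \<xi>:{0<..}|\<mu>. h u \<xi>) = - ?R u / u" using r[OF elim] bv by simp
      then show ?case using elim Rneg[OF elim] by simp
    qed
    ultimately have "((\<lambda>u. 1) \<longlongrightarrow> w0 * \<Lambda>) (at_top :: real filter)"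
      by (rule Lim_transform_eventually)
    then have "w0 * \<Lambda> = 1" by (simp add: tendsto_const_iff)
    then have "\<Lambda> \<noteq> 0" "w0 = 1 / \<Lambda>" by (auto simp: eq_divide_eq)
    then show ?thesis using bv by (simp add: effective_drift_def \<Lambda>)
  next
    case nbv: False
    have "w0 = 0"
    proof (rule ccontr)
      assume "w0 \<noteq> 0"
      then have w: "0 < w0" using w0(1) by simp
      \<comment> \<open>For \<open>w0 > 0\<close> the quotient \<open>- R u / u\<close> stays below
        \<open>1 / w0\<close>. Adding \<open>\<beta>\<close> and the mass of the large jumps turns
        this into a bound on the diffusion and jump parts together, from which bounded variation
        follows.\<close>
      define C where "C = 1 / w0 + \<beta> + measure \<mu> {1<..}"
      \<comment> \<open>Beyond 1 the function \<open>h u\<close> is only known to be at least -1;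
        the indicator lifts it to a nonnegative integrand, as Fatou's lemma requires.\<close>
      have hp: "0 \<le> indicator {0<..} \<xi> *\<^sub>R h u \<xi> + indicator {1<..} \<xi>" if "1 \<le> u" for u \<xi>
        using h_small[of u \<xi>] h_big[of u \<xi>] that by (cases "0 < \<xi>"; cases "\<xi> \<le> 1") auto
      have hpi: "integrable \<mu> (\<lambda>\<xi>. indicator {0<..} \<xi> *\<^sub>R h u \<xi> + indicator {1<..} \<xi>)" if "1 \<le> u" for u
        using hi[of u] that big by (auto simp: set_integrable_def)
      have C: "\<alpha> * u + (LINT \<xi>|\<mu>. indicator {0<..} \<xi> *\<^sub>R h u \<xi> + indicator {1<..} \<xi>) \<le> C" if u: "1 \<le> u" for u
      proof -
        have "(LINT \<xi>|\<mu>. indicator {0<..} \<xi> *\<^sub>R h u \<xi> + indicator {1<..} \<xi>) = (LINT \<xi>:{0<..}|\<mu>. h u \<xi>) + measure \<mu> {1<..}"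
          using hi[of u] u big by (simp add: set_integrable_def set_lebesgue_integral_def)
        moreover have "- ?R u / u \<le> 1 / w0"
          using w0(2)[of u] Rneg[of u] u w by (simp add: field_simps)
        ultimately show ?thesis using r[of u] u by (simp add: C_def)
      qed
      have C': "(LINT \<xi>|\<mu>. indicator {0<..} \<xi> *\<^sub>R h u \<xi> + indicator {1<..} \<xi>) \<ge> 0" if "1 \<le> u" for u
        by (rule Bochner_Integration.integral_nonneg) (rule hp[OF that])
      have "\<alpha> = 0"
      proof (rule ccontr)
        assume "\<alpha> \<noteq> 0"
        then have a: "0 < \<alpha>" using \<alpha> by simp
        \<comment> \<open>The argument is chosen so that
          \<open>\<alpha> * u = \<alpha> + \<bar>C\<bar>\<close>, which exceeds
          \<open>C\<close>.\<close>
        have "\<alpha> * (1 + \<bar>C\<bar> / \<alpha>) \<le> C" using C[of "1 + \<bar>C\<bar> / \<alpha>"] C'[of "1 + \<bar>C\<bar> / \<alpha>"] a by simp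
        moreover have "\<alpha> * (1 + \<bar>C\<bar> / \<alpha>) = \<alpha> + \<bar>C\<bar>" using a by (simp add: distrib_left)
        ultimately show False using a by linarith
      qed
      moreover have "(\<integral>\<^sup>+\<xi>\<in>{0<..1}. ennreal \<xi> \<partial>\<mu>) \<le> ennreal C"
      proof -
        have "(\<integral>\<^sup>+\<xi>\<in>{0<..1}. ennreal \<xi> \<partial>\<mu>) \<le>
          (\<integral>\<^sup>+\<xi>. liminf (\<lambda>n. ennreal (indicator {0<..} \<xi> *\<^sub>R h (real (Suc n)) \<xi> + indicator {1<..} \<xi>)) \<partial>\<mu>)"
        proof (rule nn_integral_mono)
          fix \<xi> :: real
          show "ennreal \<xi> * indicator {0<..1} \<xi> \<le>
             liminf (\<lambda>n. ennreal (indicator {0<..} \<xi> *\<^sub>R h (real (Suc n)) \<xi> + indicator {1<..} \<xi>))"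
          proof (cases "\<xi> \<in> {0<..1}")
            case True
            have "(\<lambda>n. h (real (Suc n)) \<xi>) \<longlonglongrightarrow> \<xi> * indicator {0<..1} \<xi>"
              by (rule filterlim_compose[OF hlim filterlim_compose[OF filterlim_real_sequentially filterlim_Suc]]) (use True in simp)
            then have "(\<lambda>n. ennreal (h (real (Suc n)) \<xi>)) \<longlonglongrightarrow> ennreal \<xi>" using True by (intro tendsto_ennrealI) simp
            then have "liminf (\<lambda>n. ennreal (h (real (Suc n)) \<xi>)) = ennreal \<xi>"
              by (intro lim_imp_Liminf) simp_all
            then show ?thesis using True by simp
          qed simp
        qed
        also have "\<dots> \<le> liminf (\<lambda>n. \<integral>\<^sup>+\<xi>. ennreal (indicator {0<..} \<xi> *\<^sub>R h (real (Suc n)) \<xi> + indicator {1<..} \<xi>) \<partial>\<mu>)"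
          by (rule nn_integral_liminf) measurable
        also have "\<dots> \<le> ennreal C"
        proof (rule Liminf_le)
          show "\<forall>\<^sub>F n in sequentially. (\<integral>\<^sup>+\<xi>. ennreal (indicator {0<..} \<xi> *\<^sub>R h (real (Suc n)) \<xi> + indicator {1<..} \<xi>) \<partial>\<mu>) \<le> ennreal C"
          proof (rule always_eventually, rule allI)
            fix n
            have "(\<integral>\<^sup>+\<xi>. ennreal (indicator {0<..} \<xi> *\<^sub>R h (real (Suc n)) \<xi> + indicator {1<..} \<xi>) \<partial>\<mu>) =
              ennreal (LINT \<xi>|\<mu>. indicator {0<..} \<xi> *\<^sub>R h (real (Suc n)) \<xi> + indicator {1<..} \<xi>)"
              by (rule nn_integral_eq_integral) (use hpi[of "real (Suc n)"] hp[of "real (Suc n)"] in auto)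
            also have "\<dots> \<le> ennreal C"
              using C[of "real (Suc n)"] mult_nonneg_nonneg[OF \<alpha>, of "real (Suc n)"] by (intro ennreal_leI) auto
            finally show "(\<integral>\<^sup>+\<xi>. ennreal (indicator {0<..} \<xi> *\<^sub>R h (real (Suc n)) \<xi> + indicator {1<..} \<xi>) \<partial>\<mu>) \<le> ennreal C" .
          qed
        qed simp
        finally show ?thesis .
      qed
      then have "(\<integral>\<^sup>+\<xi>\<in>{0<..1}. ennreal \<xi> \<partial>\<mu>) < \<infinity>" by (rule le_less_trans) simp
      ultimately show False using nbv by simp
    qed
    \<comment> \<open>The effective drift is infinite here, and \<open>b / \<infinity> = 0\<close>
      agrees with \<open>w0 = 0\<close>.\<close>
    then show ?thesis using nbv by (auto simp: effective_drift_def)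
  qed
qed

subsection \<open>Invariance of the limit law\<close>

lemma markov_processD:
  assumes "markov_process P X"
  shows "0 \<le> x \<Longrightarrow> prob_space (P x)" "0 \<le> x \<Longrightarrow> sets (P x) = sets (P 0)"
    and "0 \<le> t \<Longrightarrow> X t \<in> borel_measurable (P 0)"
    and "0 \<le> t \<Longrightarrow> \<omega> \<in> space (P 0) \<Longrightarrow> 0 \<le> X t \<omega>"
    and "0 \<le> x \<Longrightarrow> AE \<omega> in P x. X 0 \<omega> = x"
    and "0 \<le> t \<Longrightarrow> (\<lambda>x. distr (P x) borel (X t)) \<in> restrict_space borel {0..} \<rightarrow>\<^sub>M prob_algebra borel"
    and "0 \<le> x \<Longrightarrow> 0 \<le> s \<Longrightarrow> 0 \<le> t \<Longrightarrow> A \<in> sets borel \<Longrightarrow>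
      AE \<omega> in P x. real_cond_exp (P x) (natural_filtration P X s)
        (indicator {\<omega>\<in>space (P x). X (s + t) \<omega> \<in> A}) \<omega> = measure (distr (P (X s \<omega>)) borel (X t)) A"
proof -
  note c = assms[unfolded markov_process_def]
  show "0 \<le> x \<Longrightarrow> prob_space (P x)"
    using c[THEN conjunct1] by blast
  show "0 \<le> x \<Longrightarrow> sets (P x) = sets (P 0)"
    using c[THEN conjunct1] by blast
  show "0 \<le> t \<Longrightarrow> X t \<in> borel_measurable (P 0)"
    using c[THEN conjunct2, THEN conjunct1] by blast
  show "0 \<le> t \<Longrightarrow> \<omega> \<in> space (P 0) \<Longrightarrow> 0 \<le> X t \<omega>"
    using c[THEN conjunct2, THEN conjunct2, THEN conjunct1] by blast
  show "0 \<le> x \<Longrightarrow> AE \<omega> in P x. X 0 \<omega> = x"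
    using c[THEN conjunct2, THEN conjunct2, THEN conjunct2, THEN conjunct1] by blast
  show "0 \<le> t \<Longrightarrow> (\<lambda>x. distr (P x) borel (X t)) \<in> restrict_space borel {0..} \<rightarrow>\<^sub>M prob_algebra borel"
    using c[THEN conjunct2, THEN conjunct2, THEN conjunct2, THEN conjunct2, THEN conjunct1] by blast
  show "0 \<le> x \<Longrightarrow> 0 \<le> s \<Longrightarrow> 0 \<le> t \<Longrightarrow> A \<in> sets borel \<Longrightarrow>
      AE \<omega> in P x. real_cond_exp (P x) (natural_filtration P X s)
        (indicator {\<omega>\<in>space (P x). X (s + t) \<omega> \<in> A}) \<omega> = measure (distr (P (X s \<omega>)) borel (X t)) A"
    using c[THEN conjunct2, THEN conjunct2, THEN conjunct2, THEN conjunct2, THEN conjunct2] by blast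
qed

section \<open>Affine exponents and the flow\<close>

lemma CBI_laplace:
  assumes mp: "markov_process P X" and ex: "CBI_exponents P X \<phi> \<psi>"
    and t: "0 \<le> t" and u: "0 \<le> u" and x: "0 \<le> x"
  shows "integrable (P x) (\<lambda>\<omega>. exp (- u * X t \<omega>))"
    and "(LINT \<omega>|P x. exp (- u * X t \<omega>)) = exp (- (\<phi> t u + x * \<psi> t u))"
    and "0 \<le> \<phi> t u + x * \<psi> t u"
proof -
  have ps: "prob_space (P x)" and se: "sets (P x) = sets (P 0)"
    using markov_processD(1,2)[OF mp x] by auto
  interpret prob_space "P x" by (rule ps)
  have sp: "space (P x) = space (P 0)" by (rule sets_eq_imp_space_eq[OF se])
  have [measurable]: "X t \<in> borel_measurable (P x)"
    using markov_processD(3)[OF mp t] measurable_cong_sets[OF se refl] by blast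
  have X0: "0 \<le> X t \<omega>" if "\<omega> \<in> space (P x)" for \<omega> using markov_processD(4)[OF mp t] that sp by simp
  show int: "integrable (P x) (\<lambda>\<omega>. exp (- u * X t \<omega>))"
  proof (rule integrable_const_bound[where B=1])
    show "AE \<omega> in P x. norm (exp (- u * X t \<omega>)) \<le> 1" by (rule AE_I2) (use X0 u in simp)
  qed measurable
  have le1: "(LINT \<omega>|P x. exp (- u * X t \<omega>)) \<le> 1"
    by (rule integral_le_const[OF int], rule AE_I2) (use X0 u in simp)
  have pos: "0 < (LINT \<omega>|P x. exp (- u * X t \<omega>))" by (rule integral_exp_pos[OF ps int])
  have "- ln (LINT \<omega>|P x. exp (- u * X t \<omega>)) = \<phi> t u + x * \<psi> t u"
    using ex t u x unfolding CBI_exponents_def by blast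
  then have l: "ln (LINT \<omega>|P x. exp (- u * X t \<omega>)) = - (\<phi> t u + x * \<psi> t u)" by linarith
  show "(LINT \<omega>|P x. exp (- u * X t \<omega>)) = exp (- (\<phi> t u + x * \<psi> t u))"
    unfolding l[symmetric] using pos by simp
  have "ln (LINT \<omega>|P x. exp (- u * X t \<omega>)) \<le> 0" using le1 pos by (subst ln_le_zero_iff) auto
  then show "0 \<le> \<phi> t u + x * \<psi> t u" using l by linarith
qed

text \<open>A negative value would make \<open>\<phi> t u + x * \<psi> t u\<close> negative for
  large starting points \<open>x\<close>. Nonnegativity is what allows \<open>\<psi> t u\<close> to
  serve as a Laplace argument.\<close>

lemma CBI_psi_nonneg:
  assumes mp: "markov_process P X" and ex: "CBI_exponents P X \<phi> \<psi>"
    and t: "0 \<le> t" and u: "0 \<le> u"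
  shows "0 \<le> \<psi> t u"
proof (rule ccontr)
  assume "\<not> 0 \<le> \<psi> t u"
  then have n: "\<psi> t u < 0" by simp
  define x where "x = (\<bar>\<phi> t u\<bar> + 1) / (- \<psi> t u)"
  have "0 \<le> x" unfolding x_def by (rule divide_nonneg_pos) (use n in auto)
  from CBI_laplace(3)[OF mp ex t u this] have "0 \<le> \<phi> t u + x * \<psi> t u" .
  also have "x * \<psi> t u = - (\<bar>\<phi> t u\<bar> + 1)" using n by (simp add: x_def field_simps)
  finally show False by linarith
qed

lemma CBI_exponents_at_0:
  assumes mp: "markov_process P X" and ex: "CBI_exponents P X \<phi> \<psi>" and u: "0 \<le> u"
  shows "\<phi> 0 u = 0" "\<psi> 0 u = u"
proof -
  have eq: "\<phi> 0 u + x * \<psi> 0 u = u * x" if x: "0 \<le> x" for x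
  proof -
    interpret prob_space "P x" by (rule markov_processD(1)[OF mp x])
    have "(LINT \<omega>|P x. exp (- u * X 0 \<omega>)) = (LINT \<omega>|P x. exp (- u * x))"
    proof (rule integral_cong_AE)
      have "AE \<omega> in P x. X 0 \<omega> = x" by (rule markov_processD(5)[OF mp x])
      then show "AE \<omega> in P x. exp (- u * X 0 \<omega>) = exp (- u * x)" by eventually_elim simp
      show "(\<lambda>\<omega>. exp (- u * X 0 \<omega>)) \<in> borel_measurable (P x)"
        using CBI_laplace(1)[OF mp ex order_refl u x] by (rule borel_measurable_integrable)
    qed simp
    also have "\<dots> = exp (- u * x)" by (simp only: lebesgue_integral_const prob_space scaleR_one)
    finally have "exp (- (\<phi> 0 u + x * \<psi> 0 u)) = exp (- u * x)"
      by (simp only: CBI_laplace(2)[OF mp ex order_refl u x])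
    then have "- (\<phi> 0 u + x * \<psi> 0 u) = - u * x" by (simp only: exp_inj_iff)
    then show ?thesis by linarith
  qed
  show "\<phi> 0 u = 0" using eq[of 0] by simp
  then show "\<psi> 0 u = u" using eq[of 1] by simp
qed

text \<open>The Chapman-Kolmogorov equation, by integrating the conditional probabilities of the
  Markov property. The kernel is measurable on \<open>[0, \<infinity>)\<close> only, so
  \<open>X s\<close> is pushed to the restricted space.\<close>

lemma markov_process_distr:
  assumes mp: "markov_process P X" and x: "0 \<le> x" and s: "0 \<le> s" and t: "0 \<le> t"
  shows "distr (P x) borel (X (s + t)) =
    distr (P x) (restrict_space borel {0..}) (X s) \<bind> (\<lambda>y. distr (P y) borel (X t))"
proof -
  interpret prob_space "P x" by (rule markov_processD(1)[OF mp x])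
  have se: "sets (P x) = sets (P 0)" by (rule markov_processD(2)[OF mp x])
  have sp: "space (P x) = space (P 0)" by (rule sets_eq_imp_space_eq[OF se])
  have Xm: "r \<ge> 0 \<Longrightarrow> X r \<in> borel_measurable (P 0)" for r
    using markov_processD(3)[OF mp] by blast
  have XmP: "r \<ge> 0 \<Longrightarrow> X r \<in> borel_measurable (P x)" for r
    using Xm measurable_cong_sets[OF se refl] by blast
  have st: "s + t \<ge> 0" using s t by simp
  have [measurable]: "X s \<in> borel_measurable (P x)" "X (s + t) \<in> borel_measurable (P x)" using XmP s st by auto
  have Xr[measurable]: "X s \<in> P x \<rightarrow>\<^sub>M restrict_space borel {0..}"
    by (rule measurable_restrict_space2) (use markov_processD(4)[OF mp s] sp in auto)
  let ?\<kappa> = "\<lambda>y. distr (P y) borel (X t)"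
  have k1: "?\<kappa> \<in> restrict_space borel {0..} \<rightarrow>\<^sub>M prob_algebra borel" by (rule markov_processD(6)[OF mp t])
  have k2[measurable]: "?\<kappa> \<in> restrict_space borel {0..} \<rightarrow>\<^sub>M subprob_algebra borel"
    by (rule measurable_prob_algebraD[OF k1])
  let ?F = "natural_filtration P X s"
  have sub: "subalgebra (P x) ?F"
    unfolding subalgebra_def natural_filtration_def
  proof
    let ?G = "\<Union>r\<in>{0..s}. {X r -` A \<inter> space (P 0) |A. A \<in> sets borel}"
    have G: "?G \<subseteq> sets (P 0)" using Xm by (auto intro: measurable_sets)
    have GP: "?G \<subseteq> Pow (space (P 0))" by auto
    show "space (sigma (space (P 0)) ?G) = space (P x)" using GP sp by simp
    show "sets (sigma (space (P 0)) ?G) \<subseteq> sets (P x)"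
      unfolding se using G GP by (simp add: sets.sigma_sets_subset)
  qed
  interpret fs: finite_measure_subalgebra "P x" ?F
    by unfold_locales (rule sub)
  show ?thesis
  proof (rule measure_eqI)
    have ne: "space (distr (P x) (restrict_space borel {0..}) (X s)) \<noteq> {}" by (simp add: space_restrict_space)
    have sb: "sets (distr (P x) (restrict_space borel {0..}) (X s) \<bind> ?\<kappa>) = sets borel"
    proof (rule sets_bind)
      fix y assume "y \<in> space (distr (P x) (restrict_space borel {0..}) (X s))"
      then show "sets (?\<kappa> y) = sets borel" by simp
    qed (rule ne)
    show "sets (distr (P x) borel (X (s + t))) = sets (distr (P x) (restrict_space borel {0..}) (X s) \<bind> ?\<kappa>)"
      using sb by simp
    fix A assume "A \<in> sets (distr (P x) borel (X (s + t)))"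
    then have A[measurable]: "A \<in> sets borel" by simp
    have mA: "(\<lambda>\<omega>. measure (?\<kappa> (X s \<omega>)) A) \<in> borel_measurable (P x)"
      unfolding measure_def
      by (intro borel_measurable_enn2real measurable_compose[OF Xr] measurable_compose[OF k2] measurable_emeasure_subprob_algebra A)
    let ?f = "indicator {\<omega>\<in>space (P x). X (s + t) \<omega> \<in> A} :: _ \<Rightarrow> real"
    have fi: "integrable (P x) ?f"
      by (rule integrable_real_indicator) (auto simp: emeasure_eq_measure)
    have ae: "AE \<omega> in P x. real_cond_exp (P x) ?F ?f \<omega> = measure (?\<kappa> (X s \<omega>)) A"
      by (rule markov_processD(7)[OF mp x s t A])
    have "measure (P x) {\<omega>\<in>space (P x). X (s + t) \<omega> \<in> A} = (LINT \<omega>|P x. ?f \<omega>)" by simp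
    also have "\<dots> = (LINT \<omega>|P x. real_cond_exp (P x) ?F ?f \<omega>)"
      by (rule fs.real_cond_exp_int(2)[OF fi, symmetric])
    also have "\<dots> = (LINT \<omega>|P x. measure (?\<kappa> (X s \<omega>)) A)"
      by (rule integral_cong_AE[OF _ mA ae]) simp
    finally have e1: "measure (P x) {\<omega>\<in>space (P x). X (s + t) \<omega> \<in> A} = (LINT \<omega>|P x. measure (?\<kappa> (X s \<omega>)) A)" .
    have pk: "prob_space (?\<kappa> (X s \<omega>))" if "\<omega> \<in> space (P x)" for \<omega>
    proof -
      have "X s \<omega> \<in> space (restrict_space borel {0..})" using measurable_space[OF Xr that] .
      then show ?thesis using measurable_space[OF k1] by (auto simp: space_prob_algebra)
    qed
    have "emeasure (distr (P x) borel (X (s + t))) A = ennreal (measure (P x) {\<omega>\<in>space (P x). X (s + t) \<omega> \<in> A})"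
      by (subst emeasure_distr) (auto simp: emeasure_eq_measure vimage_def Int_def conj_commute)
    also have "\<dots> = (\<integral>\<^sup>+\<omega>. ennreal (measure (?\<kappa> (X s \<omega>)) A) \<partial>P x)"
      unfolding e1
    proof (rule nn_integral_eq_integral[symmetric])
      show "integrable (P x) (\<lambda>\<omega>. measure (?\<kappa> (X s \<omega>)) A)"
      proof (rule integrable_const_bound[where B=1, OF _ mA], rule AE_I2)
        fix \<omega> assume "\<omega> \<in> space (P x)"
        then interpret k: prob_space "?\<kappa> (X s \<omega>)" by (rule pk)
        show "norm (measure (?\<kappa> (X s \<omega>)) A) \<le> 1" by simp
      qed
    qed simp
    also have "\<dots> = (\<integral>\<^sup>+\<omega>. emeasure (?\<kappa> (X s \<omega>)) A \<partial>P x)"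
    proof (rule nn_integral_cong)
      fix \<omega> assume "\<omega> \<in> space (P x)"
      then interpret k: prob_space "?\<kappa> (X s \<omega>)" by (rule pk)
      show "ennreal (measure (?\<kappa> (X s \<omega>)) A) = emeasure (?\<kappa> (X s \<omega>)) A" by (simp add: k.emeasure_eq_measure)
    qed
    also have "\<dots> = (\<integral>\<^sup>+y. emeasure (?\<kappa> y) A \<partial>distr (P x) (restrict_space borel {0..}) (X s))"
      by (rule nn_integral_distr[symmetric, OF Xr])
        (subst measurable_distr_eq1, rule measurable_compose[OF k2 measurable_emeasure_subprob_algebra[OF A]])
    also have "\<dots> = emeasure (distr (P x) (restrict_space borel {0..}) (X s) \<bind> ?\<kappa>) A"
      by (rule emeasure_bind[symmetric, OF ne _ A]) (use k2 in simp)
    finally show "emeasure (distr (P x) borel (X (s + t))) A =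
       emeasure (distr (P x) (restrict_space borel {0..}) (X s) \<bind> ?\<kappa>) A" .
  qed
qed

text \<open>In the Chapman-Kolmogorov equation the inner integral of \<open>exp (- u * z)\<close> is
  again exponential in the state, now with argument \<open>\<psi> t u\<close>. This is where the
  affine form of the exponents enters.\<close>

lemma CBI_flow:
  assumes mp: "markov_process P X" and ex: "CBI_exponents P X \<phi> \<psi>"
    and s: "0 \<le> s" and t: "0 \<le> t" and u: "0 \<le> u"
  shows "(LINT \<omega>|P 0. exp (- u * X (s + t) \<omega>)) = exp (- \<phi> t u) * (LINT \<omega>|P 0. exp (- \<psi> t u * X s \<omega>))"
proof -
  have st: "0 \<le> s + t" using s t by simp
  have \<psi>0: "0 \<le> \<psi> t u" by (rule CBI_psi_nonneg[OF mp ex t u])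
  interpret prob_space "P 0" by (rule markov_processD(1)[OF mp order_refl])
  have [measurable]: "X s \<in> borel_measurable (P 0)" "X (s + t) \<in> borel_measurable (P 0)" "X t \<in> borel_measurable (P 0)"
    by (rule markov_processD(3)[OF mp], fact)+
  have Xs0: "0 \<le> X s \<omega>" if "\<omega> \<in> space (P 0)" for \<omega> by (rule markov_processD(4)[OF mp s that])
  have Xr[measurable]: "X s \<in> P 0 \<rightarrow>\<^sub>M restrict_space borel {0..}"
    by (rule measurable_restrict_space2) (use Xs0 in auto)
  let ?\<kappa> = "\<lambda>y. distr (P y) borel (X t)"
  have k2[measurable]: "?\<kappa> \<in> restrict_space borel {0..} \<rightarrow>\<^sub>M subprob_algebra borel"
    by (rule measurable_prob_algebraD) (rule markov_processD(6)[OF mp t])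
  have lap: "(\<integral>\<^sup>+y. ennreal (exp (- u * y)) \<partial>distr (P x) borel (X r)) = ennreal (exp (- (\<phi> r u + x * \<psi> r u)))"
    if x: "0 \<le> x" and r: "0 \<le> r" for x r
  proof -
    have "X r \<in> borel_measurable (P x)"
      using markov_processD(3)[OF mp r] measurable_cong_sets[OF markov_processD(2)[OF mp x] refl] by blast
    then have "(\<integral>\<^sup>+y. ennreal (exp (- u * y)) \<partial>distr (P x) borel (X r)) = (\<integral>\<^sup>+\<omega>. ennreal (exp (- u * X r \<omega>)) \<partial>P x)"
      by (intro nn_integral_distr) auto
    also have "\<dots> = ennreal (LINT \<omega>|P x. exp (- u * X r \<omega>))"
      by (rule nn_integral_eq_integral[OF CBI_laplace(1)[OF mp ex r u x]]) simp
    finally show ?thesis by (simp only: CBI_laplace(2)[OF mp ex r u x])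
  qed
  have "ennreal (LINT \<omega>|P 0. exp (- u * X (s + t) \<omega>)) = (\<integral>\<^sup>+y. ennreal (exp (- u * y)) \<partial>distr (P 0) borel (X (s + t)))"
    by (simp only: lap[OF order_refl st] CBI_laplace(2)[OF mp ex st u order_refl])
  also have "\<dots> = (\<integral>\<^sup>+y. \<integral>\<^sup>+z. ennreal (exp (- u * z)) \<partial>?\<kappa> y \<partial>distr (P 0) (restrict_space borel {0..}) (X s))"
    unfolding markov_process_distr[OF mp order_refl s t]
    by (rule nn_integral_bind[where B=borel]) (use k2 in auto)
  also have "\<dots> = (\<integral>\<^sup>+\<omega>. \<integral>\<^sup>+z. ennreal (exp (- u * z)) \<partial>?\<kappa> (X s \<omega>) \<partial>P 0)"
    by (rule nn_integral_distr[OF Xr])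
      (subst measurable_distr_eq1, rule measurable_compose[OF k2 nn_integral_measurable_subprob_algebra], simp)
  also have "\<dots> = (\<integral>\<^sup>+\<omega>. ennreal (exp (- \<phi> t u) * exp (- \<psi> t u * X s \<omega>)) \<partial>P 0)"
    by (rule nn_integral_cong, subst lap[OF Xs0 t]) (auto simp: algebra_simps simp flip: exp_add)
  also have "\<dots> = ennreal (LINT \<omega>|P 0. exp (- \<phi> t u) * exp (- \<psi> t u * X s \<omega>))"
    by (rule nn_integral_eq_integral, rule integrable_mult_right, rule CBI_laplace(1)[OF mp ex s \<psi>0 order_refl]) simp
  finally show ?thesis by simp
qed

section \<open>Passage to the limit law\<close>

lemma limit_distributionD:
  assumes "limit_distribution P X L"
  shows "prob_space L" "sets L = sets borel" "AE x in L. 0 \<le> x"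
proof -
  show "prob_space L" "sets L = sets borel" using assms by (auto simp: limit_distribution_def)
  then have "AE x in L. x \<notin> {..<0}"
    using assms by (intro AE_not_in) (auto simp: limit_distribution_def null_sets_def)
  then show "AE x in L. 0 \<le> x" by eventually_elim simp
qed

lemma limit_distribution_laplace:
  assumes mp: "markov_process P X" and lim: "limit_distribution P X L" and u: "0 \<le> u" and t: "0 \<le> t"
  shows "(\<lambda>n. LINT \<omega>|P 0. exp (- u * X (real n + t) \<omega>)) \<longlonglongrightarrow> (LINT x|L. exp (- u * x))"
proof -
  \<comment> \<open>\<open>max 0 x\<close> makes the test function bounded and continuous on the
    whole line, as weak convergence requires; \<open>X\<close> and \<open>L\<close> live on the
    half-line and do not see the change.\<close>
  let ?f = "\<lambda>x. exp (- u * max 0 x) :: real"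
  have rL: "real_distribution L"
    using lim by (auto simp: limit_distribution_def real_distribution_def real_distribution_axioms_def)
  have Xm: "X (real n + t) \<in> borel_measurable (P 0)" for n by (rule markov_processD(3)[OF mp]) (use t in simp)
  have rn: "real_distribution (distr (P 0) borel (X (real n + t)))" for n
    by (rule prob_space.real_distribution_distr[OF _ Xm]) (rule markov_processD(1)[OF mp order_refl])
  have wc: "weak_conv_m (\<lambda>n. distr (P 0) borel (X (real n + t))) L"
  proof -
    have "filterlim (\<lambda>n. real n + t) at_top sequentially"
      using filterlim_tendsto_add_at_top[OF tendsto_const filterlim_real_sequentially, of t] by (simp add: add.commute)
    then show ?thesis using lim by (auto simp: limit_distribution_def)
  qed
  have "(\<lambda>n. LINT x|distr (P 0) borel (X (real n + t)). ?f x) \<longlonglongrightarrow> (LINT x|L. ?f x)"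
  proof (rule weak_conv_imp_integral_bdd_continuous_conv[OF rn rL wc])
    show "isCont ?f x" for x by (intro continuous_intros)
    show "norm (?f x) \<le> 1" for x using u by simp
  qed
  moreover have "(LINT x|distr (P 0) borel (X (real n + t)). ?f x) = (LINT \<omega>|P 0. exp (- u * X (real n + t) \<omega>))" for n
  proof -
    have "(LINT x|distr (P 0) borel (X (real n + t)). ?f x) = (LINT \<omega>|P 0. ?f (X (real n + t) \<omega>))"
      by (rule integral_distr[OF Xm]) simp
    also have "\<dots> = (LINT \<omega>|P 0. exp (- u * X (real n + t) \<omega>))"
      by (rule Bochner_Integration.integral_cong) (use markov_processD(4)[OF mp, of "real n + t" for n] t in \<open>auto simp: max_def\<close>)
    finally show ?thesis .
  qed
  moreover have "(LINT x|L. ?f x) = (LINT x|L. exp (- u * x))"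
  proof (rule integral_cong_AE)
    have [measurable_cong]: "sets L = sets borel" by (rule limit_distributionD[OF lim])
    show "?f \<in> borel_measurable L" "(\<lambda>x. exp (- u * x)) \<in> borel_measurable L" by measurable
    show "AE x in L. ?f x = exp (- u * x)"
      using limit_distributionD(3)[OF lim] by eventually_elim (simp add: max_def)
  qed
  ultimately show ?thesis by simp
qed

text \<open>The transform of \<open>X (n + t)\<close> has two limits as \<open>n\<close> grows: the
  direct one, and the one obtained through \<open>CBI_flow\<close> from the law of
  \<open>X n\<close>.\<close>

lemma limit_distribution_invariant:
  assumes mp: "markov_process P X" and ex: "CBI_exponents P X \<phi> \<psi>" and lim: "limit_distribution P X L"
    and t: "0 \<le> t" and u: "0 \<le> u"
  shows "(LINT x|L. exp (- u * x)) = exp (- \<phi> t u) * (LINT x|L. exp (- \<psi> t u * x))"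
proof (rule LIMSEQ_unique)
  have \<psi>0: "0 \<le> \<psi> t u" by (rule CBI_psi_nonneg[OF mp ex t u])
  show "(\<lambda>n. LINT \<omega>|P 0. exp (- u * X (real n + t) \<omega>)) \<longlonglongrightarrow> exp (- \<phi> t u) * (LINT x|L. exp (- \<psi> t u * x))"
    unfolding CBI_flow[OF mp ex of_nat_0_le_iff t u]
    using limit_distribution_laplace[OF mp lim \<psi>0 order_refl] by (intro tendsto_mult tendsto_const) simp
  show "(\<lambda>n. LINT \<omega>|P 0. exp (- u * X (real n + t) \<omega>)) \<longlonglongrightarrow> (LINT x|L. exp (- u * x))"
    by (rule limit_distribution_laplace[OF mp lim u t])
qed

subsection \<open>Laplace transforms of laws on the half-line\<close>

text \<open>On the unit interval the exponential series of the characteristic function can be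
  integrated termwise, its partial sums being bounded by \<open>exp \<bar>t\<bar>\<close>; so the
  moments determine it.\<close>

lemma moments_unit_interval_unique:
  fixes M N :: "real measure"
  assumes M: "real_distribution M" "AE x in M. x \<in> {0..1}"
    and N: "real_distribution N" "AE x in N. x \<in> {0..1}"
    and mom: "\<And>n. (LINT x|M. x ^ n) = (LINT x|N. x ^ n)"
  shows "M = N"
proof (rule Levy_uniqueness[OF M(1) N(1)], rule ext)
  have char: "(\<lambda>n. (\<i> * of_real t) ^ n /\<^sub>R fact n * of_real (LINT x|M. x ^ n)) sums char M t"
    if M: "real_distribution M" "AE x in M. x \<in> {0..1}" for M and t :: real
  proof -
    interpret real_distribution M by (rule M(1))
    have "(\<lambda>n. CLINT x|M. (\<i> * of_real t) ^ n /\<^sub>R fact n * of_real (x ^ n)) sums (CLINT x|M. iexp (t * x))"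
    proof (rule sums_integral_dominated[where w="\<lambda>_. exp \<bar>t\<bar>"])
      have i: "integrable M (\<lambda>x. x ^ n)" for n
      proof (rule integrable_const_bound[where B=1])
        show "AE x in M. norm (x ^ n) \<le> 1" using M(2) by eventually_elim (auto simp: power_le_one)
      qed simp
      show "integrable M (\<lambda>x. (\<i> * of_real t) ^ n /\<^sub>R fact n * of_real (x ^ n))" for n
        by (intro integrable_mult_right integrable_of_real i)
      show "AE x in M. (\<lambda>n. (\<i> * of_real t) ^ n /\<^sub>R fact n * of_real (x ^ n)) sums iexp (t * x)"
      proof (rule AE_I2)
        fix x
        have "(\<lambda>n. (\<i> * of_real (t * x)) ^ n /\<^sub>R fact n) sums iexp (t * x)" by (rule exp_converges)
        then show "(\<lambda>n. (\<i> * of_real t) ^ n /\<^sub>R fact n * of_real (x ^ n)) sums iexp (t * x)"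
          by (simp add: power_mult_distrib mult_ac)
      qed
      fix K
      show "AE x in M. norm (\<Sum>n<K. (\<i> * of_real t) ^ n /\<^sub>R fact n * of_real (x ^ n)) \<le> exp \<bar>t\<bar>"
        using M(2)
      proof eventually_elim
        case (elim x)
        have "norm (\<Sum>n<K. (\<i> * of_real t) ^ n /\<^sub>R fact n * of_real (x ^ n)) \<le> (\<Sum>n<K. \<bar>t\<bar> ^ n / fact n)"
        proof (rule sum_norm_le)
          fix n
          have "norm ((\<i> * of_real t) ^ n /\<^sub>R fact n * of_real (x ^ n)) = \<bar>t\<bar> ^ n / fact n * x ^ n"
            using elim by (simp add: norm_mult norm_power divide_inverse mult_ac)
          also have "\<dots> \<le> \<bar>t\<bar> ^ n / fact n * 1"
            using elim by (intro mult_left_mono power_le_one) auto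
          finally show "norm ((\<i> * of_real t) ^ n /\<^sub>R fact n * of_real (x ^ n)) \<le> \<bar>t\<bar> ^ n / fact n" by simp
        qed
        also have "\<dots> \<le> exp \<bar>t\<bar>" by (rule sum_power_fact_le_exp) simp
        finally show ?case .
      qed
    qed measurable
    moreover have "(CLINT x|M. (\<i> * of_real t) ^ n /\<^sub>R fact n * of_real (x ^ n)) =
        (\<i> * of_real t) ^ n /\<^sub>R fact n * of_real (LINT x|M. x ^ n)" for n
      by (simp only: integral_mult_right_zero integral_complex_of_real)
    ultimately show ?thesis unfolding char_def by (simp only:)
  qed
  show "char M t = char N t" for t
    using sums_unique2[OF char[OF M] char[OF N, unfolded mom[symmetric]]] .
qed

text \<open>Under \<open>y = e\<^sup>-\<^sup>x\<close> the values of the transform at the integers become moments on the unit interval.\<close>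

lemma laplace_transform_unique:
  fixes M N :: "real measure"
  assumes M: "sets M = sets borel" "AE x in M. 0 \<le> x" and N: "sets N = sets borel" "AE x in N. 0 \<le> x"
    and eq: "\<And>n::nat. 1 \<le> n \<Longrightarrow> (\<integral>\<^sup>+x. ennreal (exp (- real n * x)) \<partial>M) = (\<integral>\<^sup>+x. ennreal (exp (- real n * x)) \<partial>N)"
    and fin: "(\<integral>\<^sup>+x. ennreal (exp (- x)) \<partial>M) < \<infinity>"
  shows "M = N"
proof -
  define A where "A = (\<integral>\<^sup>+x. ennreal (exp (- x)) \<partial>M)"
  have AN: "A = (\<integral>\<^sup>+x. ennreal (exp (- x)) \<partial>N)" using eq[of 1] by (simp add: A_def)
  show ?thesis
  proof (cases "A = 0")
    case True
    \<comment> \<open>As \<open>exp (- x)\<close> is positive, \<open>A = 0\<close> forces both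
      measures to vanish; otherwise \<open>A\<close> serves as a normalisation.\<close>
    have "emeasure Q B = 0" if Q: "sets Q = sets borel" "(\<integral>\<^sup>+x. ennreal (exp (- x)) \<partial>Q) = 0" for Q :: "real measure" and B
    proof -
      have [measurable_cong]: "sets Q = sets borel" by (rule Q)
      have "AE x in Q. ennreal (exp (- x)) = 0" using Q(2) by (subst (asm) nn_integral_0_iff_AE) auto
      then have "AE x in Q. False" by simp
      then have "emeasure Q (space Q) = 0" by (subst (asm) AE_iff_measurable[of "space Q"]) auto
      moreover have "emeasure Q B \<le> emeasure Q (space Q)" by (rule emeasure_space)
      ultimately show ?thesis by simp
    qed
    then show ?thesis using True AN M N unfolding A_def by (intro measure_eqI) auto
  next
    case False
    define a where "a = enn2real A"
    have a: "0 < a" "A = ennreal a" using False fin by (auto simp: a_def A_def enn2real_positive_iff less_top zero_less_iff_neq_zero)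
    \<comment> \<open>The measures may be infinite; the tilt by \<open>exp (- x) / a\<close> makes
      them probabilities. It also moves the \<open>n\<close>-th moment of \<open>V Q\<close> to the
      transform at \<open>n + 1\<close>, so that only positive integers occur. The last clause of
      \<open>V\<close> undoes both the tilt and the change of variable.\<close>
    define T where "T Q = density Q (\<lambda>x. ennreal (exp (- x) / a))" for Q :: "real measure"
    define V where "V Q = distr (T Q) borel (\<lambda>x. exp (- x))" for Q :: "real measure"
    have V: "real_distribution (V Q)" "AE y in V Q. y \<in> {0..1}"
      "\<And>n. (LINT y|V Q. y ^ n) = enn2real (\<integral>\<^sup>+x. ennreal (exp (- real (Suc n) * x)) \<partial>Q) / a"
      "Q = density (distr (V Q) borel (\<lambda>y. - ln y)) (\<lambda>x. ennreal (a * exp x))"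
      if Q: "sets Q = sets borel" "AE x in Q. 0 \<le> x" "(\<integral>\<^sup>+x. ennreal (exp (- x)) \<partial>Q) = ennreal a" for Q
    proof -
      have sQ[measurable_cong]: "sets Q = sets borel" by (rule Q)
      have spQ: "space Q = UNIV" using sets_eq_imp_space_eq[OF sQ] by simp
      have sT[measurable_cong]: "sets (T Q) = sets borel" by (simp add: T_def Q)
      have "emeasure (T Q) (space (T Q)) = (\<integral>\<^sup>+x. ennreal (exp (- x) / a) \<partial>Q)"
        by (simp add: T_def emeasure_density spQ)
      also have "\<dots> = (\<integral>\<^sup>+x. ennreal (exp (- x)) \<partial>Q) / ennreal a"
        using a(1) by (subst nn_integral_divide[symmetric]) (auto simp: divide_ennreal)
      also have "\<dots> = 1" using a(1) Q(3) by (simp add: divide_ennreal)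
      finally interpret T: prob_space "T Q" by (rule prob_spaceI)
      show rV: "real_distribution (V Q)" unfolding V_def by (rule T.real_distribution_distr) simp
      have "AE x in T Q. 0 \<le> x" unfolding T_def using Q(2) by (subst AE_density) auto
      then show "AE y in V Q. y \<in> {0..1}" unfolding V_def by (subst AE_distr_iff) auto
      show "(LINT y|V Q. y ^ n) = enn2real (\<integral>\<^sup>+x. ennreal (exp (- real (Suc n) * x)) \<partial>Q) / a" for n
      proof -
        have "(LINT y|V Q. y ^ n) = (LINT x|T Q. exp (- x) ^ n)" unfolding V_def by (rule integral_distr) simp_all
        also have "\<dots> = (LINT x|Q. (exp (- x) / a) * exp (- x) ^ n)"
          unfolding T_def using a(1) by (subst integral_density) auto
        also have "\<dots> = (LINT x|Q. exp (- real (Suc n) * x) / a)"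
          by (rule Bochner_Integration.integral_cong)
            (simp_all add: exp_of_nat_mult[symmetric] algebra_simps flip: exp_add)
        also have "\<dots> = (LINT x|Q. exp (- real (Suc n) * x)) / a" by (rule integral_divide_zero)
        also have "(LINT x|Q. exp (- real (Suc n) * x)) = enn2real (\<integral>\<^sup>+x. ennreal (exp (- real (Suc n) * x)) \<partial>Q)"
          by (rule integral_eq_nn_integral) auto
        finally show ?thesis .
      qed
      have "distr (V Q) borel (\<lambda>y. - ln y) = distr (T Q) borel (\<lambda>x. x)"
        unfolding V_def by (subst distr_distr) (auto simp: comp_def)
      also have "\<dots> = T Q" by (rule distr_id2) (rule sT[symmetric])
      finally have "density (distr (V Q) borel (\<lambda>y. - ln y)) (\<lambda>x. ennreal (a * exp x)) = density (T Q) (\<lambda>x. ennreal (a * exp x))" by simp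
      also have "\<dots> = density Q (\<lambda>x. ennreal (exp (- x) / a) * ennreal (a * exp x))"
        unfolding T_def by (rule density_density_eq) measurable
      also have "(\<lambda>x. ennreal (exp (- x) / a) * ennreal (a * exp x)) = (\<lambda>x. 1)"
        using a(1) by (auto simp: fun_eq_iff exp_minus field_simps simp flip: ennreal_mult)
      finally show "Q = density (distr (V Q) borel (\<lambda>y. - ln y)) (\<lambda>x. ennreal (a * exp x))" by (simp add: density_1)
    qed
    have QM: "(\<integral>\<^sup>+x. ennreal (exp (- x)) \<partial>M) = ennreal a" and QN: "(\<integral>\<^sup>+x. ennreal (exp (- x)) \<partial>N) = ennreal a"
      using a(2) AN by (auto simp: A_def)
    have "V M = V N"
      by (rule moments_unit_interval_unique[OF V(1,2)[OF M QM] V(1,2)[OF N QN]])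
         (simp only: V(3)[OF M QM] V(3)[OF N QN] eq)
    then show ?thesis using V(4)[OF M QM] V(4)[OF N QN] by metis
  qed
qed

section \<open>Derivative, exponent and support read off from the transform\<close>

lemma laplace_integrable:
  fixes L :: "real measure"
  assumes "prob_space L" "sets L = sets borel" "AE x in L. 0 \<le> x" "0 \<le> u"
  shows "integrable L (\<lambda>x. exp (- u * x))"
proof -
  interpret prob_space L by (rule assms)
  have [measurable_cong]: "sets L = sets borel" by (rule assms)
  show ?thesis
  proof (rule integrable_const_bound[where B=1])
    show "AE x in L. norm (exp (- u * x)) \<le> 1" using assms(3) by eventually_elim (use assms(4) in simp)
  qed measurable
qed

lemma laplace_moment_integrable:
  fixes L :: "real measure"
  assumes L: "prob_space L" "sets L = sets borel" "AE x in L. 0 \<le> x" and u: "0 < u"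
  shows "integrable L (\<lambda>x. x * exp (- u * x))"
proof -
  interpret prob_space L by (rule L)
  have [measurable_cong]: "sets L = sets borel" by (rule L)
  show ?thesis
  proof (rule integrable_const_bound[where B="1 / u"])
    show "AE x in L. norm (x * exp (- u * x)) \<le> 1 / u" using L(3)
    proof eventually_elim
      case (elim x)
      have "u * x \<le> exp (u * x)" using exp_ge_add_one_self[of "u * x"] by linarith
      then show ?case using elim u by (simp add: exp_minus abs_mult field_simps)
    qed
  qed measurable
qed

lemma laplace_pos:
  fixes L :: "real measure"
  assumes "prob_space L" "sets L = sets borel" "AE x in L. 0 \<le> x" "0 \<le> u"
  shows "0 < (LINT x|L. exp (- u * x))"
  by (rule integral_exp_pos[OF assms(1) laplace_integrable[OF assms]])

lemma exp_diff_le: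
  fixes x y z :: real
  assumes "z \<le> x" "z \<le> y"
  shows "\<bar>exp (- x) - exp (- y)\<bar> \<le> \<bar>x - y\<bar> * exp (- z)"
proof -
  have *: "\<bar>exp (- x) - exp (- y)\<bar> \<le> \<bar>x - y\<bar> * exp (- z)" if "z \<le> x" "x \<le> y" for x y :: real
  proof -
    have "exp (- x) - exp (- y) = exp (- x) * (1 - exp (- (y - x)))" by (simp add: algebra_simps flip: exp_add)
    also have "\<dots> \<le> exp (- z) * (y - x)"
    proof (rule mult_mono)
      show "1 - exp (- (y - x)) \<le> y - x" using exp_ge_add_one_self[of "- (y - x)"] by linarith
    qed (use that in auto)
    finally show ?thesis using that by (simp add: mult.commute)
  qed
  show ?thesis using *[of x y] *[of y x] assms by (cases "x \<le> y") (auto simp: abs_minus_commute)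
qed

lemma laplace_has_derivative:
  fixes L :: "real measure"
  assumes L: "prob_space L" "sets L = sets borel" "AE x in L. 0 \<le> x" and u: "0 < u"
  shows "((\<lambda>u. LINT x|L. exp (- u * x)) has_real_derivative - (LINT x|L. x * exp (- u * x))) (at u)"
proof -
  interpret prob_space L by (rule L)
  have [measurable_cong]: "sets L = sets borel" by (rule L)
  have "((\<lambda>v. LINT x|L. (exp (- v * x) - exp (- u * x)) / (v - u)) \<longlongrightarrow> (LINT x|L. - x * exp (- u * x))) (at u)"
  proof (rule integral_dominated_convergence_within)
    show "integrable L (\<lambda>x. 2 / u)" by simp
    show "AE x in L. ((\<lambda>v. (exp (- v * x) - exp (- u * x)) / (v - u)) \<longlongrightarrow> - x * exp (- u * x)) (at u)"
    proof (rule AE_I2)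
      fix x
      have "((\<lambda>v. exp (- v * x)) has_real_derivative (- x * exp (- u * x))) (at u)"
        by (auto intro!: derivative_eq_intros)
      then show "((\<lambda>v. (exp (- v * x) - exp (- u * x)) / (v - u)) \<longlongrightarrow> - x * exp (- u * x)) (at u)"
        by (simp add: has_field_derivative_iff)
    qed
    \<comment> \<open>Keeping \<open>v\<close> above \<open>u / 2\<close> bounds the difference
      quotient by \<open>x * exp (- (u / 2 * x))\<close>, which is at most
      \<open>2 / u\<close>.\<close>
    have "\<forall>\<^sub>F v in at u. u / 2 < v"
      by (rule order_tendstoD(1)[OF tendsto_ident_at]) (use u in simp)
    then show "\<forall>\<^sub>F v in at u. AE x in L. norm ((exp (- v * x) - exp (- u * x)) / (v - u)) \<le> 2 / u"
    proof eventually_elim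
      case (elim v)
      show ?case using L(3)
      proof eventually_elim
        case (elim x)
        have "\<bar>exp (- (v * x)) - exp (- (u * x))\<bar> \<le> \<bar>v * x - u * x\<bar> * exp (- (u / 2 * x))"
        proof (rule exp_diff_le)
          show "u / 2 * x \<le> v * x" by (rule mult_right_mono) (use elim \<open>u / 2 < v\<close> in auto)
          show "u / 2 * x \<le> u * x" by (rule mult_right_mono) (use elim u in auto)
        qed
        also have "\<bar>v * x - u * x\<bar> = \<bar>v - u\<bar> * x" using elim by (simp add: abs_mult flip: left_diff_distrib)
        finally have 1: "\<bar>exp (- (v * x)) - exp (- (u * x))\<bar> \<le> \<bar>v - u\<bar> * (x * exp (- (u / 2 * x)))" by simp
        have "u / 2 * x \<le> exp (u / 2 * x)" using exp_ge_add_one_self[of "u / 2 * x"] by linarith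
        then have 2: "x * exp (- (u / 2 * x)) \<le> 2 / u" using u by (simp add: exp_minus field_simps)
        have "\<bar>exp (- (v * x)) - exp (- (u * x))\<bar> \<le> \<bar>v - u\<bar> * (2 / u)"
          using 1 mult_left_mono[OF 2, of "\<bar>v - u\<bar>"] by linarith
        then show ?case
        proof (cases "v = u")
          case False
          then have "\<bar>exp (- (v * x)) - exp (- (u * x))\<bar> / \<bar>v - u\<bar> \<le> 2 / u"
            using \<open>\<bar>exp (- (v * x)) - exp (- (u * x))\<bar> \<le> \<bar>v - u\<bar> * (2 / u)\<close>
            by (subst pos_divide_le_eq) (auto simp: mult.commute)
          then show ?thesis by simp
        qed (use u in simp)
      qed
    qed
  qed measurable
  moreover have "\<forall>\<^sub>F v in at u. (LINT x|L. (exp (- v * x) - exp (- u * x)) / (v - u)) =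
      ((LINT x|L. exp (- v * x)) - (LINT x|L. exp (- u * x))) / (v - u)"
  proof -
    have "\<forall>\<^sub>F v in at u. 0 < v" by (rule order_tendstoD(1)[OF tendsto_ident_at u])
    then show ?thesis
    proof eventually_elim
      case (elim v)
      then show ?case
        using laplace_integrable[OF L, of v] laplace_integrable[OF L, of u] u by simp
    qed
  qed
  ultimately have "((\<lambda>v. ((LINT x|L. exp (- v * x)) - (LINT x|L. exp (- u * x))) / (v - u)) \<longlongrightarrow> (LINT x|L. - x * exp (- u * x))) (at u)"
    by (rule Lim_transform_eventually)
  then show ?thesis by (simp add: has_field_derivative_iff)
qed

lemma laplace_continuous:
  fixes L :: "real measure"
  assumes L: "prob_space L" "sets L = sets borel" "AE x in L. 0 \<le> x"
  shows "continuous_on {0..} (\<lambda>u. LINT x|L. exp (- u * x))"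
  unfolding continuous_on_def
proof
  interpret prob_space L by (rule L)
  have [measurable_cong]: "sets L = sets borel" by (rule L)
  fix u :: real
  show "((\<lambda>u. LINT x|L. exp (- u * x)) \<longlongrightarrow> (LINT x|L. exp (- u * x))) (at u within {0..})"
  proof (rule integral_dominated_convergence_within)
    show "integrable L (\<lambda>_. 1)" by simp
    show "AE x in L. ((\<lambda>v. exp (- v * x)) \<longlongrightarrow> exp (- u * x)) (at u within {0..})"
      by (intro AE_I2 tendsto_intros)
    have "\<forall>\<^sub>F v in at u within {0..}. v \<in> {0..}" by (simp add: eventually_at_filter)
    then show "\<forall>\<^sub>F v in at u within {0..}. AE x in L. norm (exp (- v * x)) \<le> 1"
    proof eventually_elim
      case (elim v)
      show ?case using L(3) by eventually_elim (use elim in simp)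
    qed
  qed measurable
qed

text \<open>The differential equation \<open>(ln D)' = - \<integral> e\<^sup>-\<^sup>u\<^sup>x k(x) dx\<close> for \<open>D(u) = e\<^sup>\<gamma>\<^sup>u \<integral> e\<^sup>-\<^sup>u\<^sup>x L(dx)\<close> is integrated over \<open>[0,u]\<close>.\<close>

lemma levy_khintchine_of_derivative:
  fixes L :: "real measure" and k kh :: "real \<Rightarrow> real"
  assumes L: "prob_space L" "sets L = sets borel" "AE x in L. 0 \<le> x"
    and [measurable]: "k \<in> borel_measurable borel" and k0: "\<And>x. 0 \<le> k x" "\<And>x. x \<le> 0 \<Longrightarrow> k x = 0"
    and kh: "\<And>u. 0 < u \<Longrightarrow> (\<integral>\<^sup>+x. ennreal (exp (- u * x) * k x) \<partial>lborel) = ennreal (kh u)" "\<And>u. 0 < u \<Longrightarrow> 0 \<le> kh u"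
    and der: "\<And>u. 0 < u \<Longrightarrow> (LINT x|L. x * exp (- u * x)) = (\<gamma> + kh u) * (LINT x|L. exp (- u * x))"
    and u: "0 < u"
  shows "integrable lborel (\<lambda>x. (1 - exp (- u * x)) * k x / x)"
    and "exp (\<gamma> * u) * (LINT x|L. exp (- u * x)) = exp (- (LINT x|lborel. (1 - exp (- u * x)) * k x / x))"
proof -
  define Lh where "Lh v = (LINT x|L. exp (- v * x))" for v
  have Lpos: "0 < Lh v" if "0 \<le> v" for v unfolding Lh_def by (rule laplace_pos[OF L that])
  interpret prob_space L by (rule L)
  have Lh0: "Lh 0 = 1" by (simp add: Lh_def prob_space)
  define h where "h v = - \<gamma> * v - ln (Lh v)" for v
  define q where "q v = (if 0 < v then kh v else 0)" for v
  have "(q has_integral (h u - h 0)) {0..u}"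
  \<comment> \<open>Differentiability is asked for in the interior only: \<open>L\<close> may have
    infinite mean, and then \<open>h\<close> has no finite derivative at 0.\<close>
  proof (rule fundamental_theorem_of_calculus_interior)
    have "continuous_on {0..u} Lh"
      using continuous_on_subset[OF laplace_continuous[OF L], of "{0..u}"] by (simp add: Lh_def[abs_def])
    then show "continuous_on {0..u} h" unfolding h_def
      using Lpos by (intro continuous_intros) force+
    fix v assume v: "v \<in> {0<..<u}"
    then have "(Lh has_real_derivative - ((\<gamma> + kh v) * Lh v)) (at v)"
      using laplace_has_derivative[OF L, of v] der[of v] by (simp add: Lh_def[abs_def])
    then have "(h has_real_derivative - \<gamma> - (- ((\<gamma> + kh v) * Lh v) / Lh v)) (at v)"
      unfolding h_def using v Lpos[of v] by (auto intro!: derivative_eq_intros)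
    moreover have "- \<gamma> - (- ((\<gamma> + kh v) * Lh v) / Lh v) = q v" using Lpos[of v] v by (simp add: q_def)
    ultimately show "(h has_vector_derivative q v) (at v)"
      by (simp add: has_real_derivative_iff_has_vector_derivative)
  qed (use u in simp)
  then have 1: "(\<integral>\<^sup>+v. ennreal (q v) * indicator {0..u} v \<partial>lborel) = ennreal (h u)"
    using nn_integral_has_integral_lebesgue'[of "{0..u}" q "h u - h 0"] kh(2) Lh0
    by (simp add: q_def h_def)
  have "(\<integral>\<^sup>+v. ennreal (q v) * indicator {0..u} v \<partial>lborel) =
     (\<integral>\<^sup>+v. \<integral>\<^sup>+x. ennreal (exp (- v * x) * k x) * indicator {0<..u} v \<partial>lborel \<partial>lborel)"
  proof (rule nn_integral_cong)
    fix v :: real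
    show "ennreal (q v) * indicator {0..u} v = (\<integral>\<^sup>+x. ennreal (exp (- v * x) * k x) * indicator {0<..u} v \<partial>lborel)"
      using kh(1)[of v] by (cases "0 < v"; cases "v \<le> u") (simp_all add: q_def)
  qed
  also have "\<dots> = (\<integral>\<^sup>+x. \<integral>\<^sup>+v. ennreal (exp (- v * x) * k x) * indicator {0<..u} v \<partial>lborel \<partial>lborel)"
    by (rule lborel_pair.Fubini') measurable
  also have "\<dots> = (\<integral>\<^sup>+x. ennreal ((1 - exp (- u * x)) * k x / x) \<partial>lborel)"
  proof (rule nn_integral_cong)
    fix x :: real
    show "(\<integral>\<^sup>+v. ennreal (exp (- v * x) * k x) * indicator {0<..u} v \<partial>lborel) = ennreal ((1 - exp (- u * x)) * k x / x)"
    proof (cases "0 < x")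
      case True
      have "(\<integral>\<^sup>+v. ennreal (exp (- v * x) * k x) * indicator {0<..u} v \<partial>lborel)
        = (\<integral>\<^sup>+v. ennreal (exp (- v * x) * k x) * indicator {0..u} v \<partial>lborel)"
        by (rule nn_integral_cong_AE) (use AE_lborel_singleton[of "0::real"] in eventually_elim, auto split: split_indicator)
      also have "\<dots> = ennreal ((- exp (- u * x) * k x / x) - (- exp (- 0 * x) * k x / x))"
      proof (rule nn_integral_FTC_Icc)
        show "((\<lambda>v. - exp (- v * x) * k x / x) has_real_derivative exp (- v * x) * k x) (at v)" for v
          using True by (auto intro!: derivative_eq_intros)
      qed (use u k0 in auto)
      also have "(- exp (- u * x) * k x / x) - (- exp (- 0 * x) * k x / x) = (1 - exp (- u * x)) * k x / x"
        using True by (simp add: field_simps)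
      finally show ?thesis .
    qed (simp add: k0)
  qed
  finally have 2: "(\<integral>\<^sup>+x. ennreal ((1 - exp (- u * x)) * k x / x) \<partial>lborel) = ennreal (h u)" using 1 by simp
  have nn: "0 \<le> (1 - exp (- u * x)) * k x / x" for x
    using u k0(1)[of x] k0(2)[of x] by (cases "0 < x") auto
  show int: "integrable lborel (\<lambda>x. (1 - exp (- u * x)) * k x / x)"
  proof (rule integrableI_nonneg)
    show "(\<integral>\<^sup>+x. ennreal ((1 - exp (- u * x)) * k x / x) \<partial>lborel) < \<infinity>" unfolding 2 by simp
  qed (use nn in auto)
  have hu: "0 \<le> h u"
  proof -
    have "(q has_integral (h u - h 0)) {0..u}" by fact
    then have "0 \<le> h u - h 0" by (rule has_integral_nonneg) (use kh(2) in \<open>auto simp: q_def\<close>)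
    then show ?thesis by (simp add: h_def Lh0)
  qed
  have "(LINT x|lborel. (1 - exp (- u * x)) * k x / x) = h u"
    using nn_integral_eq_integral[OF int] nn hu 2 by (simp add: ennreal_inj integral_nonneg)
  then have "exp (- (LINT x|lborel. (1 - exp (- u * x)) * k x / x)) = exp (\<gamma> * u) * exp (ln (Lh u))"
    by (simp add: h_def flip: exp_add)
  then show "exp (\<gamma> * u) * (LINT x|L. exp (- u * x)) = exp (- (LINT x|lborel. (1 - exp (- u * x)) * k x / x))"
    using Lpos[of u] u by (simp add: Lh_def)
qed

text \<open>An exponential Chebyshev bound: mass \<open>p\<close> below \<open>\<gamma> - e\<close>
  would make the left-hand side of \<open>le\<close> at least \<open>p * exp (e * u)\<close>, which
  is unbounded in \<open>u\<close> unless \<open>p = 0\<close>.\<close>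

lemma laplace_support:
  fixes L :: "real measure"
  assumes L: "prob_space L" "sets L = sets borel" "AE x in L. 0 \<le> x"
    and le: "\<And>u. 0 < u \<Longrightarrow> exp (\<gamma> * u) * (LINT x|L. exp (- u * x)) \<le> 1"
  shows "AE x in L. \<gamma> \<le> x"
proof -
  interpret prob_space L by (rule L)
  have [measurable_cong]: "sets L = sets borel" by (rule L)
  have "AE x in L. \<gamma> - e \<le> x" if e: "0 < e" for e
  proof -
    have b: "measure L {..<\<gamma> - e} \<le> exp (- e * u)" if u: "0 < u" for u
    proof -
      have "exp (- u * (\<gamma> - e)) * measure L {..<\<gamma> - e} = (LINT x|L. exp (- u * (\<gamma> - e)) * indicator {..<\<gamma> - e} x)"
        by simp
      also have "\<dots> \<le> (LINT x|L. exp (- u * x))"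
      proof (rule integral_mono_AE)
        show "integrable L (\<lambda>x. exp (- u * x))" by (rule laplace_integrable[OF L]) (use u in simp)
        show "AE x in L. exp (- u * (\<gamma> - e)) * indicator {..<\<gamma> - e} x \<le> exp (- u * x)"
          by (rule AE_I2) (use u in \<open>auto split: split_indicator\<close>)
      qed (auto intro!: integrable_mult_right integrable_real_indicator simp: emeasure_eq_measure)
      also have "\<dots> \<le> exp (- \<gamma> * u)" using le[OF u] by (simp add: exp_minus field_simps)
      finally have "exp (u * (\<gamma> - e)) * (exp (- u * (\<gamma> - e)) * measure L {..<\<gamma> - e}) \<le> exp (u * (\<gamma> - e)) * exp (- \<gamma> * u)"
        by (rule mult_left_mono) simp
      also have "exp (u * (\<gamma> - e)) * exp (- \<gamma> * u) = exp (- e * u)" by (simp add: algebra_simps flip: exp_add)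
      also have "exp (u * (\<gamma> - e)) * (exp (- u * (\<gamma> - e)) * measure L {..<\<gamma> - e}) = measure L {..<\<gamma> - e}"
        by (simp flip: mult.assoc exp_add)
      finally show ?thesis .
    qed
    have "((\<lambda>u. exp (- e * u)) \<longlongrightarrow> 0) at_top"
      using exp_neg_mult_tendsto_0[OF e] by (simp add: mult.commute)
    moreover have "\<forall>\<^sub>F u in at_top. measure L {..<\<gamma> - e} \<le> exp (- e * u)"
      using eventually_gt_at_top[of 0] by eventually_elim (rule b)
    ultimately have "measure L {..<\<gamma> - e} \<le> 0" by (intro tendsto_lowerbound) auto
    then have "emeasure L {..<\<gamma> - e} = 0" by (simp add: emeasure_eq_measure measure_le_0_iff)
    then have "AE x in L. x \<notin> {..<\<gamma> - e}" by (intro AE_not_in) (auto simp: null_sets_def)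
    then show ?thesis by eventually_elim simp
  qed
  then have "AE x in L. \<forall>n. \<gamma> - 1 / real (Suc n) \<le> x" by (subst AE_all_countable) simp
  then show ?thesis
  proof eventually_elim
    case (elim x)
    have "(\<lambda>n. \<gamma> - 1 / real (Suc n)) \<longlonglongrightarrow> \<gamma> - 0" by (intro tendsto_intros LIMSEQ_Suc lim_1_over_n)
    then have "(\<lambda>n. \<gamma> - 1 / real (Suc n)) \<longlonglongrightarrow> \<gamma>" by simp
    then show ?case by (rule LIMSEQ_le_const2) (use elim in auto)
  qed
qed

subsection \<open>Asymptotics of the density\<close>

text \<open>Applied with \<open>\<sigma> = 1\<close> and \<open>\<sigma> = - 1\<close>, this covers
  upper and lower bounds at once. The integral inequality makes
  \<open>\<sigma> * ((G x + a * I s) * s powr (- a))\<close> nonincreasing in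
  \<open>s\<close>.\<close>

lemma power_gronwall:
  fixes G :: "real \<Rightarrow> real"
  assumes x: "0 < x" "x \<le> z" and a: "0 \<le> a" and cont: "continuous_on {x..z} G"
    and G: "\<And>s. x \<le> s \<Longrightarrow> s \<le> z \<Longrightarrow> \<sigma> * G s \<le> \<sigma> * (G x + a * integral {x..s} (\<lambda>y. G y / y))"
  shows "\<sigma> * G z \<le> \<sigma> * (G x * (z / x) powr a)"
proof (cases "x = z")
  case False
  then have xz: "x < z" using x by simp
  define I where "I s = integral {x..s} (\<lambda>y. G y / y)" for s
  have contq: "continuous_on {x..z} (\<lambda>y. G y / y)"
    using cont x by (intro continuous_on_divide continuous_on_id) auto
  have I': "(I has_real_derivative G s / s) (at s within {x..z})" if "x \<le> s" "s \<le> z" for s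
    unfolding I_def by (rule integral_has_real_derivative[OF contq]) (use that in auto)
  have contI: "continuous_on {x..z} I"
    by (rule DERIV_continuous_on[where D="\<lambda>s. G s / s"]) (use I' in auto)
  define E where "E s = \<sigma> * ((G x + a * I s) * s powr (- a))" for s
  have "E z \<le> E x"
  proof (rule DERIV_nonpos_imp_decreasing_open[OF x(2)])
    show "continuous_on {x..z} E"
      unfolding E_def using x by (intro continuous_intros contI) auto
    fix s assume s: "x < s" "s < z"
    have "at s within {x..z} = at s" using s by (intro at_within_interior) auto
    then have "(I has_real_derivative G s / s) (at s)" using I'[of s] s by simp
    then have "(E has_real_derivative \<sigma> * ((a * (G s / s)) * s powr (- a) + (- a * s powr (- a - 1)) * (G x + a * I s))) (at s)"
      unfolding E_def using s x by (auto intro!: derivative_eq_intros simp: algebra_simps)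
    moreover have "\<sigma> * ((a * (G s / s)) * s powr (- a) + (- a * s powr (- a - 1)) * (G x + a * I s))
        = a * s powr (- a - 1) * (\<sigma> * G s - \<sigma> * (G x + a * I s))"
      using s x by (simp add: powr_diff field_simps)
    moreover have "\<dots> \<le> 0"
      using G[of s] s a by (intro mult_nonneg_nonpos) (auto simp: I_def)
    ultimately show "\<exists>y. DERIV E s :> y \<and> y \<le> 0" by metis
  qed
  then have "\<sigma> * (G x + a * I z) * z powr (- a) \<le> \<sigma> * G x * x powr (- a)"
    by (simp add: E_def I_def mult.assoc)
  then have "\<sigma> * (G x + a * I z) \<le> \<sigma> * G x * x powr (- a) / z powr (- a)"
    using x by (simp add: pos_le_divide_eq)
  also have "\<dots> = \<sigma> * (G x * (z / x) powr a)"
  proof -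
    have "(z / x) powr a = z powr a / x powr a" using x by (simp add: powr_divide)
    then show ?thesis using x by (simp add: powr_minus field_simps)
  qed
  finally show ?thesis using G[of z] x by (simp add: I_def)
qed (use x in auto)

text \<open>Regular variation of \<open>exp A\<close> at 0 with index \<open>c\<close>, read off
  from logarithmic bounds. It is applied to \<open>ln G\<close> and to \<open>- J\<close>; the bound
  \<open>e0\<close> is there because the estimates for \<open>G\<close> require
  \<open>e < c\<close>.\<close>

lemma log_increment_tendsto:
  fixes A :: "real \<Rightarrow> real"
  assumes A: "\<And>e. 0 < e \<Longrightarrow> e < e0 \<Longrightarrow> \<exists>d>0. \<forall>x z. 0 < x \<longrightarrow> x \<le> z \<longrightarrow> z < d \<longrightarrow>
      \<bar>A z - A x - c * (ln z - ln x)\<bar> \<le> e * (ln z - ln x)"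
    and e0: "0 < e0" and y: "0 < y"
  shows "((\<lambda>t. A (t * y) - A t) \<longlongrightarrow> c * ln y) (at_right 0)"
proof (rule tendstoI)
  fix r :: real assume r: "0 < r"
  \<comment> \<open>Small enough for \<open>e * \<bar>ln y\<bar> < r\<close>; the summand 1 keeps
    the quotient meaningful at \<open>y = 1\<close>.\<close>
  define e where "e = min (e0 / 2) (r / (\<bar>ln y\<bar> + 1))"
  have e: "0 < e" "e < e0" "e * \<bar>ln y\<bar> < r"
  proof -
    show "0 < e" "e < e0" using r e0 by (auto simp: e_def)
    have "e * \<bar>ln y\<bar> \<le> r / (\<bar>ln y\<bar> + 1) * \<bar>ln y\<bar>" by (rule mult_right_mono) (auto simp: e_def)
    also have "\<dots> < r" using r by (simp add: field_simps)
    finally show "e * \<bar>ln y\<bar> < r" .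
  qed
  from A[OF e(1,2)] obtain d where d: "0 < d"
    "\<And>x z. 0 < x \<Longrightarrow> x \<le> z \<Longrightarrow> z < d \<Longrightarrow> \<bar>A z - A x - c * (ln z - ln x)\<bar> \<le> e * (ln z - ln x)" by blast
  have "\<forall>\<^sub>F t in at_right 0. t \<in> {0<..<min d (d / y)}"
    by (rule eventually_at_right_real) (use d y in auto)
  then show "\<forall>\<^sub>F t in at_right 0. dist (A (t * y) - A t) (c * ln y) < r"
  proof eventually_elim
    case (elim t)
    then have t: "0 < t" "t < d" "t * y < d" using y by (auto simp: field_simps)
    have l: "ln (t * y) = ln t + ln y" using t y by (simp add: ln_mult_pos)
    have "\<bar>A (t * y) - A t - c * ln y\<bar> \<le> e * \<bar>ln y\<bar>"
    proof (cases "1 \<le> y")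
      case True
      then have "t \<le> t * y" using t by simp
      then show ?thesis using d(2)[of t "t * y"] t True l by simp
    next
      case False
      then have "t * y \<le> t" using t by simp
      then have "\<bar>A t - A (t * y) - c * (- ln y)\<bar> \<le> e * (- ln y)"
        using d(2)[of "t * y" t] t y l by simp
      moreover have "ln y \<le> 0" using False y by simp
      moreover have "A t - A (t * y) - c * (- ln y) = - (A (t * y) - A t - c * ln y)" by simp
      ultimately show ?thesis by (simp only: abs_minus abs_of_nonpos)
    qed
    then show ?case using e(3) by (simp add: dist_real_def)
  qed
qed

lemma Gamma_has_bochner_integral:
  fixes a :: real
  assumes a: "0 < a"
  shows "has_bochner_integral lborel (\<lambda>y. indicator {0<..} y * (y powr (a - 1) * exp (- y))) (Gamma a)"
proof (rule has_bochner_integral_nn_integral)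
  have "(\<integral>\<^sup>+y. ennreal (indicator {0<..} y * (y powr (a - 1) * exp (- y))) \<partial>lborel) =
      (\<integral>\<^sup>+y. ennreal (indicator {0..} y * y powr (a - 1) / exp y) \<partial>lborel)"
    by (intro nn_integral_cong) (auto simp: exp_minus divide_inverse indicator_def)
  also have "\<dots> = ennreal (Gamma a)" by (rule Gamma_conv_nn_integral_real[OF a, symmetric])
  finally show "(\<integral>\<^sup>+y. ennreal (indicator {0<..} y * (y powr (a - 1) * exp (- y))) \<partial>lborel) = ennreal (Gamma a)" .
qed (use Gamma_real_pos[OF a] in \<open>auto simp: less_imp_le\<close>)

lemma nn_integral_inverse_Icc:
  fixes a b :: real
  assumes "0 < a" "a \<le> b"
  shows "(\<integral>\<^sup>+x\<in>{a..b}. ennreal (1 / x) \<partial>lborel) = ennreal (ln b - ln a)"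
proof (rule nn_integral_FTC_Icc[where F=ln and f="\<lambda>x. 1 / x"])
  show "(ln has_real_derivative 1 / x) (at x)" if "x \<in> {a..b}" for x
    using that assms by (auto intro!: derivative_eq_intros)
qed (use assms in auto)

text \<open>The drift-free situation, instantiated with the limit law shifted by
  \<open>- \<gamma>\<close>. The assumption \<open>der\<close> is the equation D' = - kh D for the
  Laplace transform D of \<open>L\<close>. Extending \<open>k\<close> by 0 restricts convolutions
  with it to \<open>y < x\<close> automatically.\<close>

locale laplace_ode =
  fixes L :: "real measure" and k kh :: "real \<Rightarrow> real" and c :: real
  assumes L: "prob_space L" "sets L = sets borel" "AE x in L. 0 \<le> x"
    and k_meas[measurable]: "k \<in> borel_measurable borel" and k0: "\<And>x. 0 \<le> k x" "\<And>x. x \<le> 0 \<Longrightarrow> k x = 0"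
    and kh: "\<And>u. 0 < u \<Longrightarrow> (\<integral>\<^sup>+x. ennreal (exp (- u * x) * k x) \<partial>lborel) = ennreal (kh u)" "\<And>u. 0 < u \<Longrightarrow> 0 \<le> kh u"
    and der: "\<And>u. 0 < u \<Longrightarrow> (LINT x|L. x * exp (- u * x)) = kh u * (LINT x|L. exp (- u * x))"
    and k_lim: "(k \<longlongrightarrow> c) (at_right 0)" and c_pos: "0 < c"
begin

sublocale real_distribution L
  using L by (simp add: real_distribution_def real_distribution_axioms_def)

sublocale pair_sigma_finite lborel L ..

lemma k_near_0:
  assumes "0 < e"
  obtains d where "0 < d" "\<And>x. 0 < x \<Longrightarrow> x < d \<Longrightarrow> \<bar>k x - c\<bar> < e"
proof -
  have "\<forall>\<^sub>F x in at_right 0. dist (k x) c < e" by (rule tendstoD[OF k_lim assms])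
  then show thesis using that by (auto simp: eventually_at_right_field dist_real_def)
qed

text \<open>The convolution of \<open>k(x) dx\<close> with \<open>L\<close>, kept in
  \<open>ennreal\<close> because it may be infinite at some points.\<close>

definition h :: "real \<Rightarrow> ennreal" where
  "h x = (\<integral>\<^sup>+y. ennreal (k (x - y)) \<partial>L)"

lemma h_measurable[measurable]: "h \<in> borel_measurable borel"
  unfolding h_def by measurable

lemma h_neg: "h x = 0" if "x < 0"
proof -
  have "AE y in L. ennreal (k (x - y)) = 0"
    using L(3) by eventually_elim (use that k0(2) in simp)
  then show ?thesis unfolding h_def by (subst nn_integral_0_iff_AE) auto
qed

text \<open>Both sides have the Laplace transform \<open>kh(u) \<integral> e\<^sup>-\<^sup>u\<^sup>x L(dx)\<close>.\<close>

lemma size_biased_eq_convolution: "density L (\<lambda>x. ennreal x) = density lborel h"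
proof (rule laplace_transform_unique)
  have A: "(\<integral>\<^sup>+x. ennreal (exp (- u * x)) \<partial>density L (\<lambda>x. ennreal x)) = ennreal (kh u * (LINT x|L. exp (- u * x)))"
    if u: "0 < u" for u
  proof -
    have "(\<integral>\<^sup>+x. ennreal (exp (- u * x)) \<partial>density L (\<lambda>x. ennreal x)) = (\<integral>\<^sup>+x. ennreal x * ennreal (exp (- u * x)) \<partial>L)"
      by (rule nn_integral_density) measurable
    also have "\<dots> = (\<integral>\<^sup>+x. ennreal (x * exp (- u * x)) \<partial>L)"
      by (rule nn_integral_cong) (simp add: ennreal_mult'')
    also have "\<dots> = ennreal (LINT x|L. x * exp (- u * x))"
    proof (rule nn_integral_eq_integral)
      show "integrable L (\<lambda>x. x * exp (- u * x))" by (rule laplace_moment_integrable[OF L u])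
      show "AE x in L. 0 \<le> x * exp (- u * x)" using L(3) by eventually_elim simp
    qed
    finally show ?thesis by (simp only: der[OF u])
  qed
  have B: "(\<integral>\<^sup>+x. ennreal (exp (- u * x)) \<partial>density lborel h) = ennreal (kh u * (LINT x|L. exp (- u * x)))"
    if u: "0 < u" for u
  proof -
    have "(\<integral>\<^sup>+x. ennreal (exp (- u * x)) \<partial>density lborel h) = (\<integral>\<^sup>+x. h x * ennreal (exp (- u * x)) \<partial>lborel)"
      by (rule nn_integral_density) measurable
    also have "\<dots> = (\<integral>\<^sup>+x. (\<integral>\<^sup>+y. ennreal (exp (- u * x) * k (x - y)) \<partial>L) \<partial>lborel)"
    proof (rule nn_integral_cong)
      fix x
      show "h x * ennreal (exp (- u * x)) = (\<integral>\<^sup>+y. ennreal (exp (- u * x) * k (x - y)) \<partial>L)"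
        unfolding h_def by (subst nn_integral_multc[symmetric]) (auto intro!: nn_integral_cong simp: ennreal_mult k0 mult.commute)
    qed
    also have "\<dots> = (\<integral>\<^sup>+y. (\<integral>\<^sup>+x. ennreal (exp (- u * x) * k (x - y)) \<partial>lborel) \<partial>L)"
      by (rule Fubini'[symmetric]) measurable
    also have "\<dots> = (\<integral>\<^sup>+y. ennreal (kh u * exp (- u * y)) \<partial>L)"
    proof (rule nn_integral_cong)
      fix y
      have "(\<integral>\<^sup>+x. ennreal (exp (- u * x) * k (x - y)) \<partial>lborel) =
        ennreal \<bar>1\<bar> * (\<integral>\<^sup>+x. ennreal (exp (- u * (y + 1 * x)) * k (y + 1 * x - y)) \<partial>lborel)"
        by (rule nn_integral_real_affine) auto
      also have "\<dots> = (\<integral>\<^sup>+x. ennreal (exp (- u * y)) * ennreal (exp (- u * x) * k x) \<partial>lborel)"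
      proof (simp only: abs_one ennreal_1 mult_1, rule nn_integral_cong)
        fix x
        have "exp (- u * (y + x)) = exp (- u * y) * exp (- u * x)" by (simp add: algebra_simps flip: exp_add)
        then show "ennreal (exp (- u * (y + x)) * k (y + x - y)) = ennreal (exp (- u * y)) * ennreal (exp (- u * x) * k x)"
          using k0(1)[of x] by (simp add: mult.assoc flip: ennreal_mult)
      qed
      also have "\<dots> = ennreal (exp (- u * y)) * (\<integral>\<^sup>+x. ennreal (exp (- u * x) * k x) \<partial>lborel)"
        by (rule nn_integral_cmult) measurable
      also have "\<dots> = ennreal (kh u * exp (- u * y))"
        unfolding kh(1)[OF u] using kh(2)[OF u] by (simp add: mult.commute flip: ennreal_mult)
      finally show "(\<integral>\<^sup>+x. ennreal (exp (- u * x) * k (x - y)) \<partial>lborel) = ennreal (kh u * exp (- u * y))" .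
    qed
    also have "\<dots> = ennreal (LINT y|L. kh u * exp (- u * y))"
      using laplace_integrable[OF L, of u] u kh(2)[OF u] by (intro nn_integral_eq_integral) auto
    finally show ?thesis by simp
  qed
  show "(\<integral>\<^sup>+x. ennreal (exp (- real n * x)) \<partial>density L (\<lambda>x. ennreal x)) = (\<integral>\<^sup>+x. ennreal (exp (- real n * x)) \<partial>density lborel h)"
    if "1 \<le> n" for n
    by (subst A, use that in simp, subst B, use that in simp, rule refl)
  show "(\<integral>\<^sup>+x. ennreal (exp (- x)) \<partial>density L (\<lambda>x. ennreal x)) < \<infinity>" using A[of 1] by simp
  show "AE x in density L (\<lambda>x. ennreal x). 0 \<le> x" using L(3) by (subst AE_density) auto
  show "AE x in density lborel h. 0 \<le> x"
  proof (subst AE_density, measurable, rule AE_I2, rule impI)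
    fix x assume "0 < h x"
    then show "0 \<le> x" using h_neg[of x] by (cases "x < 0") auto
  qed
qed simp_all

lemma nn_integral_size_biased:
  assumes [measurable]: "f \<in> borel_measurable borel"
  shows "(\<integral>\<^sup>+x. ennreal x * f x \<partial>L) = (\<integral>\<^sup>+x. h x * f x \<partial>lborel)"
  using size_biased_eq_convolution nn_integral_density[of "\<lambda>x. ennreal x" L f] nn_integral_density[of h lborel f]
  by simp

text \<open>Dividing the size-biased identity by \<open>x\<close> recovers \<open>L\<close>, except
  for a possible atom at 0, which the factor \<open>x\<close> has erased.\<close>

lemma emeasure_pos_part:
  assumes [measurable]: "A \<in> sets borel"
  shows "emeasure L (A \<inter> {0<..}) = (\<integral>\<^sup>+x\<in>A. h x * (ennreal (1 / x) * indicator {0<..} x) \<partial>lborel)"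
proof -
  have "emeasure L (A \<inter> {0<..}) = (\<integral>\<^sup>+x. indicator (A \<inter> {0<..}) x \<partial>L)" by simp
  also have "\<dots> = (\<integral>\<^sup>+x. ennreal x * (ennreal (1 / x) * indicator (A \<inter> {0<..}) x) \<partial>L)"
    by (intro nn_integral_cong) (auto split: split_indicator simp flip: ennreal_mult mult.assoc)
  also have "\<dots> = (\<integral>\<^sup>+x. h x * (ennreal (1 / x) * indicator (A \<inter> {0<..}) x) \<partial>lborel)"
    by (rule nn_integral_size_biased) measurable
  also have "\<dots> = (\<integral>\<^sup>+x\<in>A. h x * (ennreal (1 / x) * indicator {0<..} x) \<partial>lborel)"
    by (intro nn_integral_cong) (auto split: split_indicator)
  finally show ?thesis .
qed

text \<open>An atom of mass \<open>p\<close> at \<open>0\<close> would give \<open>L\<close> at least the density \<open>p k(x) / x\<close>, which is not integrable at \<open>0\<close>.\<close>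

lemma no_atom_0: "emeasure L {0} = 0"
proof (rule ccontr)
  assume "emeasure L {0} \<noteq> 0"
  define p where "p = measure L {0}"
  have p: "0 < p" using \<open>emeasure L {0} \<noteq> 0\<close> by (simp add: p_def emeasure_eq_measure zero_less_measure_iff)
  obtain d where d: "0 < d" "\<And>x. 0 < x \<Longrightarrow> x < d \<Longrightarrow> \<bar>k x - c\<bar> < c / 2"
    using k_near_0[of "c / 2"] c_pos by auto
  define C where "C = p * (c / 2)"
  have C: "0 < C" using p c_pos by (simp add: C_def)
  define b where "b = d / 2"
  \<comment> \<open>Chosen so that \<open>1 / x\<close> integrates over \<open>[a, b]\<close> to
    \<open>2 / C\<close>; the density bound \<open>C / x\<close> then yields mass 2.\<close>
  define a where "a = b * exp (- (2 / C))"
  have ab: "0 < a" "a \<le> b" "b < d" using d C by (auto simp: a_def b_def)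
  have "ln a = ln b + - (2 / C)" unfolding a_def using d(1) by (subst ln_mult_pos) (auto simp: b_def)
  then have "ln b - ln a = 2 / C" by simp
  then have "ennreal 2 = ennreal C * ennreal (ln b - ln a)" using C by (simp flip: ennreal_mult)
  also have "\<dots> = (\<integral>\<^sup>+x. ennreal C * (ennreal (1 / x) * indicator {a..b} x) \<partial>lborel)"
    using nn_integral_inverse_Icc[OF ab(1,2)] by (subst nn_integral_cmult) auto
  also have "\<dots> \<le> (\<integral>\<^sup>+x\<in>{a..b}. h x * (ennreal (1 / x) * indicator {0<..} x) \<partial>lborel)"
  proof (rule nn_integral_mono)
    fix x
    show "ennreal C * (ennreal (1 / x) * indicator {a..b} x) \<le> h x * (ennreal (1 / x) * indicator {0<..} x) * indicator {a..b} x"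
    proof (cases "x \<in> {a..b}")
      case True
      have "ennreal C \<le> (\<integral>\<^sup>+y. ennreal (k x) * indicator {0} y \<partial>L)"
      proof -
        have "\<bar>k x - c\<bar> < c / 2" by (rule d(2)) (use True ab in auto)
        then have "c / 2 \<le> k x" by linarith
        then have "C \<le> k x * p" using p by (simp add: C_def mult.commute mult_right_mono)
        then show ?thesis using k0(1)[of x] by (simp add: nn_integral_cmult_indicator emeasure_eq_measure p_def ennreal_leI flip: ennreal_mult)
      qed
      also have "\<dots> \<le> h x" unfolding h_def by (intro nn_integral_mono) (auto split: split_indicator)
      finally show ?thesis using True ab by (simp add: mult_right_mono)
    qed simp
  qed
  also have "\<dots> = emeasure L ({a..b} \<inter> {0<..})" by (rule emeasure_pos_part[symmetric]) simp
  also have "\<dots> \<le> ennreal 1" by (simp add: emeasure_eq_measure)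
  finally show False by simp
qed

text \<open>This version of the density is tied to \<open>h\<close> at every point, which makes a
  pointwise asymptotic statement possible. Where \<open>h\<close> is infinite the value is 0; close
  to 0 this does not occur, by the estimate \<open>up\<close> inside
  \<open>f0_bounds\<close>.\<close>

definition f0 :: "real \<Rightarrow> real" where
  "f0 x = (if 0 < x then enn2real (h x) / x else 0)"

lemma f0_measurable[measurable]: "f0 \<in> borel_measurable borel"
  unfolding f0_def by measurable

lemma f0_nonneg: "0 \<le> f0 x" by (simp add: f0_def)

lemma L_density: "L = density lborel (\<lambda>x. ennreal (f0 x))"
proof (rule measure_eqI)
  fix A assume "A \<in> sets L"
  then have A[measurable]: "A \<in> sets borel" by simp
  have fin: "AE x in lborel. 0 < x \<longrightarrow> h x < \<infinity>"
  proof -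
    have "(\<integral>\<^sup>+x. h x * (ennreal (1 / x) * indicator {0<..} x) \<partial>lborel) = emeasure L (UNIV \<inter> {0<..})"
      by (subst emeasure_pos_part) auto
    then have "AE x in lborel. h x * (ennreal (1 / x) * indicator {0<..} x) \<noteq> \<infinity>"
      by (intro nn_integral_PInf_AE) (auto simp: emeasure_eq_measure)
    then show ?thesis by eventually_elim (auto simp: ennreal_mult_eq_top_iff less_top)
  qed
  have "emeasure L (A - {0<..}) = 0"
  proof -
    have "AE x in L. x \<notin> {0}" using no_atom_0 by (intro AE_not_in) (auto simp: null_sets_def)
    with L(3) have "AE x in L. x \<notin> A - {0<..}" by eventually_elim auto
    then show ?thesis by (subst (asm) AE_iff_null_sets[symmetric]) (auto simp: null_sets_def)
  qed
  moreover have "emeasure L A = emeasure L (A \<inter> {0<..}) + emeasure L (A - {0<..})"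
    by (subst plus_emeasure) (auto intro: arg_cong[where f="emeasure L"])
  ultimately have "emeasure L A = emeasure L (A \<inter> {0<..})" by simp
  also have "\<dots> = (\<integral>\<^sup>+x\<in>A. h x * (ennreal (1 / x) * indicator {0<..} x) \<partial>lborel)" by (rule emeasure_pos_part) simp
  also have "\<dots> = (\<integral>\<^sup>+x\<in>A. ennreal (f0 x) \<partial>lborel)"
  proof (rule nn_integral_cong_AE)
    show "AE x in lborel. h x * (ennreal (1 / x) * indicator {0<..} x) * indicator A x = ennreal (f0 x) * indicator A x"
      using fin
    proof eventually_elim
      case (elim x)
      show ?case
      proof (cases "0 < x")
        case True
        then have "h x = ennreal (enn2real (h x))" using elim by simp
        then have "h x * ennreal (1 / x) = ennreal (enn2real (h x)) * ennreal (1 / x)" by simp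
        also have "\<dots> = ennreal (f0 x)" using True by (simp add: f0_def flip: ennreal_mult)
        finally show ?thesis using True by simp
      qed (simp add: f0_def)
    qed
  qed
  also have "\<dots> = emeasure (density lborel (\<lambda>x. ennreal (f0 x))) A" by (simp add: emeasure_density)
  finally show "emeasure L A = emeasure (density lborel (\<lambda>x. ennreal (f0 x))) A" .
qed simp

lemma no_atoms: "emeasure L {x} = 0"
proof -
  have "emeasure L {x} = (\<integral>\<^sup>+y\<in>{x}. ennreal (f0 y) \<partial>lborel)"
    by (subst L_density) (simp add: emeasure_density)
  also have "\<dots> = (\<integral>\<^sup>+(y::real). 0 \<partial>lborel)"
    by (rule nn_integral_cong_AE) (use AE_lborel_singleton[of x] in eventually_elim, simp)
  finally show ?thesis by simp
qed

section \<open>Regular variation of the distribution function\<close>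

abbreviation G :: "real \<Rightarrow> real" where "G \<equiv> cdf L"

lemma G_nonneg: "0 \<le> G x" and G_le_1: "G x \<le> 1" by (simp_all add: cdf_def)

lemma G_cont: "isCont G x"
  using no_atoms[of x] by (simp add: isCont_cdf emeasure_eq_measure)

lemma G_measurable[measurable]: "G \<in> borel_measurable borel"
  by (intro borel_measurable_continuous_onI continuous_at_imp_continuous_on ballI G_cont)

text \<open>\<open>x * f0 x\<close> integrates \<open>k (x - y)\<close> over \<open>y < x\<close>,
  and there \<open>x - y\<close> lies in \<open>(0, d)\<close>. The lower bound uses that
  \<open>x\<close> is no atom: \<open>k 0 = 0\<close>, while \<open>G x\<close> counts the point
  \<open>x\<close>.\<close>

lemma f0_bounds:
  assumes d: "\<And>y. 0 < y \<Longrightarrow> y < d \<Longrightarrow> \<bar>k y - c\<bar> < e" and e: "0 < e" "e < c" and x: "0 < x" "x < d"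
  shows "(c - e) * G x \<le> x * f0 x" "x * f0 x \<le> (c + e) * G x"
proof -
  have up: "h x \<le> ennreal ((c + e) * G x)"
  proof -
    have "h x \<le> (\<integral>\<^sup>+y. ennreal (c + e) * indicator {..x} y \<partial>L)"
      unfolding h_def
    proof (rule nn_integral_mono_AE)
      show "AE y in L. ennreal (k (x - y)) \<le> ennreal (c + e) * indicator {..x} y" using L(3)
      proof eventually_elim
        case (elim y)
        show ?case
        proof (cases "y < x")
          case True
          then show ?thesis using d[of "x - y"] elim x by (auto intro!: ennreal_leI)
        qed (simp add: k0)
      qed
    qed
    also have "\<dots> = ennreal ((c + e) * G x)"
      using c_pos e by (simp add: nn_integral_cmult_indicator emeasure_eq_measure cdf_def ennreal_mult)
    finally show ?thesis .
  qed
  have lo: "ennreal ((c - e) * G x) \<le> h x"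
  proof -
    have "ennreal ((c - e) * G x) = (\<integral>\<^sup>+y. ennreal (c - e) * indicator {..x} y \<partial>L)"
      using e by (simp add: nn_integral_cmult_indicator emeasure_eq_measure cdf_def ennreal_mult)
    also have "\<dots> \<le> h x"
      unfolding h_def
    proof (rule nn_integral_mono_AE)
      have "AE y in L. y \<notin> {x}" using no_atoms[of x] by (intro AE_not_in) (auto simp: null_sets_def)
      with L(3) show "AE y in L. ennreal (c - e) * indicator {..x} y \<le> ennreal (k (x - y))"
      proof eventually_elim
        case (elim y)
        show ?case
        proof (cases "y < x")
          case True
          then have "c - e \<le> k (x - y)" using d[of "x - y"] elim x by auto
          then show ?thesis using True by (simp add: ennreal_leI)
        qed (use elim in simp)
      qed
    qed
    finally show ?thesis .
  qed
  have eq: "x * f0 x = enn2real (h x)" using x by (simp add: f0_def)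
  have cG: "0 \<le> (c + e) * G x" using c_pos e G_nonneg[of x] by simp
  show "x * f0 x \<le> (c + e) * G x"
    unfolding eq using enn2real_mono[OF up] cG by simp
  have "enn2real (ennreal ((c - e) * G x)) \<le> enn2real (h x)"
    by (rule enn2real_mono[OF lo]) (use up in \<open>auto intro: le_less_trans\<close>)
  then show "(c - e) * G x \<le> x * f0 x"
    unfolding eq using e G_nonneg[of x] by simp
qed

text \<open>Integrating the bounds on \<open>f0\<close> turns them into the integral inequalities
  for \<open>G\<close> to which \<open>power_gronwall\<close> applies.\<close>

lemma G_increment:
  assumes d: "\<And>y. 0 < y \<Longrightarrow> y < d \<Longrightarrow> \<bar>k y - c\<bar> < e" and e: "0 < e" "e < c" and x: "0 < x" "x \<le> z" "z < d"
  shows "G z \<le> G x + (c + e) * integral {x..z} (\<lambda>y. G y / y)"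
    and "G x + (c - e) * integral {x..z} (\<lambda>y. G y / y) \<le> G z"
proof -
  define I where "I = integral {x..z} (\<lambda>y. G y / y)"
  have contq: "continuous_on {x..z} (\<lambda>y. G y / y)"
    using x by (intro continuous_on_divide continuous_on_id continuous_at_imp_continuous_on) (auto intro: G_cont)
  have hI: "((\<lambda>y. G y / y) has_integral I) {x..z}"
    unfolding I_def by (rule integrable_integral[OF integrable_continuous_real[OF contq]])
  have I0: "0 \<le> I" by (rule has_integral_nonneg[OF hI]) (use x G_nonneg in auto)
  have nI: "(\<integral>\<^sup>+y. ennreal (G y / y) * indicator {x..z} y \<partial>lborel) = ennreal I"
    by (rule nn_integral_has_integral_lebesgue'[OF _ hI]) (use x G_nonneg in auto)
  have cI: "(\<integral>\<^sup>+y. ennreal a * (ennreal (G y / y) * indicator {x..z} y) \<partial>lborel) = ennreal (a * I)" if "0 \<le> a" for a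
    using that by (subst nn_integral_cmult) (auto simp: nI ennreal_mult')
  have mG: "emeasure L {x..z} = ennreal (G z - G x)"
  proof -
    have "emeasure L {x..z} = emeasure L {x} + emeasure L {x<..z}"
      by (subst plus_emeasure) (use x in \<open>auto intro!: arg_cong[where f="emeasure L"]\<close>)
    also have "\<dots> = ennreal (measure L {x<..z})" using no_atoms[of x] by (simp add: emeasure_eq_measure)
    also have "measure L {x<..z} = G z - G x" using cdf_diff_eq[of x z] x by (cases "x = z") auto
    finally show ?thesis .
  qed
  have dens: "emeasure L {x..z} = (\<integral>\<^sup>+y\<in>{x..z}. ennreal (f0 y) \<partial>lborel)"
    by (subst L_density) (simp add: emeasure_density)
  have GG: "G x \<le> G z" using cdf_nondecreasing x by auto
  have "ennreal (G z - G x) \<le> ennreal ((c + e) * I)"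
  proof -
    have "(\<integral>\<^sup>+y\<in>{x..z}. ennreal (f0 y) \<partial>lborel) \<le> (\<integral>\<^sup>+y. ennreal (c + e) * (ennreal (G y / y) * indicator {x..z} y) \<partial>lborel)"
    proof (rule nn_integral_mono)
      fix y
      show "ennreal (f0 y) * indicator {x..z} y \<le> ennreal (c + e) * (ennreal (G y / y) * indicator {x..z} y)"
      proof (cases "y \<in> {x..z}")
        case True
        then have "f0 y \<le> (c + e) * (G y / y)" using f0_bounds(2)[where d=d and e=e and x=y] d e x by (simp add: field_simps)
        moreover have "ennreal ((c + e) * (G y / y)) = ennreal (c + e) * ennreal (G y / y)"
          by (rule ennreal_mult) (use True c_pos e x G_nonneg[of y] in auto)
        ultimately show ?thesis using True by (metis ennreal_leI indicator_simps(1) mult.right_neutral)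
      qed simp
    qed
    then show ?thesis using mG dens cI[of "c + e"] c_pos e by simp
  qed
  then show "G z \<le> G x + (c + e) * integral {x..z} (\<lambda>y. G y / y)"
    using I0 c_pos e by (simp add: I_def)
  have "ennreal ((c - e) * I) \<le> ennreal (G z - G x)"
  proof -
    have "(\<integral>\<^sup>+y. ennreal (c - e) * (ennreal (G y / y) * indicator {x..z} y) \<partial>lborel) \<le> (\<integral>\<^sup>+y\<in>{x..z}. ennreal (f0 y) \<partial>lborel)"
    proof (rule nn_integral_mono)
      fix y
      show "ennreal (c - e) * (ennreal (G y / y) * indicator {x..z} y) \<le> ennreal (f0 y) * indicator {x..z} y"
      proof (cases "y \<in> {x..z}")
        case True
        then have "(c - e) * (G y / y) \<le> f0 y" using f0_bounds(1)[where d=d and e=e and x=y] d e x by (simp add: field_simps)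
        moreover have "ennreal ((c - e) * (G y / y)) = ennreal (c - e) * ennreal (G y / y)"
          by (rule ennreal_mult) (use True e x G_nonneg[of y] in auto)
        ultimately show ?thesis using True by (metis ennreal_leI indicator_simps(1) mult.right_neutral)
      qed simp
    qed
    then show ?thesis using mG dens cI[of "c - e"] e by simp
  qed
  then show "G x + (c - e) * integral {x..z} (\<lambda>y. G y / y) \<le> G z"
    using GG by (simp add: I_def)
qed

lemma G_power_bounds:
  assumes d: "\<And>y. 0 < y \<Longrightarrow> y < d \<Longrightarrow> \<bar>k y - c\<bar> < e" and e: "0 < e" "e < c" and x: "0 < x" "x \<le> z" "z < d"
  shows "G z \<le> G x * (z / x) powr (c + e)" "G x * (z / x) powr (c - e) \<le> G z"
proof -
  have cont: "continuous_on {x..z} G" by (intro continuous_at_imp_continuous_on ballI G_cont)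
  have inc: "G s \<le> G x + (c + e) * integral {x..s} (\<lambda>y. G y / y)" "G x + (c - e) * integral {x..s} (\<lambda>y. G y / y) \<le> G s"
    if "x \<le> s" "s \<le> z" for s
    using G_increment[where d=d and e=e and x=x and z=s] d e x that by auto
  show "G z \<le> G x * (z / x) powr (c + e)"
    using power_gronwall[OF x(1,2) _ cont, of "c + e" 1] inc(1) c_pos e by simp
  show "G x * (z / x) powr (c - e) \<le> G z"
  proof -
    \<comment> \<open>The lower bound is the same Gronwall lemma with
      \<open>\<sigma> = - 1\<close>.\<close>
    have "(-1) * G z \<le> (-1) * (G x * (z / x) powr (c - e))"
    proof (rule power_gronwall[OF x(1,2) _ cont])
      fix s assume "x \<le> s" "s \<le> z"
      then show "(-1) * G s \<le> (-1) * (G x + (c - e) * integral {x..s} (\<lambda>y. G y / y))" using inc(2)[of s] by simp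
    qed (use e in simp)
    then show ?thesis by simp
  qed
qed

text \<open>If \<open>L\<close> had no mass near \<open>0\<close>, then \<open>kh(u)\<close>, the ratio of the Laplace transforms of \<open>x L(dx)\<close>
  and \<open>L\<close>, would not tend to \<open>0\<close>.\<close>

lemma G_pos:
  assumes x: "0 < x"
  shows "0 < G x"
proof (rule ccontr)
  assume "\<not> 0 < G x"
  then have Gx: "G x = 0" using G_nonneg[of x] by simp
  have L_ge: "AE y in L. x < y"
  proof -
    have "emeasure L {..x} = 0" using Gx by (simp add: emeasure_eq_measure cdf_def)
    then have "AE y in L. y \<notin> {..x}" by (intro AE_not_in) (auto simp: null_sets_def)
    then show ?thesis by eventually_elim simp
  qed
  have le: "x \<le> kh u" if u: "0 < u" for u
  proof -
    have int: "integrable L (\<lambda>y. exp (- u * y))" by (rule laplace_integrable[OF L]) (use u in simp)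
    have int2: "integrable L (\<lambda>y. y * exp (- u * y))" by (rule laplace_moment_integrable[OF L u])
    have "(LINT y|L. x * exp (- u * y)) \<le> (LINT y|L. y * exp (- u * y))"
      by (rule integral_mono_AE) (use int int2 L_ge in auto)
    then have "x * (LINT y|L. exp (- u * y)) \<le> kh u * (LINT y|L. exp (- u * y))"
      using der[OF u] by simp
    then show ?thesis using laplace_pos[OF L, of u] u by simp
  qed
  have ki: "integrable lborel (\<lambda>y. exp (- 1 * y) * k y)"
    by (rule integrableI_nonneg) (use kh(1)[of 1] k0 in auto)
  have "((\<lambda>u. LINT y|lborel. exp (- u * y) * k y) \<longlongrightarrow> (LINT y::real|lborel. 0)) at_top"
  proof (rule integral_dominated_convergence_at_top[OF _ _ ki])
    show "AE y in lborel. ((\<lambda>u. exp (- u * y) * k y) \<longlongrightarrow> 0) at_top"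
    proof (rule AE_I2)
      fix y :: real
      show "((\<lambda>u. exp (- u * y) * k y) \<longlongrightarrow> 0) at_top"
      proof (cases "0 < y")
        case True
        have "((\<lambda>u. exp (- u * y)) \<longlongrightarrow> 0) at_top" by (rule exp_neg_mult_tendsto_0[OF True])
        then show ?thesis by (rule tendsto_mult_left_zero)
      qed (simp add: k0)
    qed
    show "\<forall>\<^sub>F u in at_top. AE y in lborel. norm (exp (- u * y) * k y) \<le> exp (- 1 * y) * k y"
      using eventually_ge_at_top[of 1]
    proof eventually_elim
      case (elim u)
      have "norm (exp (- u * y) * k y) \<le> exp (- 1 * y) * k y" for y
        using elim k0(1)[of y] k0(2)[of y] by (cases "0 < y") (auto simp: abs_mult intro!: mult_right_mono)
      then show ?case by simp
    qed
  qed simp_all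
  moreover have "\<forall>\<^sub>F u in at_top. x \<le> (LINT y|lborel. exp (- u * y) * k y)"
    using eventually_gt_at_top[of 0]
  proof eventually_elim
    case (elim u)
    have "(LINT y|lborel. exp (- u * y) * k y) = kh u"
      by (subst integral_eq_nn_integral) (use kh(1)[OF elim] kh(2)[OF elim] k0 in auto)
    then show ?case using le[OF elim] by simp
  qed
  ultimately have "x \<le> (LINT y::real|lborel. 0)" by (intro tendsto_lowerbound) auto
  then show False using x by simp
qed

lemma G_log_increment:
  assumes e: "0 < e" "e < c"
  shows "\<exists>d>0. \<forall>x z. 0 < x \<longrightarrow> x \<le> z \<longrightarrow> z < d \<longrightarrow>
      \<bar>ln (G z) - ln (G x) - c * (ln z - ln x)\<bar> \<le> e * (ln z - ln x)"
proof -
  obtain d where d: "0 < d" "\<And>x. 0 < x \<Longrightarrow> x < d \<Longrightarrow> \<bar>k x - c\<bar> < e" using k_near_0[OF e(1)] by blast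
  have "\<bar>ln (G z) - ln (G x) - c * (ln z - ln x)\<bar> \<le> e * (ln z - ln x)" if x: "0 < x" "x \<le> z" "z < d" for x z
  proof -
    have z: "0 < z" using x by simp
    have "ln (G z) \<le> ln (G x * (z / x) powr (c + e))"
      using G_power_bounds(1)[OF d(2) e x] G_pos[OF x(1)] G_pos[OF z] x z by (subst ln_le_cancel_iff) auto
    then have 1: "ln (G z) \<le> ln (G x) + (c + e) * (ln z - ln x)"
      using G_pos[OF x(1)] x z by (simp add: ln_mult_pos ln_powr ln_div)
    have "ln (G x * (z / x) powr (c - e)) \<le> ln (G z)"
      using G_power_bounds(2)[OF d(2) e x] G_pos[OF x(1)] G_pos[OF z] x z by (subst ln_le_cancel_iff) auto
    then have 2: "ln (G x) + (c - e) * (ln z - ln x) \<le> ln (G z)"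
      using G_pos[OF x(1)] x z by (simp add: ln_mult_pos ln_powr ln_div)
    show ?thesis using 1 2 by (simp add: abs_le_iff algebra_simps)
  qed
  then show ?thesis using d(1) by blast
qed

end

lemma has_bochner_integral_inverse_Ioc:
  fixes a b :: real
  assumes "0 < a" "a \<le> b"
  shows "has_bochner_integral lborel (\<lambda>x. indicator {a<..b} x * (1 / x)) (ln b - ln a)"
proof (rule has_bochner_integral_nn_integral)
  have "(\<integral>\<^sup>+x. ennreal (indicator {a<..b} x * (1 / x)) \<partial>lborel) = (\<integral>\<^sup>+x\<in>{a..b}. ennreal (1 / x) \<partial>lborel)"
    by (rule nn_integral_cong_AE) (use AE_lborel_singleton[of a] in eventually_elim, auto split: split_indicator)
  then show "(\<integral>\<^sup>+x. ennreal (indicator {a<..b} x * (1 / x)) \<partial>lborel) = ennreal (ln b - ln a)"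
    by (simp only: nn_integral_inverse_Icc[OF assms])
  show "AE x in lborel. 0 \<le> indicator {a<..b} x * (1 / x)"
    by (rule AE_I2) (use assms in \<open>auto split: split_indicator\<close>)
qed (use assms in auto)

section \<open>The Levy-Khintchine exponent near 0 and Karamata's theorem\<close>

context laplace_ode
begin

lemma levy_khintchine:
  assumes "0 < u"
  shows "integrable lborel (\<lambda>x. (1 - exp (- u * x)) * k x / x)"
    and "(LINT x|L. exp (- u * x)) = exp (- (LINT x|lborel. (1 - exp (- u * x)) * k x / x))"
  using levy_khintchine_of_derivative[OF L k_meas k0 kh, of 0 u] der assms by auto

text \<open>On \<open>x > t\<close> the factor \<open>1 - exp (- x)\<close> is bounded away from 0,
  so the Levy-Khintchine integrand at \<open>u = 1\<close> dominates. In particular the integral of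
  \<open>k x / x\<close> from 1 to infinity in \<kappa> converges.\<close>

lemma k_over_id_integrable:
  assumes t: "0 < t"
  shows "integrable lborel (\<lambda>x. indicator {t<..} x * (k x / x))"
proof (rule Bochner_Integration.integrable_bound)
  define a where "a = 1 / (1 - exp (- t))"
  have a: "0 < a" using t by (simp add: a_def)
  show "integrable lborel (\<lambda>x. a * ((1 - exp (- 1 * x)) * k x / x))"
    by (rule integrable_mult_right[OF levy_khintchine(1)]) simp
  show "AE x in lborel. norm (indicator {t<..} x * (k x / x)) \<le> norm (a * ((1 - exp (- 1 * x)) * k x / x))"
  proof (rule AE_I2)
    fix x
    show "norm (indicator {t<..} x * (k x / x)) \<le> norm (a * ((1 - exp (- 1 * x)) * k x / x))"
    proof (cases "t < x")
      case True
      have q: "0 \<le> k x / x" using k0(1)[of x] True t by simp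
      have "1 = a * (1 - exp (- t))" using t by (simp add: a_def)
      also have "\<dots> \<le> a * (1 - exp (- x))" using True a by (intro mult_left_mono) auto
      finally have "1 * (k x / x) \<le> (a * (1 - exp (- x))) * (k x / x)" by (rule mult_right_mono[OF _ q])
      moreover have "norm (a * ((1 - exp (- 1 * x)) * k x / x)) = (a * (1 - exp (- x))) * (k x / x)"
        using a q True t k0(1)[of x] by (simp add: abs_mult)
      moreover have "norm (indicator {t<..} x * (k x / x)) = k x / x" using True t k0(1)[of x] by simp
      ultimately show ?thesis by simp
    qed simp
  qed
qed measurable

lemma k_over_id_integrable_subset:
  assumes t: "0 < t" and A[measurable]: "A \<in> sets borel" "A \<subseteq> {t<..}"
  shows "integrable lborel (\<lambda>x. indicator A x * (k x / x))"
proof (rule Bochner_Integration.integrable_bound[OF k_over_id_integrable[OF t]])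
  show "AE x in lborel. norm (indicator A x * (k x / x)) \<le> norm (indicator {t<..} x * (k x / x))"
    by (rule AE_I2) (use A(2) in \<open>auto split: split_indicator\<close>)
qed measurable

text \<open>The part of the exponent of \<open>K\<close> that involves \<open>k\<close>: for
  \<open>0 < t \<le> 1\<close>, \<open>exp (- J t)\<close> equals
  \<open>t powr c * K t\<close>.\<close>

definition J :: "real \<Rightarrow> real" where
  "J t = (LINT x|lborel. indicator {t<..1} x * (k x / x))"

lemma J_diff:
  assumes "0 < x" "x \<le> z" "z \<le> 1"
  shows "J x - J z = (LINT y|lborel. indicator {x<..z} y * (k y / y))"
proof -
  have i: "integrable lborel (\<lambda>y. indicator {x<..z} y * (k y / y))" "integrable lborel (\<lambda>y. indicator {z<..1} y * (k y / y))"
    by (rule k_over_id_integrable_subset[OF assms(1)]; use assms in auto)+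
  have "J x = (LINT y|lborel. indicator {x<..z} y * (k y / y) + indicator {z<..1} y * (k y / y))"
    unfolding J_def by (rule Bochner_Integration.integral_cong) (use assms in \<open>auto split: split_indicator\<close>)
  also have "\<dots> = (LINT y|lborel. indicator {x<..z} y * (k y / y)) + J z"
    unfolding J_def by (rule Bochner_Integration.integral_add[OF i])
  finally show ?thesis by simp
qed

lemma J_log_increment:
  assumes e: "0 < e"
  shows "\<exists>d>0. \<forall>x z. 0 < x \<longrightarrow> x \<le> z \<longrightarrow> z < d \<longrightarrow>
      \<bar>- J z - - J x - c * (ln z - ln x)\<bar> \<le> e * (ln z - ln x)"
proof -
  obtain d where d: "0 < d" "\<And>x. 0 < x \<Longrightarrow> x < d \<Longrightarrow> \<bar>k x - c\<bar> < e" using k_near_0[OF e] by blast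
  have "\<bar>- J z - - J x - c * (ln z - ln x)\<bar> \<le> e * (ln z - ln x)" if x: "0 < x" "x \<le> z" "z < min d 1" for x z
  proof -
    have hb: "has_bochner_integral lborel (\<lambda>y. a * (indicator {x<..z} y * (1 / y))) (a * (ln z - ln x))" for a
      by (intro has_bochner_integral_mult_right has_bochner_integral_inverse_Ioc x)
    have ik: "integrable lborel (\<lambda>y. indicator {x<..z} y * (k y / y))"
      by (rule k_over_id_integrable_subset[OF x(1)]) auto
    have kb: "c - e \<le> k y \<and> k y \<le> c + e" if "y \<in> {x<..z}" for y using d(2)[of y] that x by (auto simp: abs_less_iff)
    have "(LINT y|lborel. indicator {x<..z} y * (k y / y)) \<le> (LINT y|lborel. (c + e) * (indicator {x<..z} y * (1 / y)))"
    proof (rule integral_mono[OF ik])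
      fix y show "indicator {x<..z} y * (k y / y) \<le> (c + e) * (indicator {x<..z} y * (1 / y))"
        using kb[of y] x by (auto split: split_indicator intro!: divide_right_mono)
    qed (use hb in \<open>auto simp: has_bochner_integral_iff\<close>)
    then have 1: "J x - J z \<le> (c + e) * (ln z - ln x)"
      using J_diff[of x z] x hb[of "c + e"] by (simp add: has_bochner_integral_iff)
    have "(LINT y|lborel. (c - e) * (indicator {x<..z} y * (1 / y))) \<le> (LINT y|lborel. indicator {x<..z} y * (k y / y))"
    proof (rule integral_mono[OF _ ik])
      fix y show "(c - e) * (indicator {x<..z} y * (1 / y)) \<le> indicator {x<..z} y * (k y / y)"
        using kb[of y] x by (auto split: split_indicator intro!: divide_right_mono)
    qed (use hb in \<open>auto simp: has_bochner_integral_iff\<close>)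
    then have 2: "(c - e) * (ln z - ln x) \<le> J x - J z"
      using J_diff[of x z] x hb[of "c - e"] by (simp add: has_bochner_integral_iff)
    show ?thesis using 1 2 by (simp add: abs_le_iff algebra_simps)
  qed
  then show ?thesis using d(1) by (intro exI[of _ "min d 1"]) auto
qed

text \<open>Write \<open>exp (- x / t)\<close> as the integral of \<open>exp (- y)\<close> over
  \<open>y \<ge> x / t\<close> and apply Tonelli. In this form \<open>t\<close> enters only through
  \<open>G (t * y)\<close>, which can be compared with \<open>G t\<close>.\<close>

lemma laplace_eq_G:
  assumes t: "0 < t"
  shows "has_bochner_integral lborel (\<lambda>y. indicator {0<..} y * (exp (- y) * G (t * y))) (LINT x|L. exp (- (1 / t) * x))"
proof (rule has_bochner_integral_nn_integral)
  show "(\<lambda>y. indicator {0<..} y * (exp (- y) * G (t * y))) \<in> borel_measurable lborel" by measurable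
  show "AE y in lborel. 0 \<le> indicator {0<..} y * (exp (- y) * G (t * y))" using G_nonneg by simp
  show "0 \<le> (LINT x|L. exp (- (1 / t) * x))" by simp
  have G0: "G s = 0" if "s \<le> 0" for s
  proof -
    have "G s \<le> G 0" using that cdf_nondecreasing by auto
    also have "G 0 = 0"
    proof -
      have "AE x in L. x \<notin> {0}" using no_atoms[of 0] by (intro AE_not_in) (auto simp: null_sets_def)
      with L(3) have "AE x in L. x \<notin> {..0}" by eventually_elim auto
      then have "emeasure L {..0} = 0" by (subst (asm) AE_iff_null_sets[symmetric]) (auto simp: null_sets_def)
      then show ?thesis by (simp add: cdf_def emeasure_eq_measure)
    qed
    finally show ?thesis using G_nonneg[of s] by simp
  qed
  have int: "integrable L (\<lambda>x. exp (- (1 / t) * x))" by (rule laplace_integrable[OF L]) (use t in simp)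
  have "ennreal (LINT x|L. exp (- (1 / t) * x)) = (\<integral>\<^sup>+x. ennreal (exp (- (1 / t) * x)) \<partial>L)"
    by (rule nn_integral_eq_integral[OF int, symmetric]) simp
  also have "\<dots> = (\<integral>\<^sup>+x. (\<integral>\<^sup>+y. ennreal (exp (- y)) * (if x \<le> t * y then 1 else 0) \<partial>lborel) \<partial>L)"
  proof (rule nn_integral_cong)
    fix x
    have "(\<integral>\<^sup>+y. ennreal (exp (- y)) * (if x \<le> t * y then 1 else 0) \<partial>lborel) =
      (\<integral>\<^sup>+y. ennreal (1 * exp (- 1 * y)) * indicator {x / t..} y \<partial>lborel)"
      by (rule nn_integral_cong) (use t in \<open>auto split: split_indicator simp: field_simps\<close>)
    also have "\<dots> = ennreal (exp (- 1 * (x / t)))" by (rule nn_integral_exp_atLeast) simp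
    finally show "ennreal (exp (- (1 / t) * x)) = (\<integral>\<^sup>+y. ennreal (exp (- y)) * (if x \<le> t * y then 1 else 0) \<partial>lborel)"
      by simp
  qed
  also have "\<dots> = (\<integral>\<^sup>+y. (\<integral>\<^sup>+x. ennreal (exp (- y)) * (if x \<le> t * y then 1 else 0) \<partial>L) \<partial>lborel)"
    by (rule Fubini') measurable
  also have "\<dots> = (\<integral>\<^sup>+y. ennreal (indicator {0<..} y * (exp (- y) * G (t * y))) \<partial>lborel)"
  proof (rule nn_integral_cong)
    fix y
    have "(\<integral>\<^sup>+x. ennreal (exp (- y)) * (if x \<le> t * y then 1 else 0) \<partial>L) = (\<integral>\<^sup>+x. ennreal (exp (- y)) * indicator {..t * y} x \<partial>L)"
      by (rule nn_integral_cong) (auto split: split_indicator)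
    also have "\<dots> = ennreal (exp (- y) * G (t * y))"
      by (simp add: nn_integral_cmult_indicator emeasure_eq_measure cdf_def ennreal_mult)
    also have "\<dots> = ennreal (indicator {0<..} y * (exp (- y) * G (t * y)))"
    proof (cases "0 < y")
      case False
      then have "t * y \<le> 0" using t by (simp add: mult_le_0_iff)
      then show ?thesis using False G0 by simp
    qed simp
    finally show "(\<integral>\<^sup>+x. ennreal (exp (- y)) * (if x \<le> t * y then 1 else 0) \<partial>L) =
      ennreal (indicator {0<..} y * (exp (- y) * G (t * y)))" .
  qed
  finally show "(\<integral>\<^sup>+y. ennreal (indicator {0<..} y * (exp (- y) * G (t * y))) \<partial>lborel) = ennreal (LINT x|L. exp (- (1 / t) * x))" by simp
qed

text \<open>The Abelian half of Karamata's theorem; the power bounds on \<open>G\<close> play the role of Potter's bounds.\<close>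

lemma laplace_over_G: "((\<lambda>t. (LINT x|L. exp (- (1 / t) * x)) / G t) \<longlongrightarrow> Gamma (1 + c)) (at_right 0)"
proof -
  define e where "e = min 1 (c / 2)"
  have e: "0 < e" "e < c" "e \<le> 1" using c_pos by (auto simp: e_def)
  obtain d where d: "0 < d" "\<And>x. 0 < x \<Longrightarrow> x < d \<Longrightarrow> \<bar>k x - c\<bar> < e" using k_near_0[OF e(1)] by blast
  \<comment> \<open>The power bound reaches only arguments below \<open>d\<close>. Beyond,
    \<open>G (t * y) \<le> 1\<close>, and comparing \<open>G t\<close> with \<open>G (d / 2)\<close>
    costs the factor \<open>1 / G (d / 2)\<close>; the summand 1 covers the range below
    \<open>d\<close>.\<close>
  define B where "B = 1 + 1 / G (d / 2)"
  have Gd: "0 < G (d / 2)" using G_pos d by simp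
  have B: "1 \<le> B" "1 / G (d / 2) \<le> B" using Gd by (auto simp: B_def)
  have ratio: "G (t * y) / G t \<le> 1 + B * y powr (c + e)" if t: "0 < t" "t < d / 2" and y: "0 < y" for t y
  proof -
    have Gt: "0 < G t" by (rule G_pos[OF t(1)])
    have p: "0 \<le> B * y powr (c + e)" using B by simp
    consider "y \<le> 1" | "1 < y" "t * y < d" | "1 < y" "d \<le> t * y" by linarith
    then show ?thesis
    proof cases
      case 1
      then have "t * y \<le> t" using t by simp
      then have "G (t * y) \<le> G t" by (rule cdf_nondecreasing)
      then have "G (t * y) / G t \<le> 1" using Gt by simp
      then show ?thesis using p by linarith
    next
      case 2
      then have "G (t * y) \<le> G t * ((t * y) / t) powr (c + e)"
        using t by (intro G_power_bounds(1)[OF d(2) e(1,2)]) auto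
      then have "G (t * y) / G t \<le> 1 * y powr (c + e)" using Gt t by (simp add: pos_divide_le_eq mult.commute)
      also have "\<dots> \<le> B * y powr (c + e)" by (rule mult_right_mono[OF B(1)]) simp
      finally show ?thesis by simp
    next
      case 3
      have "G (d / 2) \<le> G t * ((d / 2) / t) powr (c + e)"
        using t d by (intro G_power_bounds(1)[OF d(2) e(1,2)]) auto
      also have "\<dots> \<le> G t * y powr (c + e)"
      proof (intro mult_left_mono powr_mono2)
        show "d / 2 / t \<le> y" using 3 t d(1) by (simp add: field_simps)
      qed (use t d c_pos e Gt in auto)
      finally have "1 / G t \<le> (1 / G (d / 2)) * y powr (c + e)" using Gd Gt by (simp add: field_simps)
      also have "\<dots> \<le> B * y powr (c + e)" by (rule mult_right_mono[OF B(2)]) simp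
      finally have "1 / G t \<le> B * y powr (c + e)" .
      moreover have "G (t * y) / G t \<le> 1 / G t" using Gt G_le_1 by (intro divide_right_mono) auto
      ultimately show ?thesis by linarith
    qed
  qed
  have Gam: "has_bochner_integral lborel (\<lambda>y. indicator {0<..} y * (y powr a * exp (- y))) (Gamma (1 + a))" if "0 \<le> a" for a :: real
    using Gamma_has_bochner_integral[of "1 + a"] that by simp
  have lim: "((\<lambda>t. LINT y|lborel. indicator {0<..} y * (exp (- y) * (G (t * y) / G t))) \<longlongrightarrow>
     (LINT y|lborel. indicator {0<..} y * (y powr c * exp (- y)))) (at_right 0)"
  proof (rule integral_dominated_convergence_within)
    show "integrable lborel (\<lambda>y. indicator {0<..} y * (y powr 0 * exp (- y)) + B * (indicator {0<..} y * (y powr (c + e) * exp (- y))))"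
      using Gam[of 0] Gam[of "c + e"] c_pos e by (auto simp: has_bochner_integral_iff)
    show "AE y in lborel. ((\<lambda>t. indicator {0<..} y * (exp (- y) * (G (t * y) / G t))) \<longlongrightarrow>
        indicator {0<..} y * (y powr c * exp (- y))) (at_right 0)"
    proof (rule AE_I2)
      fix y :: real
      show "((\<lambda>t. indicator {0<..} y * (exp (- y) * (G (t * y) / G t))) \<longlongrightarrow>
        indicator {0<..} y * (y powr c * exp (- y))) (at_right 0)"
      proof (cases "0 < y")
        case True
        have "((\<lambda>t. ln (G (t * y)) - ln (G t)) \<longlongrightarrow> c * ln y) (at_right 0)"
          by (rule log_increment_tendsto[OF G_log_increment c_pos True])
        then have "((\<lambda>t. exp (ln (G (t * y)) - ln (G t))) \<longlongrightarrow> exp (c * ln y)) (at_right 0)"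
          by (intro tendsto_exp)
        moreover have "\<forall>\<^sub>F t in at_right 0. exp (ln (G (t * y)) - ln (G t)) = G (t * y) / G t"
          using eventually_at_right_less[of "0::real"]
          by eventually_elim (use True G_pos in \<open>simp add: exp_diff\<close>)
        ultimately have "((\<lambda>t. G (t * y) / G t) \<longlongrightarrow> exp (c * ln y)) (at_right 0)"
          by (rule Lim_transform_eventually)
        then have "((\<lambda>t. indicator {0<..} y * (exp (- y) * (G (t * y) / G t))) \<longlongrightarrow>
           indicator {0<..} y * (exp (- y) * exp (c * ln y))) (at_right 0)"
          by (intro tendsto_mult tendsto_const)
        then show ?thesis using True by (simp add: powr_def mult.commute)
      qed simp
    qed
    have "\<forall>\<^sub>F t in at_right 0. t \<in> {0<..<d / 2}" by (rule eventually_at_right_real) (use d in simp)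
    then show "\<forall>\<^sub>F t in at_right 0. AE y in lborel. norm (indicator {0<..} y * (exp (- y) * (G (t * y) / G t)))
        \<le> indicator {0<..} y * (y powr 0 * exp (- y)) + B * (indicator {0<..} y * (y powr (c + e) * exp (- y)))"
    proof eventually_elim
      case (elim t)
      have "norm (indicator {0<..} y * (exp (- y) * (G (t * y) / G t)))
        \<le> indicator {0<..} y * (y powr 0 * exp (- y)) + B * (indicator {0<..} y * (y powr (c + e) * exp (- y)))" for y
      proof (cases "0 < y")
        case True
        have "exp (- y) * (G (t * y) / G t) \<le> exp (- y) * (1 + B * y powr (c + e))"
          by (rule mult_left_mono[OF ratio]) (use elim True in auto)
        then show ?thesis using True G_nonneg by (simp add: algebra_simps)
      qed simp
      then show ?case by simp
    qed
  qed measurable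
  have eq: "(LINT y|lborel. indicator {0<..} y * (y powr c * exp (- y))) = Gamma (1 + c)"
    using Gam[of c] c_pos by (simp add: has_bochner_integral_iff)
  have ev: "\<forall>\<^sub>F t in at_right 0. (LINT y|lborel. indicator {0<..} y * (exp (- y) * (G (t * y) / G t))) =
      (LINT x|L. exp (- (1 / t) * x)) / G t"
    using eventually_at_right_less[of "0::real"]
  proof eventually_elim
    case (elim t)
    have "(LINT y|lborel. indicator {0<..} y * (exp (- y) * (G (t * y) / G t))) =
      (LINT y|lborel. indicator {0<..} y * (exp (- y) * G (t * y)) / G t)" by simp
    also have "\<dots> = (LINT y|lborel. indicator {0<..} y * (exp (- y) * G (t * y))) / G t" by (rule integral_divide_zero)
    also have "\<dots> = (LINT x|L. exp (- (1 / t) * x)) / G t"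
      using laplace_eq_G[OF elim] by (simp add: has_bochner_integral_iff)
    finally show ?case .
  qed
  show ?thesis using Lim_transform_eventually[OF lim ev] unfolding eq .
qed

text \<open>The difference between the cut-off at 1 and the exponential, relative to
  \<open>dy / y\<close>. Its integral is Euler's constant, and the negative of that integral is the
  factor of \<open>c\<close> in the exponent of \<kappa>.\<close>

definition p :: "real \<Rightarrow> real" where
  "p y = indicator {0<..} y * ((indicator {..1} y - exp (- y)) / y)"

lemma p_measurable[measurable]: "p \<in> borel_measurable borel"
  unfolding p_def by measurable

lemma p_bound: "\<bar>p y\<bar> \<le> indicator {0<..1} y + indicator {0<..} y * exp (- y)"
proof (cases "0 < y")
  case True
  show ?thesis
  proof (cases "y \<le> 1")
    case y1: True
    have "1 - exp (- y) \<le> y" using exp_ge_add_one_self[of "- y"] by linarith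
    then have "\<bar>p y\<bar> \<le> 1" using True y1 by (simp add: p_def)
    then show ?thesis using True y1 by (simp add: add_increasing2)
  next
    case False
    have "exp (- y) / y \<le> exp (- y) / 1" using False by (intro divide_left_mono) auto
    then show ?thesis using False by (simp add: p_def)
  qed
qed (simp add: p_def)

lemma p_bound_integrable: "integrable lborel (\<lambda>y::real. indicator {0<..1} y + indicator {0<..} y * exp (- y))"
proof (rule Bochner_Integration.integrable_add)
  show "integrable lborel (\<lambda>y::real. indicator {0<..1} y :: real)" by (rule integrable_real_indicator) auto
  show "integrable lborel (\<lambda>y::real. indicator {0<..} y * exp (- y))"
  proof -
    have "integrable lborel (\<lambda>y::real. indicator {0<..} y * (y powr (1 - 1) * exp (- y)))"
      by (rule integrable.intros[OF Gamma_has_bochner_integral]) simp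
    also have "(\<lambda>y::real. indicator {0<..} y * (y powr (1 - 1) * exp (- y))) = (\<lambda>y. indicator {0<..} y * exp (- y))"
      by (auto simp: fun_eq_iff split: split_indicator)
    finally show ?thesis .
  qed
qed

text \<open>
  Up to a constant the Levy-Khintchine exponent at \<open>1 / t\<close> exceeds \<open>J(t)\<close> by \<open>\<integral> p(y) k(t y) dy\<close>, after the
  substitution \<open>x = t y\<close>.
\<close>

lemma laplace_times_exp_J:
  "((\<lambda>t. (LINT x|L. exp (- (1 / t) * x)) * exp (J t)) \<longlongrightarrow>
     exp (- (c * (LINT y|lborel. p y)) - (LINT x|lborel. indicator {1<..} x * (k x / x)))) (at_right 0)"
proof -
  define T where "T = (LINT x|lborel. indicator {1<..} x * (k x / x))"
  obtain d where d: "0 < d" "\<And>x. 0 < x \<Longrightarrow> x < d \<Longrightarrow> \<bar>k x - c\<bar> < 1" using k_near_0[of 1] by auto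
  \<comment> \<open>Below \<open>d'\<close> the function \<open>k\<close> is bounded; above it only
    integrability of \<open>k x / x\<close> is available. Hence the split into \<open>q1\<close>,
    treated by scaling, and \<open>q2\<close>, made small by the exponential.\<close>
  define d' where "d' = min d 1"
  have d': "0 < d'" "d' \<le> 1" "\<And>x. x < d' \<Longrightarrow> k x \<le> c + 1"
  proof -
    show "k x \<le> c + 1" if "x < d'" for x
      using d(2)[of x] that k0(2)[of x] c_pos by (cases "0 < x") (auto simp: d'_def abs_less_iff)
  qed (use d in \<open>auto simp: d'_def\<close>)
  \<comment> \<open>The Levy-Khintchine integrand at \<open>1 / t\<close> less
    \<open>k x / x\<close> on \<open>x > t\<close>, that is, less the integrands of
    \<open>J t\<close> and \<open>T\<close>.\<close>
  define q where "q t x = (indicator {..t} x - exp (- (1 / t) * x)) * (k x / x)" for t x :: real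
  define q1 where "q1 t x = indicator {..<d'} x * q t x" for t x :: real
  define q2 where "q2 t x = indicator {d'..} x * (exp (- (1 / t) * x) * (k x / x))" for t x :: real
  have [measurable]: "q t \<in> borel_measurable borel" "q1 t \<in> borel_measurable borel" "q2 t \<in> borel_measurable borel" for t
    unfolding q_def q1_def q2_def by measurable
  have q2_lim: "((\<lambda>t. LINT x|lborel. q2 t x) \<longlongrightarrow> (LINT x::real|lborel. 0)) (at_right 0)"
  proof (rule integral_dominated_convergence_within)
    show "integrable lborel (\<lambda>x. indicator {d'..} x * (k x / x))"
      by (rule k_over_id_integrable_subset[of "d' / 2"]) (use d' in auto)
    show "AE x in lborel. ((\<lambda>t. q2 t x) \<longlongrightarrow> 0) (at_right 0)"
    proof (rule AE_I2)
      fix x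
      show "((\<lambda>t. q2 t x) \<longlongrightarrow> 0) (at_right 0)"
      proof (cases "d' \<le> x")
        case True
        have "filterlim (\<lambda>t::real. 1 / t) at_top (at_right 0)"
          using filterlim_inverse_at_top_right by (simp add: inverse_eq_divide)
        then have "LIM t at_right 0. - x * (1 / t) :> at_bot"
          by (rule filterlim_tendsto_neg_mult_at_bot[OF tendsto_const, rotated]) (use True d' in simp)
        then have "((\<lambda>t. exp (- x * (1 / t))) \<longlongrightarrow> 0) (at_right 0)" by (rule filterlim_compose[OF exp_at_bot])
        then have "((\<lambda>t. indicator {d'..} x * (exp (- x * (1 / t)) * (k x / x))) \<longlongrightarrow> indicator {d'..} x * (0 * (k x / x))) (at_right 0)"
          by (intro tendsto_mult tendsto_const)
        then show ?thesis by (simp add: q2_def)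
      qed (simp add: q2_def)
    qed
    show "\<forall>\<^sub>F t in at_right 0. AE x in lborel. norm (q2 t x) \<le> indicator {d'..} x * (k x / x)"
      using eventually_at_right_less[of "0::real"]
    proof eventually_elim
      case (elim t)
      have "norm (q2 t x) \<le> indicator {d'..} x * (k x / x)" for x
      proof (cases "d' \<le> x")
        case True
        have "exp (- (1 / t) * x) * (k x / x) \<le> 1 * (k x / x)"
          by (rule mult_right_mono) (use True d' elim k0(1)[of x] in auto)
        then show ?thesis using True d' k0(1)[of x] by (simp add: q2_def abs_mult)
      qed (simp add: q2_def)
      then show ?case by simp
    qed
  qed measurable
  have scale: "(LINT x|lborel. q1 t x) = (LINT y|lborel. indicator {..<d'} (t * y) * (p y * k (t * y)))" if t: "0 < t" for t
  proof -
    have "(LINT x|lborel. q1 t x) = \<bar>t\<bar> *\<^sub>R (LINT y|lborel. q1 t (0 + t * y))"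
      by (rule lborel_integral_real_affine) (use t in simp)
    also have "\<dots> = (LINT y|lborel. t * q1 t (t * y))" using t by simp
    also have "\<dots> = (LINT y|lborel. indicator {..<d'} (t * y) * (p y * k (t * y)))"
    proof (rule Bochner_Integration.integral_cong[OF refl])
      fix y
      show "t * q1 t (t * y) = indicator {..<d'} (t * y) * (p y * k (t * y))"
      proof (cases "0 < y")
        case True
        then have "indicator {..t} (t * y) = (indicator {..1} y :: real)" using t by (auto simp: indicator_def)
        then show ?thesis using t True by (simp add: q1_def q_def p_def)
      next
        case False
        then have "t * y \<le> 0" using t by (simp add: mult_le_0_iff)
        then show ?thesis by (simp add: q1_def q_def k0(2))
      qed
    qed
    finally show ?thesis .
  qed
  have q1_lim: "((\<lambda>t. LINT y|lborel. indicator {..<d'} (t * y) * (p y * k (t * y))) \<longlongrightarrow> (LINT y|lborel. p y * c)) (at_right 0)"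
  proof (rule integral_dominated_convergence_within)
    show "integrable lborel (\<lambda>y::real. (indicator {0<..1} y + indicator {0<..} y * exp (- y)) * (c + 1))"
      by (rule integrable_mult_left[OF p_bound_integrable])
    show "AE y in lborel. ((\<lambda>t. indicator {..<d'} (t * y) * (p y * k (t * y))) \<longlongrightarrow> p y * c) (at_right 0)"
    proof (rule AE_I2)
      fix y
      show "((\<lambda>t. indicator {..<d'} (t * y) * (p y * k (t * y))) \<longlongrightarrow> p y * c) (at_right 0)"
      proof (cases "0 < y")
        case True
        have "filterlim (\<lambda>t. t * y) (at_right 0) (at_right 0)"
        proof (subst filterlim_at, intro conjI)
          have "((\<lambda>t. t * y) \<longlongrightarrow> 0 * y) (at_right 0)" by (intro tendsto_intros)
          then show "((\<lambda>t. t * y) \<longlongrightarrow> 0) (at_right 0)" by simp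
          show "\<forall>\<^sub>F t in at_right 0. t * y \<in> {0<..} \<and> t * y \<noteq> 0"
            using eventually_at_right_less[of "0::real"] by eventually_elim (use True in auto)
        qed
        then have "((\<lambda>t. k (t * y)) \<longlongrightarrow> c) (at_right 0)" by (rule filterlim_compose[OF k_lim])
        then have "((\<lambda>t. p y * k (t * y)) \<longlongrightarrow> p y * c) (at_right 0)" by (intro tendsto_mult tendsto_const)
        moreover have "\<forall>\<^sub>F t in at_right 0. t \<in> {0<..<d' / y}"
          by (rule eventually_at_right_real) (use True d' in simp)
        then have "\<forall>\<^sub>F t in at_right 0. p y * k (t * y) = indicator {..<d'} (t * y) * (p y * k (t * y))"
          by eventually_elim (use True in \<open>auto simp: field_simps\<close>)
        ultimately show ?thesis by (rule Lim_transform_eventually)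
      qed (simp add: p_def)
    qed
    show "\<forall>\<^sub>F t in at_right 0. AE y in lborel. norm (indicator {..<d'} (t * y) * (p y * k (t * y)))
        \<le> (indicator {0<..1} y + indicator {0<..} y * exp (- y)) * (c + 1)"
    proof (rule always_eventually, rule allI, rule AE_I2)
      fix t y :: real
      have b0: "0 \<le> (indicator {0<..1} y + indicator {0<..} y * exp (- y) :: real)" by simp
      show "norm (indicator {..<d'} (t * y) * (p y * k (t * y))) \<le> (indicator {0<..1} y + indicator {0<..} y * exp (- y)) * (c + 1)"
      proof (cases "t * y < d'")
        case True
        have "\<bar>p y\<bar> * \<bar>k (t * y)\<bar> \<le> (indicator {0<..1} y + indicator {0<..} y * exp (- y)) * (c + 1)"
          by (rule mult_mono[OF p_bound]) (use d'(3)[OF True] k0(1)[of "t * y"] b0 in auto)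
        then show ?thesis using True by (simp add: abs_mult)
      qed (use b0 c_pos in \<open>auto intro!: mult_nonneg_nonneg\<close>)
    qed
  qed measurable
  have q1i: "integrable lborel (q1 t)" and q2i: "integrable lborel (q2 t)"
    and decomp: "(LINT x|lborel. (1 - exp (- (1 / t) * x)) * k x / x) = (LINT x|lborel. q1 t x) - (LINT x|lborel. q2 t x) + J t + T"
    if t: "0 < t" "t < d'" for t
  proof -
    have lk: "integrable lborel (\<lambda>x. (1 - exp (- (1 / t) * x)) * k x / x)" by (rule levy_khintchine(1)) (use t in simp)
    have J: "integrable lborel (\<lambda>x. indicator {t<..1} x * (k x / x))" by (rule k_over_id_integrable_subset[OF t(1)]) auto
    have Ti: "integrable lborel (\<lambda>x. indicator {1<..} x * (k x / x))" by (rule k_over_id_integrable) simp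
    have qq: "(1 - exp (- (1 / t) * x)) * k x / x - indicator {t<..1} x * (k x / x) - indicator {1<..} x * (k x / x) = q t x" for x
    proof -
      have "(1 - exp (- (1 / t) * x)) * k x / x = k x / x - exp (- (1 / t) * x) * (k x / x)"
        by (simp add: diff_divide_distrib left_diff_distrib)
      then show ?thesis using t d' by (auto simp: q_def left_diff_distrib split: split_indicator)
    qed
    have qi: "integrable lborel (q t)"
      using Bochner_Integration.integrable_diff[OF Bochner_Integration.integrable_diff[OF lk J] Ti] by (simp only: qq)
    have qI: "(LINT x|lborel. q t x) = (LINT x|lborel. (1 - exp (- (1 / t) * x)) * k x / x) - J t - T"
      using Bochner_Integration.integral_diff[OF Bochner_Integration.integrable_diff[OF lk J] Ti]
        Bochner_Integration.integral_diff[OF lk J] unfolding J_def T_def by (simp only: qq)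
    show q1i: "integrable lborel (q1 t)"
      using integrable_mult_indicator[OF _ qi, of "{..<d'}"] by (simp add: q1_def[abs_def])
    \<comment> \<open>As \<open>t < d'\<close>, the indicator in \<open>q t\<close> vanishes from
      \<open>d'\<close> on, and only the exponential term is left.\<close>
    have q12: "q t x - q1 t x = - q2 t x" for x
      using t by (auto simp: q_def q1_def q2_def split: split_indicator)
    have "integrable lborel (\<lambda>x. - q2 t x)"
      using Bochner_Integration.integrable_diff[OF qi q1i] by (simp only: q12)
    then show "integrable lborel (q2 t)" by simp
    have "(LINT x|lborel. q t x) - (LINT x|lborel. q1 t x) = - (LINT x|lborel. q2 t x)"
      using Bochner_Integration.integral_diff[OF qi q1i] by (simp add: q12)
    then show "(LINT x|lborel. (1 - exp (- (1 / t) * x)) * k x / x) = (LINT x|lborel. q1 t x) - (LINT x|lborel. q2 t x) + J t + T"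
      using qI by simp
  qed
  have "((\<lambda>t. exp (- (LINT y|lborel. indicator {..<d'} (t * y) * (p y * k (t * y))) + (LINT x|lborel. q2 t x) - T)) \<longlongrightarrow>
      exp (- (LINT y|lborel. p y * c) + (LINT x::real|lborel. 0) - T)) (at_right 0)"
    by (intro tendsto_intros q1_lim q2_lim)
  moreover have "\<forall>\<^sub>F t in at_right 0. t \<in> {0<..<d'}" by (rule eventually_at_right_real) (use d' in simp)
  then have "\<forall>\<^sub>F t in at_right 0. exp (- (LINT y|lborel. indicator {..<d'} (t * y) * (p y * k (t * y))) + (LINT x|lborel. q2 t x) - T)
     = (LINT x|L. exp (- (1 / t) * x)) * exp (J t)"
  proof eventually_elim
    case (elim t)
    then have t: "0 < t" "t < d'" by auto
    have t1: "0 < 1 / t" using t by simp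
    show ?case
      unfolding levy_khintchine(2)[OF t1] decomp[OF t] scale[OF t(1), symmetric]
      by (simp flip: exp_add)
  qed
  ultimately have "((\<lambda>t. (LINT x|L. exp (- (1 / t) * x)) * exp (J t)) \<longlongrightarrow>
      exp (- (LINT y|lborel. p y * c) + (LINT x::real|lborel. 0) - T)) (at_right 0)"
    by (rule Lim_transform_eventually)
  then show ?thesis by (simp add: T_def mult.commute)
qed

lemma id_f0_over_G: "((\<lambda>t. t * f0 t / G t) \<longlongrightarrow> c) (at_right 0)"
proof (rule tendstoI)
  fix r :: real assume r: "0 < r"
  define e where "e = min (r / 2) (c / 2)"
  have e: "0 < e" "e < c" "e < r" using r c_pos by (auto simp: e_def min_def)
  obtain d where d: "0 < d" "\<And>x. 0 < x \<Longrightarrow> x < d \<Longrightarrow> \<bar>k x - c\<bar> < e" using k_near_0[OF e(1)] by blast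
  have "\<forall>\<^sub>F t in at_right 0. t \<in> {0<..<d}" by (rule eventually_at_right_real) (rule d)
  then show "\<forall>\<^sub>F t in at_right 0. dist (t * f0 t / G t) c < r"
  proof eventually_elim
    case (elim t)
    have Gt: "0 < G t" using elim by (intro G_pos) auto
    have "(c - e) * G t \<le> t * f0 t" "t * f0 t \<le> (c + e) * G t"
      using f0_bounds[where d=d and e=e and x=t] d(2) e elim by auto
    then have "c - e \<le> t * f0 t / G t" "t * f0 t / G t \<le> c + e"
      using Gt by (auto simp: pos_le_divide_eq pos_divide_le_eq)
    then show ?case using e(3) by (auto simp: dist_real_def abs_less_iff)
  qed
qed

text \<open>With D the transform at \<open>1 / t\<close>, the function factors as
  \<open>(t * f0 t / G t) / (D / G t) * (D * exp (J t))\<close>, and each factor has a known limit.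
  \<open>Gamma (1 + c) = c * Gamma c\<close> absorbs the \<open>c\<close> from the first
  one.\<close>

lemma f0_asymptotics:
  "((\<lambda>t. t * f0 t * exp (J t)) \<longlongrightarrow>
     exp (- (c * (LINT y|lborel. p y)) - (LINT x|lborel. indicator {1<..} x * (k x / x))) / Gamma c) (at_right 0)"
proof -
  let ?D = "\<lambda>t. (LINT x|L. exp (- (1 / t) * x))"
  let ?\<kappa> = "exp (- (c * (LINT y|lborel. p y)) - (LINT x|lborel. indicator {1<..} x * (k x / x)))"
  have "0 < Gamma (1 + c)" by (rule Gamma_real_pos) (use c_pos in simp)
  then have G0: "Gamma (1 + c) \<noteq> 0" by (rule less_imp_neq[symmetric])
  have G1: "Gamma (1 + c) = c * Gamma c" using c_pos Gamma_plus1[of c] by (simp add: add.commute nonpos_Ints_def)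
  have lim: "((\<lambda>t. (t * f0 t / G t) / (?D t / G t) * (?D t * exp (J t))) \<longlongrightarrow> c / Gamma (1 + c) * ?\<kappa>) (at_right 0)"
    by (intro tendsto_mult tendsto_divide id_f0_over_G laplace_over_G laplace_times_exp_J) (rule G0)
  have eq: "c / Gamma (1 + c) * ?\<kappa> = ?\<kappa> / Gamma c" using G1 c_pos by simp
  have ev: "\<forall>\<^sub>F t in at_right 0. (t * f0 t / G t) / (?D t / G t) * (?D t * exp (J t)) = t * f0 t * exp (J t)"
    using eventually_at_right_less[of "0::real"]
  proof eventually_elim
    case (elim t)
    have "0 < G t" by (rule G_pos[OF elim])
    moreover have "0 < ?D t" by (rule laplace_pos[OF L]) (use elim in simp)
    ultimately show ?case by simp
  qed
  show ?thesis using Lim_transform_eventually[OF lim ev] unfolding eq .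
qed

end

section \<open>The slowly varying factor and the constant\<close>

context laplace_ode
begin

lemma exp_interval_integral_eq:
  assumes t: "0 < t" "t \<le> 1"
  shows "exp (LBINT y=t..1. (c - k y) / y) = t powr (- c) * exp (- J t)"
proof -
  have hb: "has_bochner_integral lborel (\<lambda>y. indicator {t<..1} y * (1 / y)) (ln 1 - ln t)"
    by (rule has_bochner_integral_inverse_Ioc) (use t in auto)
  have ik: "integrable lborel (\<lambda>y. indicator {t<..1} y * (k y / y))"
    by (rule k_over_id_integrable_subset[OF t(1)]) auto
  have "(LBINT y=t..1. (c - k y) / y) = (LBINT y:{t<..1}. (c - k y) / y)"
    unfolding one_ereal_def by (rule interval_integral_Ioc) (use t in simp)
  also have "\<dots> = (LINT y|lborel. c * (indicator {t<..1} y * (1 / y)) - indicator {t<..1} y * (k y / y))"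
    unfolding set_lebesgue_integral_def
    by (rule Bochner_Integration.integral_cong) (auto simp: diff_divide_distrib split: split_indicator)
  also have "\<dots> = c * (ln 1 - ln t) - J t"
    unfolding J_def
    by (rule has_bochner_integral_integral_eq)
       (intro has_bochner_integral_diff has_bochner_integral_mult_right hb has_bochner_integral_integrable ik)
  finally show ?thesis using t by (simp add: powr_def exp_diff exp_minus divide_inverse)
qed

text \<open>Splitting the integral of \<open>p\<close> at 1 gives, up to sign, the first two
  integrals in \<kappa>.\<close>

lemma exp_constants_eq:
  "exp (c * (LBINT x=0..1. (exp (- x) - 1) / x) + c * (LBINT x=1..\<infinity>. exp (- x) / x) - (LBINT x=1..\<infinity>. k x / x))
     = exp (- (c * (LINT y|lborel. p y)) - (LINT x|lborel. indicator {1<..} x * (k x / x)))"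
proof -
  have pi: "integrable lborel p"
  proof (rule Bochner_Integration.integrable_bound[OF p_bound_integrable])
    show "AE y in lborel. norm (p y) \<le> norm (indicator {0<..1} y + indicator {0<..} y * exp (- y))"
      by (rule AE_I2) (use p_bound in \<open>simp add: abs_of_nonneg\<close>)
  qed measurable
  have I1: "(LBINT x=0..1. (exp (- x) - 1) / x) = (LINT x|lborel. - (indicator {..1} x * p x))"
  proof -
    have "(LBINT x=0..1. (exp (- x) - 1) / x) = (LBINT x:{0<..1}. (exp (- x) - 1) / x)"
      unfolding one_ereal_def zero_ereal_def by (rule interval_integral_Ioc) simp
    also have "\<dots> = (LINT x|lborel. - (indicator {..1} x * p x))"
      unfolding set_lebesgue_integral_def
      by (rule Bochner_Integration.integral_cong)
         (auto simp: p_def diff_divide_distrib split: split_indicator)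
    finally show ?thesis .
  qed
  have I2: "(LBINT x=1..\<infinity>. exp (- x) / x) = (LINT x|lborel. - (indicator {1<..} x * p x))"
    unfolding one_ereal_def interval_integral_to_infinity_eq set_lebesgue_integral_def
    by (rule Bochner_Integration.integral_cong) (auto simp: p_def split: split_indicator)
  have I3: "(LBINT x=1..\<infinity>. k x / x) = (LINT x|lborel. indicator {1<..} x * (k x / x))"
    unfolding one_ereal_def interval_integral_to_infinity_eq set_lebesgue_integral_def by simp
  have i: "integrable lborel (\<lambda>x. indicator A x * p x)" if "A \<in> sets borel" for A
    using integrable_mult_indicator[OF _ pi, of A] that by simp
  have "(LINT y|lborel. p y) = (LINT y|lborel. indicator {..1} y * p y + indicator {1<..} y * p y)"
    by (rule Bochner_Integration.integral_cong) (auto split: split_indicator)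
  also have "\<dots> = (LINT y|lborel. indicator {..1} y * p y) + (LINT y|lborel. indicator {1<..} y * p y)"
    by (rule Bochner_Integration.integral_add; rule i) auto
  finally show ?thesis unfolding I1 I2 I3 by (simp add: algebra_simps)
qed

text \<open>Near 0, \<open>K x\<close> is \<open>x powr (- c) * exp (- J x)\<close>, and
  \<open>exp (- J x)\<close> is regularly varying with index \<open>c\<close>; the two powers
  cancel.\<close>

lemma exp_interval_integral_slowly_varying:
  fixes K :: "real \<Rightarrow> real"
  assumes K: "\<And>x. 0 < x \<Longrightarrow> K x = exp (LBINT y=x..1. (c - k y) / y)"
  shows "slowly_varying_at_0 K"
  unfolding slowly_varying_at_0_def
proof (intro allI impI)
  fix a :: real assume a: "0 < a"
  have "((\<lambda>x. - J (x * a) - - J x) \<longlongrightarrow> c * ln a) (at_right 0)"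
    by (rule log_increment_tendsto[OF J_log_increment zero_less_one a])
  then have lim: "((\<lambda>x. exp (- J (x * a) - - J x - c * ln a)) \<longlongrightarrow> exp (c * ln a - c * ln a)) (at_right 0)"
    by (intro tendsto_exp tendsto_diff tendsto_const)
  have "\<forall>\<^sub>F x in at_right 0. x \<in> {0<..<min 1 (1 / a)}" by (rule eventually_at_right_real) (use a in simp)
  then have ev: "\<forall>\<^sub>F x in at_right 0. exp (- J (x * a) - - J x - c * ln a) = K (a * x) / K x"
  proof eventually_elim
    case (elim x)
    then have x: "0 < x" "x \<le> 1" "a * x \<le> 1" "0 < a * x" using a by (auto simp: field_simps)
    have "K (a * x) / K x = ((a * x) powr (- c) * exp (- J (a * x))) / (x powr (- c) * exp (- J x))"
      by (simp only: K[OF x(1)] K[OF x(4)] exp_interval_integral_eq[OF x(1,2)] exp_interval_integral_eq[OF x(4,3)])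
    also have "(a * x) powr (- c) = exp (- c * ln a) * x powr (- c)"
    proof -
      have "exp (- c * ln a) = a powr (- c)" using a by (simp add: powr_def)
      then show ?thesis using a x by (simp only: powr_mult)
    qed
    also have "exp (- c * ln a) * x powr (- c) * exp (- J (a * x)) / (x powr (- c) * exp (- J x))
        = exp (- c * ln a) * (exp (- J (a * x)) / exp (- J x))"
      using x by simp
    also have "\<dots> = exp (- J (x * a) - - J x - c * ln a)"
      by (simp add: mult.commute flip: exp_diff exp_add)
    finally show ?case by simp
  qed
  show "((\<lambda>x. K (a * x) / K x) \<longlongrightarrow> 1) (at_right 0)"
    using Lim_transform_eventually[OF lim ev] by simp
qed

lemma f0_asymp_equiv:
  fixes K :: "real \<Rightarrow> real"
  assumes K: "\<And>x. 0 < x \<Longrightarrow> K x = exp (LBINT y=x..1. (c - k y) / y)"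
    and \<kappa>: "\<kappa> = exp (c * (LBINT x=0..1. (exp (- x) - 1) / x) + c * (LBINT x=1..\<infinity>. exp (- x) / x) - (LBINT x=1..\<infinity>. k x / x))"
  shows "((\<lambda>t. f0 t / (\<kappa> / Gamma c * t powr (c - 1) * K t)) \<longlongrightarrow> 1) (at_right 0)"
proof -
  have Gc: "0 < Gamma c" by (rule Gamma_real_pos[OF c_pos])
  have \<kappa>0: "0 < \<kappa>" by (simp add: \<kappa>)
  have "((\<lambda>t. t * f0 t * exp (J t)) \<longlongrightarrow> \<kappa> / Gamma c) (at_right 0)"
    using f0_asymptotics unfolding \<kappa> exp_constants_eq .
  then have lim: "((\<lambda>t. t * f0 t * exp (J t) / (\<kappa> / Gamma c)) \<longlongrightarrow> (\<kappa> / Gamma c) / (\<kappa> / Gamma c)) (at_right 0)"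
    by (rule tendsto_divide[OF _ tendsto_const]) (use \<kappa>0 Gc in \<open>simp add: less_imp_neq[symmetric]\<close>)
  have "\<forall>\<^sub>F t in at_right 0. t \<in> {0<..<1::real}" by (rule eventually_at_right_real) simp
  then have ev: "\<forall>\<^sub>F t in at_right 0. t * f0 t * exp (J t) / (\<kappa> / Gamma c) = f0 t / (\<kappa> / Gamma c * t powr (c - 1) * K t)"
  proof eventually_elim
    case (elim t)
    then have t: "0 < t" "t \<le> 1" by auto
    have "t powr (c - 1) * (t powr (- c) * exp (- J t)) = inverse t * inverse (exp (J t))"
    proof -
      have "t powr (c - 1) * t powr (- c) = t powr (- 1)" by (simp flip: powr_add)
      also have "\<dots> = inverse t" using t by (simp add: powr_minus)
      finally show ?thesis by (simp add: exp_minus flip: mult.assoc)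
    qed
    then have e: "t powr (c - 1) * K t = inverse (t * exp (J t))"
      by (simp add: K[OF t(1)] exp_interval_integral_eq[OF t])
    show ?case unfolding mult.assoc[of "\<kappa> / Gamma c"] e using t by (simp add: field_simps)
  qed
  have "(\<kappa> / Gamma c) / (\<kappa> / Gamma c) = 1" using \<kappa>0 Gc by simp
  then show ?thesis using Lim_transform_eventually[OF lim ev] by (simp only:)
qed

end

text \<open>Differentiate \<open>\<integral> e\<^sup>-\<^sup>u\<^sup>x L(dx) = e\<^sup>-\<^sup>\<phi>\<^sup>(\<^sup>t\<^sup>,\<^sup>u\<^sup>) \<integral> e\<^sup>-\<^sup>\<psi>\<^sup>(\<^sup>t\<^sup>,\<^sup>u\<^sup>)\<^sup>x L(dx)\<close> at \<open>t = 0\<close>.\<close>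

lemma limit_distribution_laplace_ode:
  assumes mp: "markov_process P X" and chars: "functional_characteristics P X F R"
    and lim: "limit_distribution P X L" and u: "0 < u"
  shows "R u * (LINT x|L. x * exp (- u * x)) = - F u * (LINT x|L. exp (- u * x))"
proof -
  note L = limit_distributionD[OF lim]
  obtain \<phi> \<psi> where ex: "CBI_exponents P X \<phi> \<psi>"
    and F: "((\<lambda>t. \<phi> t u) has_real_derivative F u) (at_right 0)"
    and R: "((\<lambda>t. \<psi> t u) has_real_derivative R u) (at_right 0)"
    using chars u by (auto simp: functional_characteristics_def)
  define Lh where "Lh v = (LINT x|L. exp (- v * x))" for v
  have \<phi>0: "\<phi> 0 u = 0" and \<psi>0: "\<psi> 0 u = u" using CBI_exponents_at_0[OF mp ex] u by auto
  \<comment> \<open>The transform of \<open>L\<close> is differentiable from both sides at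
    \<open>\<psi> 0 u = u > 0\<close>, so the chain rule applies although \<open>\<psi>\<close> is
    differentiated from the right only.\<close>
  have DL: "(Lh has_real_derivative - (LINT x|L. x * exp (- u * x))) (at (\<psi> 0 u))"
    unfolding \<psi>0 Lh_def[abs_def] by (rule laplace_has_derivative[OF L u])
  have D\<psi>: "((\<lambda>t. Lh (\<psi> t u)) has_real_derivative - (LINT x|L. x * exp (- u * x)) * R u) (at_right 0)"
    by (rule DERIV_chain'[OF R DL])
  have "((\<lambda>t. exp (- \<phi> t u)) has_real_derivative exp (- \<phi> 0 u) * (- F u)) (at_right 0)"
    using F by (auto intro!: derivative_eq_intros)
  from DERIV_mult[OF this D\<psi>]
  have D: "((\<lambda>t. exp (- \<phi> t u) * Lh (\<psi> t u)) has_real_derivative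
      - F u * Lh u - (LINT x|L. x * exp (- u * x)) * R u) (at_right 0)"
    by (simp add: \<phi>0 \<psi>0)
  have const: "exp (- \<phi> t u) * Lh (\<psi> t u) = Lh u" if "0 \<le> t" for t
    using limit_distribution_invariant[OF mp ex lim that, of u] u by (simp add: Lh_def)
  have "((\<lambda>t. (exp (- \<phi> t u) * Lh (\<psi> t u) - exp (- \<phi> 0 u) * Lh (\<psi> 0 u)) / (t - 0)) \<longlongrightarrow>
      - F u * Lh u - (LINT x|L. x * exp (- u * x)) * R u) (at_right 0)"
    using D unfolding has_field_derivative_iff .
  moreover have "\<forall>\<^sub>F t in at_right 0. (exp (- \<phi> t u) * Lh (\<psi> t u) - exp (- \<phi> 0 u) * Lh (\<psi> 0 u)) / (t - 0) = 0"
    using eventually_at_right_less[of "0::real"] by eventually_elim (simp add: const)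
  ultimately have "((\<lambda>t::real. 0) \<longlongrightarrow> - F u * Lh u - (LINT x|L. x * exp (- u * x)) * R u) (at_right 0)"
    by (rule Lim_transform_eventually)
  then have "- F u * Lh u - (LINT x|L. x * exp (- u * x)) * R u = 0"
    by (simp add: tendsto_const_iff)
  then show ?thesis by (simp add: Lh_def algebra_simps)
qed

lemma density_shift:
  fixes L :: "real measure" and f :: "real \<Rightarrow> real"
  assumes sL: "sets L = sets borel" and [measurable]: "f \<in> borel_measurable borel"
    and d: "distr L borel (\<lambda>x. x - \<gamma>) = density lborel (\<lambda>x. ennreal (f x))"
  shows "L = density lborel (\<lambda>x. ennreal (f (x - \<gamma>)))"
proof (rule measure_eqI)
  have [measurable_cong]: "sets L = sets borel" by (rule sL)
  fix A assume "A \<in> sets L"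
  then have A[measurable]: "A \<in> sets borel" using sL by simp
  have spL: "space L = UNIV" using sets_eq_imp_space_eq[OF sL] by simp
  have B: "(\<lambda>x. x + \<gamma>) -` A \<in> sets borel" using measurable_sets[of "\<lambda>x. x + \<gamma>" borel borel A] by simp
  have "emeasure L A = emeasure (distr L borel (\<lambda>x. x - \<gamma>)) ((\<lambda>x. x + \<gamma>) -` A)"
    using B by (subst emeasure_distr) (auto simp: spL vimage_def)
  also have "\<dots> = (\<integral>\<^sup>+x. ennreal (f x) * indicator ((\<lambda>x. x + \<gamma>) -` A) x \<partial>lborel)"
    unfolding d using B by (simp add: emeasure_density)
  also have "\<dots> = ennreal \<bar>1\<bar> * (\<integral>\<^sup>+x. ennreal (f (- \<gamma> + 1 * x)) * indicator ((\<lambda>x. x + \<gamma>) -` A) (- \<gamma> + 1 * x) \<partial>lborel)"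
    by (rule nn_integral_real_affine) (use B in auto)
  also have "\<dots> = (\<integral>\<^sup>+x. ennreal (f (x - \<gamma>)) * indicator A x \<partial>lborel)"
    by (auto intro!: nn_integral_cong split: split_indicator)
  also have "\<dots> = emeasure (density lborel (\<lambda>x. ennreal (f (x - \<gamma>)))) A"
    by (simp add: emeasure_density)
  finally show "emeasure L A = emeasure (density lborel (\<lambda>x. ennreal (f (x - \<gamma>)))) A" .
qed (use sL in simp)

theorem proposition4p6:
  fixes P :: "real \<Rightarrow> 'w measure" and X :: "real \<Rightarrow> 'w \<Rightarrow> real"
    and b \<alpha> \<beta> c \<gamma> \<kappa> :: real and m \<mu> L :: "real measure" and W k K :: "real \<Rightarrow> real"
  assumes cbi: "conservative_CBI P X"
    and params: "admissible_parameters b m \<alpha> \<beta> \<mu>"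
    and chars: "functional_characteristics P X (immigration_mechanism b m) (branching_mechanism \<alpha> \<beta> \<mu>)"
    and limit: "limit_distribution P X L"
    and scale: "is_scale_function (branching_mechanism \<alpha> \<beta> \<mu>) W"
    and k_eq: "\<And>x. x > 0 \<Longrightarrow> k x = k_function b m W x"
    and \<gamma>_eq: "\<gamma> = real_of_ereal (ereal b / effective_drift \<alpha> \<beta> \<mu>)"
    and k_lim: "(k \<longlongrightarrow> c) (at_right 0)" and c_pos: "c > 0"
    and K_eq: "\<And>x. x > 0 \<Longrightarrow> K x = exp (LBINT y=x..1. (c - k y) / y)"
    and \<kappa>_eq: "\<kappa> = exp (c * (LBINT x=0..1. (exp (- x) - 1) / x)
                         + c * (LBINT x=1..\<infinity>. exp (- x) / x)
                         - (LBINT x=1..\<infinity>. k x / x))"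
  shows "slowly_varying_at_0 K \<and>
         (\<exists>f. f \<in> borel_measurable borel \<and> (\<forall>x. 0 \<le> f x) \<and>
              L = density lborel (\<lambda>x. ennreal (f x)) \<and>
              f \<sim>[at_right \<gamma>] (\<lambda>x. \<kappa> / Gamma c * (x - \<gamma>) powr (c - 1) * K (x - \<gamma>)))"
proof -
  let ?R = "branching_mechanism \<alpha> \<beta> \<mu>" and ?F = "immigration_mechanism b m"
  have mp: "markov_process P X" using cbi by (simp add: conservative_CBI_def)
  have pos: "0 < W x" if "0 < x" for x
    by (rule scale_function_pos[OF scale k_eq k_lim c_pos that])
  have Rneg: "?R u < 0" if "0 < u" for u by (rule scale_function_exponent_neg[OF scale pos that])
  note kf = k_function_laplace[OF params scale pos]
  \<comment> \<open>Replaces the drift, given through \<open>effective_drift\<close>, by the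
    constant that the Laplace transform of \<open>k\<close> produces.\<close>
  have \<gamma>: "\<gamma> = b * W 0"
    unfolding \<gamma>_eq
  proof (rule drift_over_effective_drift[OF _ _ Rneg _ kf(4,5)])
    show "levy_measure_pos \<mu>" "0 \<le> \<alpha>" using params unfolding admissible_parameters_def by blast+
    show "0 \<le> W 0" using scale unfolding is_scale_function_def by blast
  qed
  \<comment> \<open>The hypotheses determine \<open>k\<close> on \<open>(0, \<infinity>)\<close>
    only; the locale works with its extension by 0.\<close>
  define kk where "kk x = indicator {0<..} x * k_function b m W x" for x
  define kh where "kh u = - ?F u / ?R u - b * W 0" for u
  have kk: "kk \<in> borel_measurable borel" "0 \<le> kk x" "x \<le> 0 \<Longrightarrow> kk x = 0" "0 < x \<Longrightarrow> kk x = k x" for x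
    unfolding kk_def[abs_def] using kf(1) kf(2)[of x] k_eq[of x] by (auto split: split_indicator)
  have kh: "(\<integral>\<^sup>+x. ennreal (exp (- u * x) * kk x) \<partial>lborel) = ennreal (kh u)" "0 \<le> kh u" if u: "0 < u" for u
  proof -
    have "(\<integral>\<^sup>+x. ennreal (exp (- u * x) * kk x) \<partial>lborel) =
        (\<integral>\<^sup>+x\<in>{0<..}. ennreal (exp (- u * x) * k_function b m W x) \<partial>lborel)"
      by (intro nn_integral_cong) (auto simp: kk_def split: split_indicator)
    then show "(\<integral>\<^sup>+x. ennreal (exp (- u * x) * kk x) \<partial>lborel) = ennreal (kh u)"
      by (simp only: kf(3)[OF _ u] kh_def)
    show "0 \<le> kh u" using kf(6)[OF _ u] by (simp add: kh_def)
  qed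
  have kk_lim: "(kk \<longlongrightarrow> c) (at_right 0)"
    by (rule Lim_transform_eventually[OF k_lim])
       (use eventually_at_right_less[of "0::real"] in eventually_elim, simp add: kk)
  note lim_L = limit_distributionD[OF limit]
  have [measurable_cong]: "sets L = sets borel" by (rule lim_L)
  have ode: "(LINT x|L. x * exp (- u * x)) = (\<gamma> + kh u) * (LINT x|L. exp (- u * x))" if u: "0 < u" for u
    using limit_distribution_laplace_ode[OF mp chars limit u] Rneg[OF u]
    by (simp add: \<gamma> kh_def field_simps)
  \<comment> \<open>The exponent in the Levy-Khintchine form is nonnegative. This bound forces
    \<open>L\<close> to live on \<open>[\<gamma>, \<infinity>)\<close>, so that the shifted law is
    again a law on the half-line.\<close>
  have le1: "exp (\<gamma> * u) * (LINT x|L. exp (- u * x)) \<le> 1" if u: "0 < u" for u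
  proof -
    have "0 \<le> (LINT x|lborel. (1 - exp (- u * x)) * kk x / x)"
    proof (rule Bochner_Integration.integral_nonneg)
      fix x show "0 \<le> (1 - exp (- u * x)) * kk x / x"
        using kk(2)[of x] kk(3)[of x] u by (cases "0 < x") auto
    qed
    then show ?thesis
      using levy_khintchine_of_derivative(2)[OF lim_L kk(1-3) kh ode u] by simp
  qed
  have supp: "AE x in L. \<gamma> \<le> x" by (rule laplace_support[OF lim_L le1])
  define L0 where "L0 = distr L borel (\<lambda>x. x - \<gamma>)"
  have lap0: "(LINT x|L0. exp (- u * x)) = exp (\<gamma> * u) * (LINT x|L. exp (- u * x))" for u
  proof -
    have "(LINT x|L0. exp (- u * x)) = (LINT x|L. exp (- u * (x - \<gamma>)))"
      unfolding L0_def by (rule integral_distr) measurable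
    also have "\<dots> = (LINT x|L. exp (\<gamma> * u) * exp (- u * x))"
      by (rule Bochner_Integration.integral_cong) (simp_all add: algebra_simps flip: exp_add)
    finally show ?thesis by simp
  qed
  interpret laplace_ode L0 kk kh c
  proof (rule laplace_ode.intro)
    show "prob_space L0" unfolding L0_def by (rule prob_space.prob_space_distr[OF lim_L(1)]) measurable
    show "sets L0 = sets borel" by (simp add: L0_def)
    show "AE x in L0. 0 \<le> x" unfolding L0_def using supp by (subst AE_distr_iff) auto
    show "(LINT x|L0. x * exp (- u * x)) = kh u * (LINT x|L0. exp (- u * x))" if u: "0 < u" for u
    proof -
      have "(LINT x|L0. x * exp (- u * x)) = (LINT x|L. (x - \<gamma>) * exp (- u * (x - \<gamma>)))"
        unfolding L0_def by (rule integral_distr) measurable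
      also have "\<dots> = (LINT x|L. exp (\<gamma> * u) * (x * exp (- u * x) - \<gamma> * exp (- u * x)))"
      proof (rule Bochner_Integration.integral_cong[OF refl])
        fix x
        have "exp (- u * (x - \<gamma>)) = exp (\<gamma> * u) * exp (- u * x)" by (simp add: algebra_simps flip: exp_add)
        then show "(x - \<gamma>) * exp (- u * (x - \<gamma>)) = exp (\<gamma> * u) * (x * exp (- u * x) - \<gamma> * exp (- u * x))"
          by (simp add: algebra_simps)
      qed
      also have "\<dots> = exp (\<gamma> * u) * ((LINT x|L. x * exp (- u * x)) - \<gamma> * (LINT x|L. exp (- u * x)))"
        using laplace_moment_integrable[OF lim_L u] laplace_integrable[OF lim_L, of u] u by simp
      also have "\<dots> = kh u * (LINT x|L0. exp (- u * x))" unfolding ode[OF u] lap0 by (simp add: algebra_simps)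
      finally show ?thesis .
    qed
  qed (use kk kh kk_lim c_pos in auto)
  have K: "K x = exp (LBINT y=x..1. (c - kk y) / y)" if x: "0 < x" for x
  proof -
    have "(LBINT y=x..1. (c - k y) / y) = (LBINT y=x..1. (c - kk y) / y)"
    proof (rule interval_integral_cong)
      fix y assume "y \<in> einterval (min (ereal x) 1) (max (ereal x) 1)"
      then have "0 < y" using x by (auto simp: einterval_def min_def one_ereal_def split: if_splits)
      then show "(c - k y) / y = (c - kk y) / y" by (simp add: kk)
    qed
    then show ?thesis using K_eq[OF x] by simp
  qed
  have "(LBINT x=1..\<infinity>. k x / x) = (LBINT x=1..\<infinity>. kk x / x)"
    by (rule interval_integral_cong) (auto simp: einterval_def one_ereal_def kk)
  then have \<kappa>: "\<kappa> = exp (c * (LBINT x=0..1. (exp (- x) - 1) / x) + c * (LBINT x=1..\<infinity>. exp (- x) / x)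
      - (LBINT x=1..\<infinity>. kk x / x))"
    using \<kappa>_eq by simp
  show ?thesis
  proof (intro conjI exI[of _ "\<lambda>x. f0 (x - \<gamma>)"] allI)
    show "slowly_varying_at_0 K" by (rule exp_interval_integral_slowly_varying[OF K])
    show "(\<lambda>x. f0 (x - \<gamma>)) \<in> borel_measurable borel" by measurable
    show "0 \<le> f0 (x - \<gamma>)" for x by (rule f0_nonneg)
    show "L = density lborel (\<lambda>x. ennreal (f0 (x - \<gamma>)))"
      by (rule density_shift[OF lim_L(2) f0_measurable]) (use L_density in \<open>simp add: L0_def\<close>)
    show "(\<lambda>x. f0 (x - \<gamma>)) \<sim>[at_right \<gamma>] (\<lambda>x. \<kappa> / Gamma c * (x - \<gamma>) powr (c - 1) * K (x - \<gamma>))"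
      \<comment> \<open>Both functions depend on \<open>x - \<gamma>\<close> alone, so the limit at
        \<open>\<gamma>\<close> from the right becomes one at 0.\<close>
      by (rule asymp_equivI', subst filterlim_at_right_to_0) (use f0_asymp_equiv[OF K \<kappa>] in simp)
  qed
qed

end
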